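(* Let $P$ be a lattice $3$-polytope of width larger than one and size $n\ge 8$, and suppose $P$ is not merged. Then one of the following holds: (1) $P$ contains a unimodular tetrahedron (in particular it is spanning); (2) $P$ has sublattice index $2$ and $P\cong\conv\{(1,-1,0),(-1,1,0),(-1,-1,1),(0,0,n-4)\}$; (3) $P$ has sublattice index $3$ and $P\cong\conv\{(2,-1,1),(-1,2,-1),(-1,-1,0),(0,0,n-4)\}$.
   Context: A lattice $3$-polytope is a polytope in $\mathbb{R}^3$ with vertices in $\mathbb{Z}^3$ and dimension $3$; size is $|P\cap\mathbb{Z}^3|$; width is the minimum of $\max f(P)-\min f(P)$ over non-constant affine functionals $f$ with $f(\mathbb{Z}^3)\subseteq\mathbb{Z}$. Sublattice index: index in $\mathbb{Z}^3$ of the affine lattice generated by $P\cap\mathbb{Z}^3$; spanning means index $1$. $\cong$ is unimodular equivalence. A unimodular tetrahedron is a lattice tetrahedron of normalized volume $1$. For a vertex $v$ of $P$, $P^v:=\conv(P\cap\mathbb{Z}^3\setminus\{v\})$ and $P^{uv}:=(P^u)^v$. A lattice $3$-polytope $P$ of width $>1$ is merged if there exist two distinct vertices $u,v$ of $P$ such that $P^u$ and $P^v$ both have width larger than one and $P^{uv}$ is $3$-dimensional. *)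

theory Defs
  imports "HOL-Analysis.Analysis"
begin

definition int_lattice :: "(real^3) set"
  where "int_lattice = {x. \<forall>i. x $ i \<in> \<int>}"

definition lattice_polytope :: "(real^3) set \<Rightarrow> bool"
  where "lattice_polytope P \<longleftrightarrow> polytope P \<and> {v. v extreme_point_of P} \<subseteq> int_lattice"

definition lattice_3_polytope :: "(real^3) set \<Rightarrow> bool"
  where "lattice_3_polytope P \<longleftrightarrow> lattice_polytope P \<and> aff_dim P = 3"

definition lattice_size :: "(real^3) set \<Rightarrow> nat"
  where "lattice_size P = card (P \<inter> int_lattice)"

definition integer_affine_functional :: "(real^3 \<Rightarrow> real) \<Rightarrow> bool"
  where "integer_affine_functional f \<longleftrightarrow>
    (\<exists>a b. f = (\<lambda>x. a \<bullet> x + b)) \<and> f ` int_lattice \<subseteq> \<int>"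

(* For a nonempty lattice polytope the values in this set are nonnegative integers (the extrema
   of f are attained at vertices), so the infimum is a minimum. *)
definition lattice_width :: "(real^3) set \<Rightarrow> real"
  where "lattice_width P =
    Inf {(SUP x\<in>P. f x) - (INF x\<in>P. f x) | f.
           integer_affine_functional f \<and> \<not> f constant_on UNIV}"

definition affine_lattice :: "(real^3) set \<Rightarrow> (real^3) set"
  where "affine_lattice S =
    {\<Sum>x\<in>T. of_int (c x) *\<^sub>R x | T (c :: real^3 \<Rightarrow> int).
       finite T \<and> T \<subseteq> S \<and> (\<Sum>x\<in>T. c x) = 1}"

(* The integer translates of an affine lattice are the cosets in int_lattice of its direction
   subgroup, so counting them gives the index.  An infinite index yields 0. *)
definition sublattice_index :: "(real^3) set \<Rightarrow> nat"
  where "sublattice_index P =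
    card ((\<lambda>t. (+) t ` affine_lattice (P \<inter> int_lattice)) ` int_lattice)"

definition spanning :: "(real^3) set \<Rightarrow> bool"
  where "spanning P \<longleftrightarrow> sublattice_index P = 1"

definition unimodular_equiv :: "(real^3) set \<Rightarrow> (real^3) set \<Rightarrow> bool"  (infix \<open>\<cong>\<^sub>u\<close> 50)
  where "P \<cong>\<^sub>u Q \<longleftrightarrow>
    (\<exists>(A :: real^3^3) b. (\<forall>i j. A $ i $ j \<in> \<int>) \<and> \<bar>det A\<bar> = 1 \<and> b \<in> int_lattice \<and>
       Q = (\<lambda>x. A *v x + b) ` P)"

definition normalized_volume :: "(real^3) set \<Rightarrow> real"
  where "normalized_volume P = fact 3 * measure lebesgue P"

definition unimodular_tetrahedron :: "(real^3) set \<Rightarrow> bool"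
  where "unimodular_tetrahedron T \<longleftrightarrow>
    3 simplex T \<and> lattice_polytope T \<and> normalized_volume T = 1"

definition remove_point :: "(real^3) set \<Rightarrow> real^3 \<Rightarrow> (real^3) set"
  where "remove_point P v = convex hull (P \<inter> int_lattice - {v})"

definition merged :: "(real^3) set \<Rightarrow> bool"
  where "merged P \<longleftrightarrow>
    lattice_3_polytope P \<and> lattice_width P > 1 \<and>
    (\<exists>u v. u extreme_point_of P \<and> v extreme_point_of P \<and> u \<noteq> v \<and>
       lattice_width (remove_point P u) > 1 \<and>
       lattice_width (remove_point P v) > 1 \<and>
       aff_dim (remove_point (remove_point P u) v) = 3)"

end

theory Submission
  imports Defs
begin

text \<open>
  Suppose that no four lattice points of \<open>P\<close> form a unimodular tetrahedron. A vertex whose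
  removal leaves a polytope of width at most one provides a functional that takes two consecutive values
  on all other lattice points. If three such functionals are independent, then five lattice points lie
  in a unit cube, and three of them in a facet together with one in the opposite facet form a unimodular
  tetrahedron. If they are dependent, all other points project along the common kernel to corners
  of a unit square. Two collinear points below one of three occupied corners again give a unimodular
  tetrahedron, so all lattice points except the three vertices lie on one line. Vertices whose removal
  keeps the width larger than one lead to the same conclusion: as \<open>P\<close> is not merged, the
  complement of any two of them lies in a plane.

  It remains to study a lattice segment with at least five points together with three further
  points. Projecting along the segment yields three primitive planar vectors \<open>u\<^sub>i\<close> such that
  \<open>det (u\<^sub>i, u\<^sub>j)\<close> is never \<open>1\<close> or \<open>-1\<close>, and a lattice point close to the origin in a
  triangle \<open>0, u\<^sub>i, u\<^sub>j\<close> would lift to a lattice point of \<open>P\<close>. This forces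
  \<open>u\<^sub>j - u\<^sub>i\<close> to be divisible by \<open>det (u\<^sub>i, u\<^sub>j)\<close>, which leaves three configurations. Parity of the
  heights excludes one of them, and the other two are the exceptional families. The segment ends at the
  base of the tetrahedron, for otherwise its two endpoints would show that \<open>P\<close> is merged.
\<close>

section \<open>Integer vectors and unimodular simplices\<close>

text \<open>The combinatorics takes place over finite sets of integer vectors: saturation replaces
  convexity and determinants replace volumes, while real numbers appear only as barycentric
  coordinates and in the final translation to polytopes. The number eight enters by counting:
  discarding three points leaves five, one more than a unit square has corners, so two of them share
  a fibre of the projection and provide a primitive edge. The same five points give the segment
  length at least four, which is the origin of the weights 1/4 and 1/2 in the planar argument: above
  a point where the segment has weight \<open>c\<close>, the fibre has length at least
  \<open>4 * c\<close>. The overview passes over the mixed situation, a tetrahedron with two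
  vertices of each kind. It leads to no line but to a contradiction: either two lattice points on
  one edge are forced to coincide, or there is a pyramid of height one over a lattice triangle,
  which contains a unimodular tetrahedron.\<close>

definition ip :: "int^3 \<Rightarrow> int^3 \<Rightarrow> int"
  where "ip a b = a$1 * b$1 + a$2 * b$2 + a$3 * b$3"

definition icross :: "int^3 \<Rightarrow> int^3 \<Rightarrow> int^3"
  where "icross a b = vector [a$2 * b$3 - a$3 * b$2, a$3 * b$1 - a$1 * b$3, a$1 * b$2 - a$2 * b$1]"

definition idet :: "int^3 \<Rightarrow> int^3 \<Rightarrow> int^3 \<Rightarrow> int"
  where "idet a b c = ip a (icross b c)"

text \<open>Primitivity is witnessed by a dual vector, which by Bezout is equivalent to coprime
  coordinates. Later arguments use the witness itself, to read off multiples of \<open>e\<close> and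
  to extend \<open>e\<close> to a basis.\<close>

definition primitive :: "int^3 \<Rightarrow> bool"
  where "primitive e \<longleftrightarrow> (\<exists>b. ip b e = 1)"

lemmas ivec_simps = vec_eq_iff forall_3 ip_def icross_def idet_def

lemma ip_add [simp]: "ip f (a + b) = ip f a + ip f b"
  and ip_diff [simp]: "ip f (a - b) = ip f a - ip f b"
  and ip_scale [simp]: "ip f (k *s a) = k * ip f a"
  and ip_zero [simp]: "ip f 0 = 0"
  and ip_minus [simp]: "ip f (- a) = - ip f a"
  and ip_add_left [simp]: "ip (f + g) a = ip f a + ip g a"
  and ip_diff_left [simp]: "ip (f - g) a = ip f a - ip g a"
  and ip_scale_left [simp]: "ip (k *s f) a = k * ip f a"
  and ip_zero_left [simp]: "ip 0 a = 0"
  by (simp_all add: ip_def algebra_simps)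

lemma primitive_multiple_exists:
  assumes "v \<noteq> (0 :: int^3)"
  obtains k e where "k > 0" "primitive e" "v = k *s e"
proof -
  define h where "h = gcd (v$1) (v$2)"
  define g where "g = gcd h (v$3)"
  have "g \<noteq> 0"
    using assms by (auto simp: g_def h_def vec_eq_iff forall_3)
  then have "g > 0"
    by (simp add: g_def)
  have dvd: "g dvd v$1" "g dvd v$2" "g dvd v$3"
    unfolding g_def h_def by (meson dvd_trans gcd_dvd1 gcd_dvd2)+
  define e where "e = (vector [v$1 div g, v$2 div g, v$3 div g] :: int^3)"
  have v: "v = g *s e"
    using dvd by (simp add: e_def vec_eq_iff forall_3)
  obtain r s where rs: "r * v$1 + s * v$2 = h"
    unfolding h_def using bezout_int by metis
  obtain k l where kl: "k * h + l * v$3 = g"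
    unfolding g_def using bezout_int by metis
  define b where "b = (vector [k * r, k * s, l] :: int^3)"
  have "ip b v = k * (r * v$1 + s * v$2) + l * v$3"
    by (simp add: ip_def b_def algebra_simps)
  then have "ip b v = g"
    using rs kl by simp
  then have "g * ip b e = g * 1"
    using v by (metis ip_scale mult.right_neutral)
  then have "ip b e = 1"
    using \<open>g \<noteq> 0\<close> by simp
  then show ?thesis
    using that[of g e] \<open>g > 0\<close> v by (auto simp: primitive_def)
qed

lemma scale_cancel: "k \<noteq> 0 \<Longrightarrow> k *s a = k *s (b :: int^3) \<longleftrightarrow> a = b"
  by (auto simp: vec_eq_iff)

lemma icross_zero_imp_multiple:
  assumes "ip b e = 1" "icross e p = 0"
  shows "p = ip b p *s e"
proof -
  have "e$2 * p$3 = e$3 * p$2" "e$3 * p$1 = e$1 * p$3" "e$1 * p$2 = e$2 * p$1"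
    using assms(2) by (simp_all add: ivec_simps)
  moreover have "b$1 * e$1 + b$2 * e$2 + b$3 * e$3 = 1"
    using assms(1) by (simp add: ip_def)
  ultimately show ?thesis
    unfolding vec_eq_iff forall_3 ip_def vector_smult_component by (intro conjI; algebra)
qed

lemma icross_icross: "icross p (icross f g) = ip p g *s f - ip p f *s g"
  by (simp add: ivec_simps algebra_simps)

lemma ip_commute: "ip a b = ip b a"
  by (simp add: ip_def algebra_simps)

lemma icross_common_kernel:
  assumes "ip f1 p = 0" "ip f2 p = 0"
  shows "icross p (icross f1 f2) = 0"
  using assms by (simp add: icross_icross ip_commute[of p] vec_eq_iff)

lemma icross_skew: "icross a b = - icross b a"
  by (simp add: ivec_simps)

lemma ip_icross_left [simp]: "ip f1 (icross f1 f2) = 0" and ip_icross_right [simp]: "ip f2 (icross f1 f2) = 0"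
  by (simp_all add: ivec_simps algebra_simps)

text \<open>The common kernel has rank one: each member is parallel to the cross product, hence an
  integer multiple of its primitive part. The factor \<open>t\<close> need not be a unit, since
  \<open>f1\<close> and \<open>f2\<close> may fail to be part of a basis.\<close>

lemma kernel_generator:
  assumes "icross f1 f2 \<noteq> 0"
  obtains t e where "primitive e" "t \<noteq> 0" "icross f1 f2 = t *s e" "ip f1 e = 0" "ip f2 e = 0"
    "\<And>p. ip f1 p = 0 \<Longrightarrow> ip f2 p = 0 \<Longrightarrow> \<exists>k. p = k *s e"
proof -
  obtain t e where te: "t > 0" "primitive e" "icross f1 f2 = t *s e"
    using primitive_multiple_exists[OF assms] by metis
  obtain b where b: "ip b e = 1"
    using te(2) by (auto simp: primitive_def)
  have e0: "ip f1 e = 0" "ip f2 e = 0"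
    using te ip_icross_left[of f1 f2] ip_icross_right[of f2 f1] by auto
  have "\<exists>k. p = k *s e" if "ip f1 p = 0" "ip f2 p = 0" for p
  proof -
    have "icross p (icross f1 f2) = 0"
      by (rule icross_common_kernel) fact+
    moreover have "icross p (t *s e) = t *s icross p e"
      by (simp add: ivec_simps algebra_simps)
    ultimately have "t *s icross p e = t *s 0"
      by (simp add: te(3))
    then have "icross p e = 0"
      using te(1) scale_cancel by fastforce
    then have "icross e p = 0"
      using icross_skew[of e p] by simp
    then show ?thesis
      using icross_zero_imp_multiple[OF b] by blast
  qed
  then show ?thesis
    using that[of e t] te e0 by auto
qed

lemma binet_cauchy:
  "ip (icross f1 f2) (icross x y) = ip f1 x * ip f2 y - ip f1 y * ip f2 x"
  by (simp add: ivec_simps algebra_simps)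

text \<open>Product rule for determinants: the left side is the determinant of the matrix of values
  of the functionals on the vectors. Two zeros in its first row leave a single minor.\<close>

lemma idet_mult:
  assumes "ip f1 x = 0" "ip f1 y = 0"
  shows "idet f1 f2 f3 * idet x y z = ip f1 z * (ip f2 x * ip f3 y - ip f3 x * ip f2 y)"
proof -
  have "idet f1 f2 f3 * idet x y z =
      ip f1 x * (ip f2 y * ip f3 z - ip f2 z * ip f3 y)
      - ip f1 y * (ip f2 x * ip f3 z - ip f2 z * ip f3 x)
      + ip f1 z * (ip f2 x * ip f3 y - ip f3 x * ip f2 y)"
    by (simp add: ivec_simps algebra_simps)
  then show ?thesis
    using assms by simp
qed

lemma idet_nonzero_kernel:
  assumes "idet f1 f2 f3 \<noteq> 0" "ip f1 p = 0" "ip f2 p = 0" "ip f3 p = 0"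
  shows "p = 0"
proof -
  have "idet f1 f2 f3 *s p
      = ip f1 p *s icross f2 f3 + ip f2 p *s icross f3 f1 + ip f3 p *s icross f1 f2"
    by (simp add: ivec_simps algebra_simps)
  then have "idet f1 f2 f3 *s p = idet f1 f2 f3 *s 0"
    using assms by (simp add: vec_eq_iff)
  then show ?thesis
    using assms(1) scale_cancel by blast
qed

section \<open>Width, flatness and saturation for sets of integer points\<close>

definition spread1 :: "int^3 \<Rightarrow> (int^3) set \<Rightarrow> bool"
  where "spread1 f Y \<longleftrightarrow> (\<forall>p\<in>Y. \<forall>q\<in>Y. ip f p - ip f q \<le> 1)"

definition wide :: "(int^3) set \<Rightarrow> bool"
  where "wide Y \<longleftrightarrow> (\<forall>f. f \<noteq> 0 \<longrightarrow> \<not> spread1 f Y)"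

definition flat :: "(int^3) set \<Rightarrow> bool"
  where "flat Y \<longleftrightarrow> (\<forall>p\<in>Y. \<forall>q\<in>Y. \<forall>r\<in>Y. \<forall>s\<in>Y. idet (q - p) (r - p) (s - p) = 0)"

text \<open>The weights are cleared of their common denominator \<open>a + b + c + d\<close>, so
  that convexity is stated over the integers. Combinations of four points, which may coincide, cover
  all later uses.\<close>

definition saturated :: "(int^3) set \<Rightarrow> bool"
  where "saturated X \<longleftrightarrow> (\<forall>p\<in>X. \<forall>q\<in>X. \<forall>r\<in>X. \<forall>s\<in>X. \<forall>a\<ge>0. \<forall>b\<ge>0. \<forall>c\<ge>0. \<forall>d\<ge>0. \<forall>x.
    a + b + c + d > 0 \<longrightarrow> (a + b + c + d) *s x = a *s p + b *s q + c *s r + d *s s \<longrightarrow> x \<in> X)"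

definition no_unimodular :: "(int^3) set \<Rightarrow> bool"
  where "no_unimodular X \<longleftrightarrow>
    (\<forall>p\<in>X. \<forall>q\<in>X. \<forall>r\<in>X. \<forall>s\<in>X. \<bar>idet (q - p) (r - p) (s - p)\<bar> \<noteq> 1)"

lemma spread1_values:
  assumes "spread1 f Y"
  obtains c where "\<And>p. p \<in> Y \<Longrightarrow> ip f p = c \<or> ip f p = c + 1"
proof (cases "\<exists>p\<in>Y. \<exists>q\<in>Y. ip f p < ip f q")
  case True
  then obtain p q where pq: "p \<in> Y" "q \<in> Y" "ip f p < ip f q"
    by blast
  have "ip f r = ip f p \<or> ip f r = ip f p + 1" if "r \<in> Y" for r
  proof -
    have "ip f q - ip f r \<le> 1" "ip f r - ip f p \<le> 1"
      using assms pq that by (auto simp: spread1_def)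
    then show ?thesis
      using pq(3) by linarith
  qed
  then show ?thesis
    using that by blast
next
  case False
  show ?thesis
  proof (cases "Y = {}")
    case True
    then show ?thesis
      using that by blast
  next
    case ne: False
    then obtain p where "p \<in> Y"
      by blast
    then have "ip f r = ip f p" if "r \<in> Y" for r
      using False that by (meson linorder_neqE)
    then show ?thesis
      using that by blast
  qed
qed

lemma spread1_subset: "spread1 f Y \<Longrightarrow> Z \<subseteq> Y \<Longrightarrow> spread1 f Z"
  by (auto simp: spread1_def)

text \<open>Three corners of a unit square span a triangle of area 1/2. Taken relative to one of
  them, the others have entries in {-1, 0, 1}, which leaves finitely many cases.\<close>

lemma unit_square_det:
  fixes a b c d :: int
  assumes "\<bar>a\<bar> \<le> 1" "\<bar>b\<bar> \<le> 1" "\<bar>c\<bar> \<le> 1" "\<bar>d\<bar> \<le> 1" "\<bar>a - c\<bar> \<le> 1" "\<bar>b - d\<bar> \<le> 1"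
    "(a, b) \<noteq> (0, 0)" "(c, d) \<noteq> (0, 0)" "(a, b) \<noteq> (c, d)"
  shows "\<bar>a * d - c * b\<bar> = 1"
proof -
  have "\<forall>a\<in>{-1, 0, 1 :: int}. \<forall>b\<in>{-1, 0, 1 :: int}. \<forall>c\<in>{-1, 0, 1 :: int}. \<forall>d\<in>{-1, 0, 1 :: int}.
      \<bar>a - c\<bar> \<le> 1 \<longrightarrow> \<bar>b - d\<bar> \<le> 1 \<longrightarrow> (a, b) \<noteq> (0, 0) \<longrightarrow> (c, d) \<noteq> (0, 0) \<longrightarrow> (a, b) \<noteq> (c, d) \<longrightarrow>
      \<bar>a * d - c * b\<bar> = 1"
    by code_simp
  moreover have "a \<in> {-1, 0, 1}" "b \<in> {-1, 0, 1}" "c \<in> {-1, 0, 1}" "d \<in> {-1, 0, 1}"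
    using assms(1-4) by auto
  ultimately show ?thesis
    using assms(5-9) by blast
qed

lemma two_spread_card:
  assumes "finite Y" "spread1 f1 Y" "spread1 f2 Y"
  shows "card ((\<lambda>p. (ip f1 p, ip f2 p)) ` Y) \<le> 4"
proof -
  obtain c1 where c1: "\<And>p. p \<in> Y \<Longrightarrow> ip f1 p = c1 \<or> ip f1 p = c1 + 1"
    using spread1_values assms(2) by blast
  obtain c2 where c2: "\<And>p. p \<in> Y \<Longrightarrow> ip f2 p = c2 \<or> ip f2 p = c2 + 1"
    using spread1_values assms(3) by blast
  have "(\<lambda>p. (ip f1 p, ip f2 p)) ` Y \<subseteq> {c1, c1 + 1} \<times> {c2, c2 + 1}"
    using c1 c2 by auto
  moreover have "card ({c1, c1 + 1} \<times> {c2, c2 + 1}) = 4"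
    by (simp add: card_cartesian_product)
  moreover have "finite ({c1, c1 + 1} \<times> {c2, c2 + 1})"
    by simp
  ultimately show ?thesis
    using card_mono by metis
qed

locale lattice_points =
  fixes X :: "(int^3) set"
  assumes fin: "finite X"
    and sat: "saturated X"
    and nouni: "no_unimodular X"
    and wide: "wide X"
    and size: "card X \<ge> 8"
begin

lemma satD:
  assumes "p \<in> X" "q \<in> X" "r \<in> X" "s \<in> X" "a \<ge> 0" "b \<ge> 0" "c \<ge> 0" "d \<ge> 0" "k > 0"
    "k = a + b + c + d" "k *s x = a *s p + b *s q + c *s r + d *s s"
  shows "x \<in> X"
  using sat assms unfolding saturated_def by metis

lemma no_unit_det:
  assumes "p \<in> X" "q \<in> X" "r \<in> X" "s \<in> X"
  shows "\<bar>idet (q - p) (r - p) (s - p)\<bar> \<noteq> 1"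
  using nouni assms unfolding no_unimodular_def by metis

lemma adjacent_point:
  assumes "p \<in> X" "q \<in> X" "p \<noteq> q"
  obtains k e where "k > 0" "primitive e" "q - p = k *s e" "p + e \<in> X"
proof -
  obtain k e where ke: "k > 0" "primitive e" "q - p = k *s e"
    using primitive_multiple_exists[of "q - p"] assms(3) by auto
  have "q = p + k *s e"
    using ke(3) by (metis add.commute diff_add_cancel)
  then have "k *s (p + e) = (k - 1) *s p + 1 *s q + 0 *s p + 0 *s p"
    by (simp add: vec_eq_iff algebra_simps)
  then have "p + e \<in> X"
    by (rule satD[rotated -1]) (use assms ke in auto)
  then show ?thesis
    using that ke by blast
qed

text \<open>By Binet-Cauchy the minor of the projected triangle is \<open>t\<close> times a
  determinant involving \<open>e\<close>, where \<open>icross f1 f2 = t *s e\<close>. Integer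
  factors of a unit are units, so the edge from \<open>s1\<close> to \<open>s1 + e\<close> together
  with \<open>q\<close> and \<open>r\<close> is unimodular.\<close>

lemma no_unit_corner:
  assumes "s1 \<in> X" "s2 \<in> X" "s1 \<noteq> s2" "q \<in> X" "r \<in> X"
    and "ip f1 s1 = ip f1 s2" "ip f2 s1 = ip f2 s2"
    and "\<bar>ip f1 (q - s1) * ip f2 (r - s1) - ip f1 (r - s1) * ip f2 (q - s1)\<bar> = 1"
  shows False
proof -
  obtain k e where ke: "k > 0" "primitive e" "s2 - s1 = k *s e" "s1 + e \<in> X"
    using adjacent_point assms(1-3) by metis
  have "k * ip f1 e = 0" "k * ip f2 e = 0"
    using assms(6,7) ip_scale ke(3) by (metis diff_self ip_diff)+
  then have "ip f1 e = 0" "ip f2 e = 0"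
    using ke(1) by auto
  then have "icross e (icross f1 f2) = 0"
    by (rule icross_common_kernel)
  then obtain t where t: "icross f1 f2 = t *s e"
    using icross_zero_imp_multiple ke(2) unfolding primitive_def by blast
  have "\<bar>t * idet e (q - s1) (r - s1)\<bar> = 1"
    using assms(8) binet_cauchy[of f1 f2 "q - s1" "r - s1"] t
    by (simp add: idet_def)
  then have "\<bar>idet e (q - s1) (r - s1)\<bar> = 1"
    by (metis abs_mult abs_zmult_eq_1 mult.commute)
  then show False
    using no_unit_det[OF assms(1) ke(4) assms(4,5)] by simp
qed

text \<open>Five points over at most four corners put two into one corner. Of the three occupied
  corners at least two differ from it, and \<open>no_unit_corner\<close> applies.\<close>

lemma no_three_corners:
  assumes T: "T \<subseteq> X" "card T \<ge> 5" "spread1 f1 T" "spread1 f2 T"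
    and p: "p1 \<in> T" "p2 \<in> T" "p3 \<in> T"
    and ne: "(ip f1 p1, ip f2 p1) \<noteq> (ip f1 p2, ip f2 p2)"
      "(ip f1 p1, ip f2 p1) \<noteq> (ip f1 p3, ip f2 p3)"
      "(ip f1 p2, ip f2 p2) \<noteq> (ip f1 p3, ip f2 p3)"
  shows False
proof -
  let ?g = "\<lambda>p. (ip f1 p, ip f2 p)"
  have "finite T"
    using T fin finite_subset by blast
  then have "card (?g ` T) < card T"
    using two_spread_card[of T f1 f2] T by simp
  then have "\<not> inj_on ?g T"
    by (metis card_image less_irrefl)
  then obtain s1 s2 where s: "s1 \<in> T" "s2 \<in> T" "s1 \<noteq> s2" "?g s1 = ?g s2"
    unfolding inj_on_def by blast
  have "\<exists>q\<in>T. \<exists>r\<in>T. ?g q \<noteq> ?g s1 \<and> ?g r \<noteq> ?g s1 \<and> ?g q \<noteq> ?g r"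
    using p ne by metis
  then obtain q r where qr: "q \<in> T" "r \<in> T" "?g q \<noteq> ?g s1" "?g r \<noteq> ?g s1" "?g q \<noteq> ?g r"
    by blast
  have b: "\<bar>ip f1 x - ip f1 y\<bar> \<le> 1" "\<bar>ip f2 x - ip f2 y\<bar> \<le> 1" if "x \<in> T" "y \<in> T" for x y
    using T(3,4) that unfolding spread1_def by (smt (verit))+
  have "\<bar>ip f1 (q - s1) * ip f2 (r - s1) - ip f1 (r - s1) * ip f2 (q - s1)\<bar> = 1"
  proof (rule unit_square_det)
    show "\<bar>ip f1 (q - s1) - ip f1 (r - s1)\<bar> \<le> 1" "\<bar>ip f2 (q - s1) - ip f2 (r - s1)\<bar> \<le> 1"
      using b[OF qr(1,2)] by auto
  qed (use b s qr in auto)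
  then show False
    using no_unit_corner[of s1 s2 q r f1 f2] s qr T(1) by blast
qed

text \<open>Under \<open>f2\<close> and \<open>f3\<close> the three points become corners of a unit
  square, so their minor is a unit. The product rule then makes the determinant of the points a unit
  as well, although \<open>idet f1 f2 f3\<close> is only assumed nonzero.\<close>

lemma no_three_in_face:
  assumes "a1 \<in> X" "a2 \<in> X" "a3 \<in> X" "d \<in> X" "distinct [a1, a2, a3]"
    and f1: "ip f1 a2 = ip f1 a1" "ip f1 a3 = ip f1 a1" "\<bar>ip f1 d - ip f1 a1\<bar> = 1"
    and sp: "spread1 f2 {a1, a2, a3}" "spread1 f3 {a1, a2, a3}"
    and D: "idet f1 f2 f3 \<noteq> 0"
  shows False
proof -
  have ne: "(ip f2 x, ip f3 x) \<noteq> (ip f2 y, ip f3 y)" if "x \<noteq> y" "ip f1 x = ip f1 y" for x y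
    using idet_nonzero_kernel[OF D, of "x - y"] that by auto
  have b: "\<bar>ip f2 x - ip f2 y\<bar> \<le> 1" "\<bar>ip f3 x - ip f3 y\<bar> \<le> 1"
    if "x \<in> {a1, a2, a3}" "y \<in> {a1, a2, a3}" for x y
    using sp that unfolding spread1_def by (smt (verit))+
  have "\<bar>ip f2 (a2 - a1) * ip f3 (a3 - a1) - ip f2 (a3 - a1) * ip f3 (a2 - a1)\<bar> = 1"
  proof (rule unit_square_det)
    show "\<bar>ip f2 (a2 - a1) - ip f2 (a3 - a1)\<bar> \<le> 1" "\<bar>ip f3 (a2 - a1) - ip f3 (a3 - a1)\<bar> \<le> 1"
      using b[of a2 a3] by auto
    show "(ip f2 (a2 - a1), ip f3 (a2 - a1)) \<noteq> (ip f2 (a3 - a1), ip f3 (a3 - a1))"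
      using ne[of a2 a3] f1 assms(5) by auto
  qed (use b[of a2 a1] b[of a3 a1] ne[of a2 a1] ne[of a3 a1] f1 assms(5) in auto)
  then have "\<bar>idet f1 f2 f3 * idet (a2 - a1) (a3 - a1) (d - a1)\<bar> = 1"
    by (subst idet_mult) (use f1 in \<open>simp_all add: abs_mult mult.commute\<close>)
  then have "\<bar>idet (a2 - a1) (a3 - a1) (d - a1)\<bar> = 1"
    by (metis abs_mult abs_zmult_eq_1 mult.commute)
  then show False
    using no_unit_det assms by blast
qed

text \<open>The points lie in two opposite facets of a box, with at most four in each because the
  other two functionals separate them. Five points therefore leave at least three in one facet and
  at least one in the other.\<close>

lemma not_boxed:
  assumes T: "T \<subseteq> X" "card T \<ge> 5" "spread1 f1 T" "spread1 f2 T" "spread1 f3 T"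
  shows "idet f1 f2 f3 = 0"
proof (rule ccontr)
  assume D: "idet f1 f2 f3 \<noteq> 0"
  have "finite T"
    using T fin finite_subset by blast
  obtain c where c: "\<And>p. p \<in> T \<Longrightarrow> ip f1 p = c \<or> ip f1 p = c + 1"
    using spread1_values T(3) by blast
  define F where "F = (\<lambda>m. {p \<in> T. ip f1 p = m})"
  have finF: "finite (F m)" for m
    using \<open>finite T\<close> by (simp add: F_def)
  have "T = F c \<union> F (c + 1)"
    using c by (auto simp: F_def)
  then have "card (F c) + card (F (c + 1)) \<ge> 5"
    using T(2) card_Un_le[of "F c" "F (c + 1)"] by simp
  moreover have le4: "card (F m) \<le> 4" for m
  proof -
    have "inj_on (\<lambda>p. (ip f2 p, ip f3 p)) (F m)"
    proof (rule inj_onI)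
      fix x y assume "x \<in> F m" "y \<in> F m" "(ip f2 x, ip f3 x) = (ip f2 y, ip f3 y)"
      then show "x = y"
        using idet_nonzero_kernel[OF D, of "x - y"] by (auto simp: F_def)
    qed
    then have "card (F m) = card ((\<lambda>p. (ip f2 p, ip f3 p)) ` F m)"
      by (simp add: card_image)
    also have "\<dots> \<le> 4"
      by (intro two_spread_card finF) (use T spread1_subset in \<open>auto simp: F_def spread1_def\<close>)
    finally show ?thesis .
  qed
  ultimately have "\<exists>m m'. \<bar>m' - m\<bar> = 1 \<and> card (F m) \<ge> 3 \<and> card (F m') \<ge> 1"
  proof (cases "card (F c) \<ge> 3")
    case True
    then show ?thesis
      using le4[of c] \<open>5 \<le> card (F c) + card (F (c + 1))\<close> by (intro exI[of _ c] exI[of _ "c + 1"]) auto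
  next
    case False
    then show ?thesis
      using le4[of "c + 1"] \<open>5 \<le> card (F c) + card (F (c + 1))\<close>
      by (intro exI[of _ "c + 1"] exI[of _ c]) auto
  qed
  then obtain m m' where m: "\<bar>m' - m\<bar> = 1" "card (F m) \<ge> 3" "card (F m') \<ge> 1"
    by blast
  obtain d where d: "d \<in> F m'"
    using m(3) by fastforce
  obtain A where A: "A \<subseteq> F m" "card A = 3"
    using obtain_subset_with_card_n[OF m(2)] by metis
  then obtain a1 a2 a3 where a: "A = {a1, a2, a3}" "distinct [a1, a2, a3]"
    by (auto simp: card_3_iff)
  show False
  proof (rule no_three_in_face[of a1 a2 a3 d f1 f2 f3])
    show "spread1 f2 {a1, a2, a3}" "spread1 f3 {a1, a2, a3}"
      using T(4,5) A a by (auto simp: F_def spread1_def)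
  qed (use A a d m D T in \<open>auto simp: F_def\<close>)
qed

end

section \<open>Removing vertices\<close>

text \<open>Dividing by the content only shrinks differences of values. A primitive functional is
  wanted because any parallel one is then an integer multiple of it.\<close>

lemma not_wide_primitive:
  assumes "\<not> wide Y"
  obtains f where "primitive f" "spread1 f Y"
proof -
  obtain f where f: "f \<noteq> 0" "spread1 f Y"
    using assms by (auto simp: wide_def)
  obtain k g where kg: "k > 0" "primitive g" "f = k *s g"
    using primitive_multiple_exists[OF f(1)] by metis
  have "ip g p - ip g q \<le> 1" if "p \<in> Y" "q \<in> Y" for p q
  proof (rule ccontr)
    assume "\<not> ip g p - ip g q \<le> 1"
    then have "k * (ip g p - ip g q) \<ge> 1 * 2"
      using kg(1) by (intro mult_mono) auto
    moreover have "k * (ip g p - ip g q) \<le> 1"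
      using f(2) that by (simp add: spread1_def kg(3) right_diff_distrib)
    ultimately show False
      by simp
  qed
  then show ?thesis
    using that kg(2) by (auto simp: spread1_def)
qed

lemma orthogonal_exists:
  obtains g where "g \<noteq> (0 :: int^3)" "ip g e = 0"
proof (cases "e$1 = 0")
  case True
  then show ?thesis
    using that[of "vector [1, 0, 0]"] by (auto simp: ivec_simps)
next
  case False
  then show ?thesis
    using that[of "vector [e$2, - e$1, 0]"] by (auto simp: ivec_simps)
qed

text \<open>For noncollinear points the normal of three of them is constant on the whole set; for
  collinear points any functional vanishing on the direction works; for at most one point any
  nonzero functional does.\<close>

lemma flat_functional:
  assumes "flat Y"
  obtains g where "g \<noteq> 0" "\<And>p q. p \<in> Y \<Longrightarrow> q \<in> Y \<Longrightarrow> ip g p = ip g q"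
proof (cases "\<exists>p\<in>Y. \<exists>q\<in>Y. \<exists>r\<in>Y. icross (q - p) (r - p) \<noteq> 0")
  case True
  then obtain p q r where pqr: "p \<in> Y" "q \<in> Y" "r \<in> Y" "icross (q - p) (r - p) \<noteq> 0"
    by blast
  have "ip (icross (q - p) (r - p)) s = ip (icross (q - p) (r - p)) p" if "s \<in> Y" for s
  proof -
    have "idet (q - p) (r - p) (s - p) = 0"
      using assms pqr that by (auto simp: flat_def)
    moreover have "idet (q - p) (r - p) (s - p) = ip (icross (q - p) (r - p)) (s - p)"
      by (simp add: ivec_simps algebra_simps)
    ultimately show ?thesis
      by simp
  qed
  then show ?thesis
    using that pqr(4) by metis
next
  case collinear: False
  show ?thesis
  proof (cases "\<exists>p\<in>Y. \<exists>q\<in>Y. p \<noteq> q")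
    case True
    then obtain p q where pq: "p \<in> Y" "q \<in> Y" "q - p \<noteq> 0"
      by (metis eq_iff_diff_eq_0)
    obtain k e where ke: "k > 0" "primitive e" "q - p = k *s e"
      using primitive_multiple_exists[OF pq(3)] by metis
    obtain b where b: "ip b e = 1"
      using ke(2) by (auto simp: primitive_def)
    obtain g where g: "g \<noteq> 0" "ip g e = 0"
      using orthogonal_exists by blast
    have "ip g r = ip g p" if "r \<in> Y" for r
    proof -
      have "icross (k *s e) (r - p) = 0"
        using collinear pq that ke(3) by metis
      moreover have "icross (k *s e) (r - p) = k *s icross e (r - p)"
        by (simp add: ivec_simps algebra_simps)
      ultimately have "k *s icross e (r - p) = k *s 0"
        by simp
      then have "icross e (r - p) = 0"
        using ke(1) scale_cancel by (metis less_irrefl)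
      then have "r - p = ip b (r - p) *s e"
        using icross_zero_imp_multiple b by blast
      then have "ip g (r - p) = ip b (r - p) * ip g e"
        by (metis ip_scale)
      then show ?thesis
        using g(2) by simp
    qed
    then show ?thesis
      using that g(1) by metis
  next
    case False
    then have "ip (vector [1, 0, 0]) p = ip (vector [1, 0, 0]) q" if "p \<in> Y" "q \<in> Y" for p q
      using that by metis
    moreover have "(vector [1, 0, 0] :: int^3) \<noteq> 0"
      by (simp add: vec_eq_iff forall_3)
    ultimately show ?thesis
      using that by blast
  qed
qed

text \<open>Only the fibres of the pair \<open>f1\<close>, \<open>f2\<close> matter, so the two
  functionals are independent but not necessarily part of a basis. The common fibre of the points in
  \<open>S\<close> becomes the long segment.\<close>

definition spike :: "(int^3) set \<Rightarrow> int^3 \<Rightarrow> int^3 \<Rightarrow> int^3 \<Rightarrow> int^3 \<Rightarrow> int^3 \<Rightarrow> bool"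
  where "spike X f1 f2 v1 v2 v3 \<longleftrightarrow>
    (let g = (\<lambda>p. (ip f1 p, ip f2 p)); S = X - {v1, v2, v3} in
      icross f1 f2 \<noteq> 0 \<and> {v1, v2, v3} \<subseteq> X \<and> distinct [g v1, g v2, g v3] \<and>
      (\<forall>s\<in>S. g s \<notin> {g v1, g v2, g v3} \<and> (\<forall>s'\<in>S. g s = g s')))"

text \<open>The vanishing determinant says that \<open>f3\<close> is zero on the common kernel
  direction of \<open>f1\<close> and \<open>f2\<close>, so \<open>f3\<close> is constant on the
  fibres of their projection.\<close>

lemma dependent_functional:
  assumes "icross f1 f2 \<noteq> 0" "idet f1 f2 f3 = 0" "ip f1 x = ip f1 y" "ip f2 x = ip f2 y"
  shows "ip f3 x = ip f3 y"
proof -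
  obtain t e where te: "primitive e" "t \<noteq> 0" "icross f1 f2 = t *s e"
    and ker: "\<And>p. ip f1 p = 0 \<Longrightarrow> ip f2 p = 0 \<Longrightarrow> \<exists>k. p = k *s e"
    using kernel_generator[OF assms(1)] by metis
  obtain k where k: "x - y = k *s e"
    using ker[of "x - y"] assms(3,4) by auto
  have "idet f1 f2 f3 = ip f3 (icross f1 f2)"
    by (simp add: ivec_simps algebra_simps)
  then have "ip f3 e = 0"
    using te assms(2) by simp
  then have "ip f3 (x - y) = 0"
    using k by simp
  then show ?thesis
    by simp
qed

context lattice_points
begin

text \<open>Otherwise \<open>s\<close> could stand in for \<open>v\<close> in every difference of
  values, and \<open>f\<close> would have spread at most one on all of \<open>X\<close>.\<close>

lemma narrow_value:
  assumes "spread1 f (X - {v})" "f \<noteq> 0" "s \<in> X" "s \<noteq> v"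
  shows "ip f s \<noteq> ip f v"
proof
  assume eq: "ip f s = ip f v"
  obtain p q where pq: "p \<in> X" "q \<in> X" "\<not> ip f p - ip f q \<le> 1"
    using wide assms(2) by (auto simp: wide_def spread1_def)
  define p' where "p' = (if p = v then s else p)"
  define q' where "q' = (if q = v then s else q)"
  have "p' \<in> X - {v}" "q' \<in> X - {v}" "ip f p' = ip f p" "ip f q' = ip f q"
    using assms pq eq by (auto simp: p'_def q'_def)
  then show False
    using assms(1) pq(3) unfolding spread1_def by metis
qed

lemma card_Diff_ge: "card (X - {a, b, c}) \<ge> 5" "card (X - {a, b}) \<ge> 6" "card (X - {a, b, c, d}) \<ge> 4"
proof -
  have "card X - card {a, b, c} \<le> card (X - {a, b, c})" "card X - card {a, b} \<le> card (X - {a, b})"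
    "card X - card {a, b, c, d} \<le> card (X - {a, b, c, d})"
    by (simp_all add: diff_card_le_card_Diff)
  moreover have "card {a, b, c} \<le> 3" "card {a, b} \<le> 2" "card {a, b, c, d} \<le> 4"
    by (auto simp: card_insert_if)
  ultimately show "card (X - {a, b, c}) \<ge> 5" "card (X - {a, b}) \<ge> 6" "card (X - {a, b, c, d}) \<ge> 4"
    using size by linarith+
qed

text \<open>Each of the three vertices is separated from all other points by its own functional; for
  \<open>v3\<close> this passes to the pair \<open>f1\<close>, \<open>f2\<close> because
  \<open>f3\<close> depends on them. If the remaining points occupied two corners, \<open>v3\<close>
  would occupy a third, against \<open>no_three_corners\<close>.\<close>

lemma dependent_narrow_spike:
  assumes v: "v1 \<in> X" "v2 \<in> X" "v3 \<in> X" "distinct [v1, v2, v3]"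
    and f: "spread1 f1 (X - {v1})" "spread1 f2 (X - {v2})" "spread1 f3 (X - {v3})" "f3 \<noteq> 0"
    and ne: "icross f1 f2 \<noteq> 0" "idet f1 f2 f3 = 0"
  shows "spike X f1 f2 v1 v2 v3"
proof -
  let ?g = "\<lambda>p. (ip f1 p, ip f2 p)"
  let ?S = "X - {v1, v2, v3}"
  have "f1 \<noteq> 0" "f2 \<noteq> 0"
    using ne by (auto simp: icross_def vec_eq_iff forall_3)
  then have n1: "\<And>s. s \<in> X \<Longrightarrow> s \<noteq> v1 \<Longrightarrow> ip f1 s \<noteq> ip f1 v1"
    and n2: "\<And>s. s \<in> X \<Longrightarrow> s \<noteq> v2 \<Longrightarrow> ip f2 s \<noteq> ip f2 v2"
    using narrow_value f by blast+
  have n3: "?g s \<noteq> ?g v3" if "s \<in> X" "s \<noteq> v3" for s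
    using narrow_value[OF f(3,4) that] dependent_functional[OF ne] by blast
  have "?g s = ?g s'" if "s \<in> ?S" "s' \<in> ?S" for s s'
  proof (rule ccontr)
    assume "?g s \<noteq> ?g s'"
    have "card (insert v3 ?S) \<ge> 5"
      using card_Diff_ge(1)[of v1 v2 v3] fin by (simp add: card_insert_if)
    moreover have "spread1 f1 (insert v3 ?S)" "spread1 f2 (insert v3 ?S)"
      using f(1,2) v by (auto intro: spread1_subset)
    moreover have "insert v3 ?S \<subseteq> X"
      using v by auto
    moreover have "s \<in> insert v3 ?S" "s' \<in> insert v3 ?S" "v3 \<in> insert v3 ?S"
      using that by auto
    moreover have "?g s \<noteq> ?g v3" "?g s' \<noteq> ?g v3"
      using n3 that by blast+
    ultimately show False
      using no_three_corners \<open>?g s \<noteq> ?g s'\<close> by metis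
  qed
  then have 1: "\<forall>s\<in>?S. \<forall>s'\<in>?S. ?g s = ?g s'"
    by blast
  have 2: "\<forall>s\<in>?S. ?g s \<notin> {?g v1, ?g v2, ?g v3}"
  proof
    fix s assume "s \<in> ?S"
    then show "?g s \<notin> {?g v1, ?g v2, ?g v3}"
      using n1[of s] n2[of s] n3[of s] by auto
  qed
  have 3: "distinct [?g v1, ?g v2, ?g v3]"
    using n1[of v2] n1[of v3] n2[of v3] v by auto
  have 4: "{v1, v2, v3} \<subseteq> X"
    using v by blast
  show ?thesis
    unfolding spike_def Let_def using ne(1) 1 2 3 4 by blast
qed

lemma primitive_parallel:
  assumes "primitive f" "icross f g = 0" "g \<noteq> 0"
  obtains k where "k \<noteq> 0" "g = k *s f"
  using assms icross_zero_imp_multiple unfolding primitive_def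
  by (metis vector_smult_lzero)

lemma spread1_multiple:
  assumes "spread1 (k *s f) Y" "k \<noteq> 0"
  shows "spread1 f Y"
  unfolding spread1_def
proof (intro ballI)
  fix p q assume "p \<in> Y" "q \<in> Y"
  then have "ip (k *s f) p - ip (k *s f) q \<le> 1" "ip (k *s f) q - ip (k *s f) p \<le> 1"
    using assms(1) unfolding spread1_def by blast+
  then have "\<bar>k * (ip f p - ip f q)\<bar> \<le> 1"
    by (simp add: right_diff_distrib)
  then have "\<bar>k\<bar> * \<bar>ip f p - ip f q\<bar> \<le> 1"
    by (simp add: abs_mult)
  moreover have "\<bar>k\<bar> * \<bar>ip f p - ip f q\<bar> \<ge> 1 * \<bar>ip f p - ip f q\<bar>"
    using assms(2) by (intro mult_right_mono) auto
  ultimately have "1 * \<bar>ip f p - ip f q\<bar> \<le> 1"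
    by (rule order_trans[rotated])
  then show "ip f p - ip f q \<le> 1"
    by simp
qed

lemma three_narrow_spike:
  assumes v: "v1 \<in> X" "v2 \<in> X" "v3 \<in> X" "distinct [v1, v2, v3]"
    and "\<not> wide (X - {v1})" "\<not> wide (X - {v2})" "\<not> wide (X - {v3})"
  shows "\<exists>f1 f2 v1 v2 v3. spike X f1 f2 v1 v2 v3"
proof -
  obtain f1 f2 f3 where f: "primitive f1" "primitive f2" "primitive f3"
    "spread1 f1 (X - {v1})" "spread1 f2 (X - {v2})" "spread1 f3 (X - {v3})"
    using assms(5-7) not_wide_primitive by metis
  have nz: "f1 \<noteq> 0" "f2 \<noteq> 0" "f3 \<noteq> 0"
    using f(1-3) by (auto simp: primitive_def)
  let ?S = "X - {v1, v2, v3}"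
  have D: "idet f1 f2 f3 = 0"
    by (rule not_boxed[of ?S]) (use card_Diff_ge(1) f in \<open>auto intro: spread1_subset\<close>)
  show ?thesis
  proof (cases "icross f1 f2 = 0")
    case False
    then show ?thesis
      using dependent_narrow_spike[OF v f(4-6) nz(3) False D] by blast
  next
    case par: True
    show ?thesis
    proof (cases "icross f1 f3 = 0")
      case False
      have "idet f1 f3 f2 = 0"
        using D by (simp add: ivec_simps algebra_simps)
      then have "spike X f1 f3 v1 v3 v2"
        using v f nz(2) False by (intro dependent_narrow_spike) auto
      then show ?thesis
        by blast
    next
      case True
      obtain k2 k3 where k: "k2 \<noteq> 0" "f2 = k2 *s f1" "k3 \<noteq> 0" "f3 = k3 *s f1"
        using primitive_parallel[OF f(1) par nz(2)] primitive_parallel[OF f(1) True nz(3)] by metis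
      have sp: "spread1 f1 (X - {v1})" "spread1 f1 (X - {v2})" "spread1 f1 (X - {v3})"
        using f k spread1_multiple by metis+
      \<comment> \<open>With all three functionals proportional, removing any of the three vertices
        must destroy every pair at distance at least 2, so all three belong to one such
        pair.\<close>
      obtain p q where pq: "p \<in> X" "q \<in> X" "\<not> ip f1 p - ip f1 q \<le> 1"
        using wide nz(1) by (auto simp: wide_def spread1_def)
      then have "{v1, v2, v3} \<subseteq> {p, q}"
        using sp unfolding spread1_def by blast
      then have False
        using v(4) by auto
      then show ?thesis ..
    qed
  qed
qed

lemma wide_not_constant:
  assumes "wide Y" "g \<noteq> 0"
  shows "\<exists>p\<in>Y. ip g p \<noteq> c"
  using assms unfolding wide_def spread1_def by fastforce

text \<open>Off \<open>u\<close> and \<open>v\<close> the functional \<open>g1\<close> is constant,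
  but removing only one of them leaves a wide set, so both miss that plane; the same holds for
  \<open>g2\<close> with \<open>u\<close> and \<open>w\<close>. Thus \<open>v\<close> and
  \<open>w\<close> each leave exactly one of the two planes and \<open>u\<close> leaves both, which
  makes the fibres distinct.\<close>

lemma three_wide_spike:
  assumes v: "u \<in> X" "v \<in> X" "w \<in> X" "distinct [u, v, w]"
    and w: "wide (X - {u})" "wide (X - {v})" "wide (X - {w})"
    and fl: "flat (X - {u, v})" "flat (X - {u, w})" "flat (X - {v, w})"
  shows "\<exists>f1 f2 v1 v2 v3. spike X f1 f2 v1 v2 v3"
proof -
  obtain g1 where g1: "g1 \<noteq> 0" "\<And>p q. p \<in> X - {u, v} \<Longrightarrow> q \<in> X - {u, v} \<Longrightarrow> ip g1 p = ip g1 q"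
    using flat_functional[OF fl(1)] by metis
  obtain g2 where g2: "g2 \<noteq> 0" "\<And>p q. p \<in> X - {u, w} \<Longrightarrow> q \<in> X - {u, w} \<Longrightarrow> ip g2 p = ip g2 q"
    using flat_functional[OF fl(2)] by metis
  obtain g3 where g3: "g3 \<noteq> 0" "\<And>p q. p \<in> X - {v, w} \<Longrightarrow> q \<in> X - {v, w} \<Longrightarrow> ip g3 p = ip g3 q"
    using flat_functional[OF fl(3)] by metis
  let ?S = "X - {u, v, w}"
  obtain s where s: "s \<in> ?S"
    using card_Diff_ge(1)[of u v w] by (metis all_not_in_conv card.empty not_numeral_le_zero)
  have w1: "ip g1 p = ip g1 s" if "p \<in> X" "p \<noteq> u" "p \<noteq> v" for p
    using g1(2) s that by blast
  have w2: "ip g2 p = ip g2 s" if "p \<in> X" "p \<noteq> u" "p \<noteq> w" for p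
    using g2(2) s that by blast
  have u1: "ip g1 u \<noteq> ip g1 s"
    using wide_not_constant[OF w(2) g1(1), of "ip g1 s"] w1 by auto
  have v1: "ip g1 v \<noteq> ip g1 s"
    using wide_not_constant[OF w(1) g1(1), of "ip g1 s"] w1 by auto
  have u2: "ip g2 u \<noteq> ip g2 s"
    using wide_not_constant[OF w(3) g2(1), of "ip g2 s"] w2 by auto
  have w2': "ip g2 w \<noteq> ip g2 s"
    using wide_not_constant[OF w(1) g2(1), of "ip g2 s"] w2 by auto
  have vs: "ip g2 v = ip g2 s" and ws: "ip g1 w = ip g1 s"
    using w1 w2 v by auto
  have cr: "icross g1 g2 \<noteq> 0"
  proof
    assume "icross g1 g2 = 0"
    then have "icross (w - s) (icross g1 g2) = 0"
      by (simp add: icross_def vec_eq_iff forall_3)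
    moreover have "icross (w - s) (icross g1 g2) = ip g2 (w - s) *s g1 - ip g1 (w - s) *s g2"
      by (simp only: icross_icross ip_commute)
    ultimately have "ip g2 (w - s) *s g1 = ip g1 (w - s) *s g2"
      by simp
    then have "ip g2 (w - s) *s g1 = ip g2 (w - s) *s 0"
      using ws by (simp add: vec_eq_iff)
    then show False
      using w2' g1(1) by (metis eq_iff_diff_eq_0 ip_diff scale_cancel)
  qed
  let ?g = "\<lambda>p. (ip g1 p, ip g2 p)"
  have gs: "?g p = ?g s" if "p \<in> ?S" for p
    using w1[of p] w2[of p] that by auto
  then have 1: "\<forall>p\<in>?S. \<forall>p'\<in>?S. ?g p = ?g p'"
    by metis
  have "?g s \<notin> {?g u, ?g v, ?g w}"
    using u1 v1 w2' by auto
  then have 2: "\<forall>p\<in>?S. ?g p \<notin> {?g u, ?g v, ?g w}"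
    using gs by metis
  have 3: "distinct [?g u, ?g v, ?g w]"
    using u1 v1 u2 w2' vs ws by auto
  have 4: "{u, v, w} \<subseteq> X"
    using v by blast
  have "spike X g1 g2 u v w"
    unfolding spike_def Let_def using cr 1 2 3 4 by blast
  then show ?thesis
    by blast
qed

text \<open>
  Here \<open>f \<times> b\<close> completes \<open>e\<close> to a basis of the lattice plane \<open>f = 0\<close>, so that \<open>u - s\<close> is
  \<open>h\<close> times this vector plus a multiple of \<open>e\<close>. Sliding along the edge from \<open>s\<close> to \<open>s + e\<close> yields a
  lattice point of \<open>X\<close> at distance one from the line through this edge.
\<close>

lemma no_unit_pyramid:
  assumes "s \<in> X" "s + e \<in> X" "u \<in> X" "w \<in> X" "primitive e" "primitive f"
    and fe: "ip f e = 0" and fu: "ip f u = ip f s" and fw: "\<bar>ip f (w - s)\<bar> = 1"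
    and nl: "icross e (u - s) \<noteq> 0"
  shows False
proof -
  obtain b where b: "ip b e = 1"
    using assms(5) by (auto simp: primitive_def)
  obtain b' where b': "ip b' f = 1"
    using assms(6) by (auto simp: primitive_def)
  have "icross f (icross e (u - s)) = 0"
    using fe fu by (simp add: icross_icross vec_eq_iff ip_commute[of f])
  then obtain h where h: "icross e (u - s) = h *s f"
    using icross_zero_imp_multiple[OF b'] by metis
  then have h0: "h \<noteq> 0"
    using nl by auto
  define e2 where "e2 = icross f b"
  have e2: "icross e e2 = f"
    using b fe by (simp add: e2_def icross_icross ip_commute[of e] vec_eq_iff)
  have "icross e (u - s - h *s e2) = icross e (u - s) - h *s icross e e2"
    by (simp add: ivec_simps algebra_simps)
  then have "icross e (u - s - h *s e2) = 0"
    using h e2 by simp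
  then obtain t where t: "u - s - h *s e2 = t *s e"
    using icross_zero_imp_multiple[OF b] by metis
  define k where "k = \<bar>h\<bar>"
  \<comment> \<open>The ceiling of \<open>t / k\<close>: the remainder \<open>k * z - t\<close>,
    between 0 and \<open>k - 1\<close>, becomes the weight of \<open>s + e\<close>, next to weight 1
    for \<open>u\<close> and the rest for \<open>s\<close>.\<close>
  define z where "z = - ((- t) div k)"
  obtain d where d: "h = k * d" "\<bar>d\<bar> = 1"
  proof
    show "h = k * sgn h" "\<bar>sgn h\<bar> = 1"
      using h0 by (simp_all add: k_def abs_mult_sgn)
  qed
  have k: "k > 0"
    using h0 by (auto simp: k_def)
  have "(- t) mod k = - t - k * ((- t) div k)"
    by (simp add: minus_mult_div_eq_mod)
  then have kz0: "k * z - t = (- t) mod k"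
    by (simp add: z_def)
  have kz: "0 \<le> k * z - t" "k * z - t \<le> k - 1"
    using k kz0 pos_mod_bound[OF k, of "-t"] by auto
  define q where "q = s + d *s e2 + z *s e"
  have u: "u = s + h *s e2 + t *s e"
    using t by (simp add: algebra_simps)
  have "k *s q = (k - 1 - (k * z - t)) *s s + (k * z - t) *s (s + e) + 1 *s u + 0 *s s"
    unfolding q_def u vec_eq_iff
    by (simp add: d(1) algebra_simps)
  then have "q \<in> X"
    by (rule satD[rotated -1]) (use assms k kz in auto)
  have "idet e (q - s) (w - s) = d * ip (icross e e2) (w - s)"
    by (simp add: q_def ivec_simps algebra_simps)
  also have "\<dots> = d * ip f (w - s)"
    using e2 by simp
  finally have "\<bar>idet e (q - s) (w - s)\<bar> = 1"
    using fw d(2) by (simp add: abs_mult)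
  then show False
    using no_unit_det[OF assms(1,2) \<open>q \<in> X\<close> assms(4)] by simp
qed

end

section \<open>Combining vertices of both kinds\<close>

lemma ip_ext: "(\<And>f. ip f a = ip f b) \<Longrightarrow> a = b"
proof -
  assume *: "\<And>f. ip f a = ip f b"
  show "a = b"
    using *[of "vector [1, 0, 0]"] *[of "vector [0, 1, 0]"] *[of "vector [0, 0, 1]"]
    by (simp add: ip_def vec_eq_iff forall_3)
qed

text \<open>\<open>hull\<close> expresses membership in the convex hull of \<open>V\<close> by
  testing barycentric coordinates on all integer functionals, among them the coordinates, so that
  real vectors stay out.\<close>

locale non_merged_points = lattice_points +
  fixes V :: "(int^3) set"
  assumes VX: "V \<subseteq> X"
    and card_V: "card V \<ge> 4"
    and hull: "s \<in> X \<Longrightarrow> \<exists>c. (\<forall>v\<in>V. 0 \<le> c v) \<and> sum c V = (1 :: real) \<and>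
      (\<forall>f. (\<Sum>v\<in>V. c v * real_of_int (ip f v)) = real_of_int (ip f s))"
    and non_merged: "u \<in> V \<Longrightarrow> v \<in> V \<Longrightarrow> u \<noteq> v \<Longrightarrow>
      \<not> wide (X - {u}) \<or> \<not> wide (X - {v}) \<or> flat (X - {u, v})"
begin

text \<open>Since \<open>u\<close> and \<open>v\<close> lie on the same side of the level of
  \<open>w1\<close> and \<open>w2\<close>, a point of that level has no weight at them and lies on
  the line through \<open>w1\<close> and \<open>w2\<close>. A functional that separates
  \<open>w1\<close> from \<open>w2\<close> is injective there.\<close>

lemma edge_determined:
  assumes V: "V = {u, v, w1, w2}" "distinct [u, v, w1, w2]"
    and g: "ip g u = ip g v" "ip g w1 = lev" "ip g w2 = lev" "ip g u \<noteq> lev"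
    and s: "s1 \<in> X" "s2 \<in> X" "ip g s1 = lev" "ip g s2 = lev"
    and f: "ip f s1 = ip f s2" "ip f w1 \<noteq> ip f w2"
  shows "s1 = s2"
proof -
  have *: "\<exists>a. \<forall>f. a * real_of_int (ip f w1) + (1 - a) * real_of_int (ip f w2) = real_of_int (ip f s)"
    if sX: "s \<in> X" and sg: "ip g s = lev" for s
  proof -
    obtain c where c: "\<forall>v\<in>V. 0 \<le> c v" "sum c V = (1 :: real)"
      and cf: "\<And>f. (\<Sum>v\<in>V. c v * real_of_int (ip f v)) = real_of_int (ip f s)"
      using hull[OF sX] by auto
    have sum: "c u + c v + c w1 + c w2 = 1"
      using c(2) V by (simp add: add.assoc)
    have cf': "c u * ip f u + c v * ip f v + c w1 * ip f w1 + c w2 * ip f w2 = ip f s" for f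
      using cf[of f] V by (simp add: add.assoc)
    have "c u * ip g u + c v * ip g u + (c w1 + c w2) * lev = lev"
      using cf'[of g] g sg by (simp add: algebra_simps)
    moreover have "c w1 + c w2 = 1 - c u - c v"
      using sum by simp
    ultimately have "(c u + c v) * (real_of_int (ip g u) - real_of_int lev) = 0"
      by (simp add: algebra_simps)
    then have "c u + c v = 0"
      using g(4) by simp
    moreover have "c u \<ge> 0" "c v \<ge> 0"
      using c(1) V by auto
    ultimately have "c u = 0" "c v = 0"
      by linarith+
    then have "c w2 = 1 - c w1"
      using sum by simp
    then show ?thesis
      using cf' \<open>c u = 0\<close> \<open>c v = 0\<close> by (intro exI[of _ "c w1"]) simp
  qed
  obtain a where a: "\<And>f. a * real_of_int (ip f w1) + (1 - a) * real_of_int (ip f w2) = real_of_int (ip f s1)"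
    using *[OF s(1,3)] by blast
  obtain b where b: "\<And>f. b * real_of_int (ip f w1) + (1 - b) * real_of_int (ip f w2) = real_of_int (ip f s2)"
    using *[OF s(2,4)] by blast
  have "(a - b) * (real_of_int (ip f w1) - real_of_int (ip f w2)) = 0"
    using a[of f] b[of f] f(1) by (simp add: algebra_simps)
  then have "a = b"
    using f(2) by simp
  then have "real_of_int (ip f s1) = real_of_int (ip f s2)" for f
    using a[of f] b[of f] by simp
  then show "s1 = s2"
    by (intro ip_ext) simp
qed

lemma two_wide_two_narrow:
  assumes V: "V = {u, v, w1, w2}" "distinct [u, v, w1, w2]"
    and w: "wide (X - {u})" "wide (X - {v})" and fl: "flat (X - {u, v})"
    and n: "\<not> wide (X - {w1})" "\<not> wide (X - {w2})"
  shows False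
proof -
  have inX: "u \<in> X" "v \<in> X" "w1 \<in> X" "w2 \<in> X"
    using VX V by auto
  obtain g where g: "g \<noteq> 0" "\<And>p q. p \<in> X - {u, v} \<Longrightarrow> q \<in> X - {u, v} \<Longrightarrow> ip g p = ip g q"
    using flat_functional[OF fl] by metis
  let ?S = "X - {u, v, w1, w2}"
  have cS: "card ?S \<ge> 4"
    using card_Diff_ge(3) .
  define lev where "lev = ip g w1"
  have "w1 \<in> X - {u, v}"
    using inX V by auto
  then have glev: "ip g s = lev" if "s \<in> X" "s \<noteq> u" "s \<noteq> v" for s
    using g(2)[of s w1] that by (simp add: lev_def)
  have gu: "ip g u \<noteq> lev"
    using wide_not_constant[OF w(2) g(1), of lev] glev by auto
  have gv: "ip g v \<noteq> lev"
    using wide_not_constant[OF w(1) g(1), of lev] glev by auto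
  obtain f1 f2 where f: "primitive f1" "primitive f2" "spread1 f1 (X - {w1})" "spread1 f2 (X - {w2})"
    using n not_wide_primitive by metis
  have nz: "f1 \<noteq> 0" "f2 \<noteq> 0"
    using f(1,2) by (auto simp: primitive_def)
  show False
  proof (cases "icross f1 f2 = 0")
    case False
    let ?h = "\<lambda>p. (ip f1 p, ip f2 p)"
    let ?T = "X - {w1, w2}"
    have T: "?T \<subseteq> X" "card ?T \<ge> 5" "spread1 f1 ?T" "spread1 f2 ?T"
      using card_Diff_ge(2)[of w1 w2] f by (auto intro: spread1_subset)
    \<comment> \<open>Three points of \<open>?S\<close> in different fibres would occupy three
      corners, so two of its at least four points share a fibre.\<close>
    have "\<not> inj_on ?h ?S"
    proof
      assume inj: "inj_on ?h ?S"
      have "3 \<le> card ?S"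
        using cS by linarith
      then obtain A where A: "A \<subseteq> ?S" "card A = 3"
        by (rule obtain_subset_with_card_n)
      then obtain a b c where abc: "A = {a, b, c}" "a \<noteq> b" "b \<noteq> c" "a \<noteq> c"
        unfolding card_3_iff by blast
      then have mem: "a \<in> ?S" "b \<in> ?S" "c \<in> ?S"
        using A by auto
      then have "?h a \<noteq> ?h b" "?h a \<noteq> ?h c" "?h b \<noteq> ?h c"
        using inj_on_contraD[OF inj] mem abc by blast+
      then show False
        using no_three_corners[OF T, of a b c] mem by blast
    qed
    then obtain s1 s2 where s: "s1 \<in> ?S" "s2 \<in> ?S" "s1 \<noteq> s2" "?h s1 = ?h s2"
      unfolding inj_on_def by blast
    obtain e where ker: "\<And>p. ip f1 p = 0 \<Longrightarrow> ip f2 p = 0 \<Longrightarrow> \<exists>k. p = k *s e"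
      using kernel_generator[OF False] by metis
    obtain k where k: "s2 - s1 = k *s e"
      using ker[of "s2 - s1"] s(4) by auto
    have "k \<noteq> 0"
      using k s(3) by auto
    moreover have "k * ip g e = 0"
      using k glev[of s1] glev[of s2] s by (metis DiffD1 DiffD2 diff_self insertCI ip_diff ip_scale)
    ultimately have ge: "ip g e = 0"
      by simp
    have gh: "ip g x = ip g y" if h: "?h x = ?h y" for x y
    proof -
      obtain j where j: "x - y = j *s e"
        using ker[of "x - y"] h by auto
      have "ip g (x - y) = 0"
        unfolding j using ge by simp
      then show ?thesis
        by simp
    qed
    have gs: "ip g s1 = lev" "ip g s2 = lev"
      using glev s by auto
    have hu: "?h s1 \<noteq> ?h u" and hv: "?h s1 \<noteq> ?h v"
      using gh gs gu gv by metis+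
    have mem: "s1 \<in> ?T" "u \<in> ?T" "v \<in> ?T"
      using s inX V by auto
    \<comment> \<open>The fibre through \<open>s1\<close> and \<open>s2\<close> runs in the plane
      that \<open>u\<close> and \<open>v\<close> avoid. As a third corner is forbidden,
      \<open>u\<close> and \<open>v\<close> share a fibre and so their value under \<open>g\<close>,
      as \<open>edge_determined\<close> requires.\<close>
    have "?h u = ?h v"
      using no_three_corners[OF T mem hu hv] by blast
    then have "ip g u = ip g v"
      by (rule gh)
    moreover have "ip f1 w1 \<noteq> ip f1 w2"
      using narrow_value[OF f(3) nz(1), of w2] inX V by auto
    ultimately show False
      using edge_determined[OF V, of g lev s1 s2 f1] gs gu s glev[of w1] glev[of w2] V inX by auto
  next
    case True
    obtain k where k: "k \<noteq> 0" "f2 = k *s f1"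
      using primitive_parallel[OF f(1) True nz(2)] by metis
    have sp: "spread1 f1 (X - {w1})" "spread1 f1 (X - {w2})"
      using f k spread1_multiple by metis+
    obtain p q where pq: "p \<in> X" "q \<in> X" "\<not> ip f1 p - ip f1 q \<le> 1"
      using wide nz(1) by (auto simp: wide_def spread1_def)
    then have "w1 \<in> {p, q}" "w2 \<in> {p, q}"
      using sp unfolding spread1_def by blast+
    then have "{p, q} = {w1, w2}"
      using V by auto
    then have far: "\<bar>ip f1 w1 - ip f1 w2\<bar> \<ge> 2"
      using pq(3) by (auto simp: doubleton_eq_iff)
    \<comment> \<open>Both \<open>w1\<close> and \<open>w2\<close> are within 1 of \<open>s\<close>
      but at least 2 apart, so \<open>s\<close> is exactly in the middle.\<close>
    have mid: "2 * ip f1 s = ip f1 w1 + ip f1 w2 \<and> \<bar>ip f1 (w1 - s)\<bar> = 1"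
      if "s \<in> X" "s \<noteq> w1" "s \<noteq> w2" for s
    proof -
      have "s \<in> X - {w1}" "w2 \<in> X - {w1}" "s \<in> X - {w2}" "w1 \<in> X - {w2}"
        using that inX V by auto
      then have "ip f1 s - ip f1 w2 \<le> 1" "ip f1 w2 - ip f1 s \<le> 1"
        "ip f1 s - ip f1 w1 \<le> 1" "ip f1 w1 - ip f1 s \<le> 1"
        using sp unfolding spread1_def by blast+
      then show ?thesis
        unfolding ip_diff using far by linarith
    qed
    have "2 \<le> card ?S"
      using cS by linarith
    then obtain A where A: "A \<subseteq> ?S" "card A = 2"
      by (rule obtain_subset_with_card_n)
    then obtain s1 s2 where s: "s1 \<in> ?S" "s2 \<in> ?S" "s1 \<noteq> s2"
      unfolding card_2_iff by blast
    then have sX: "s1 \<in> X" "s2 \<in> X"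
      by auto
    obtain j e where e: "j > 0" "primitive e" "s2 - s1 = j *s e" "s1 + e \<in> X"
      using adjacent_point[OF sX s(3)] by metis
    have "ip f1 (s2 - s1) = 0" "ip g (s2 - s1) = 0"
      using mid[of s1] mid[of s2] glev[of s1] glev[of s2] s by auto
    then have fe: "ip f1 e = 0" and ge: "ip g e = 0"
      unfolding e(3) using e(1) by auto
    have fu: "ip f1 u = ip f1 s1"
      using mid[of s1] mid[of u] s inX V by auto
    \<comment> \<open>In the middle plane, \<open>u\<close> is off the line of \<open>s1\<close> and
      \<open>s2\<close> because \<open>g\<close> separates it, and \<open>w1\<close> has height one
      over this plane: the situation of \<open>no_unit_pyramid\<close>.\<close>
    have "icross e (u - s1) \<noteq> 0"
    proof
      assume "icross e (u - s1) = 0"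
      then obtain m where m: "u - s1 = m *s e"
        using e(2) icross_zero_imp_multiple unfolding primitive_def by metis
      have "ip g (u - s1) = 0"
        unfolding m using ge by simp
      then show False
        using gu glev[of s1] s by auto
    qed
    moreover have "\<bar>ip f1 (w1 - s1)\<bar> = 1"
      using mid[of s1] s by auto
    ultimately show False
      using no_unit_pyramid[OF sX(1) e(4) inX(1,3) e(2) f(1) fe fu] by blast
  qed
qed

theorem spike_exists: "\<exists>f1 f2 v1 v2 v3. spike X f1 f2 v1 v2 v3"
proof -
  define B where "B = {v \<in> V. wide (X - {v})}"
  define N where "N = V - B"
  have finV: "finite V"
    using VX fin finite_subset by blast
  have NB: "card N + card B = card V"
  proof -
    have "card N = card V - card B" "card B \<le> card V"
      using finV unfolding N_def B_def by (auto intro: card_Diff_subset card_mono)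
    then show ?thesis
      by simp
  qed
  have inB: "v \<in> X" "wide (X - {v})" if "v \<in> B" for v
    using that VX by (auto simp: B_def)
  have inN: "v \<in> X" "\<not> wide (X - {v})" if "v \<in> N" for v
    using that VX by (auto simp: N_def B_def)
  have flB: "flat (X - {u, v})" if "u \<in> B" "v \<in> B" "u \<noteq> v" for u v
    using non_merged[of u v] that by (auto simp: B_def)
  \<comment> \<open>If neither class of the at least four vertices has three members, each has
    exactly two, and \<open>V\<close> is the vertex set of a tetrahedron.\<close>
  consider "card N \<ge> 3" | "card B \<ge> 3" | "card N = 2" "card B = 2"
    using NB card_V by linarith
  then show ?thesis
  proof cases
    case 1
    then obtain A where "A \<subseteq> N" "card A = 3"
      using obtain_subset_with_card_n by metis
    then obtain a b c where "a \<in> N" "b \<in> N" "c \<in> N" "distinct [a, b, c]"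
      by (auto simp: card_3_iff)
    then show ?thesis
      using three_narrow_spike[of a b c] inN by blast
  next
    case 2
    then obtain A where "A \<subseteq> B" "card A = 3"
      using obtain_subset_with_card_n by metis
    then obtain a b c where abc: "a \<in> B" "b \<in> B" "c \<in> B" "distinct [a, b, c]"
      by (auto simp: card_3_iff)
    then show ?thesis
      using three_wide_spike[of a b c] inB flB by auto
  next
    case 3
    obtain u v where uv: "B = {u, v}" "u \<noteq> v"
      using 3(2) by (auto simp: card_2_iff)
    obtain w1 w2 where w: "N = {w1, w2}" "w1 \<noteq> w2"
      using 3(1) by (auto simp: card_2_iff)
    have "V = B \<union> N" "B \<inter> N = {}"
      by (auto simp: N_def B_def)
    then have "V = {u, v, w1, w2}" "distinct [u, v, w1, w2]"
      using uv w by auto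
    then have False
      using two_wide_two_narrow[of u v w1 w2] inB inN flB uv w by auto
    then show ?thesis ..
  qed
qed

end

section \<open>Projections along a long segment\<close>

definition ip2 :: "int^2 \<Rightarrow> int^2 \<Rightarrow> int"
  where "ip2 a b = a$1 * b$1 + a$2 * b$2"

definition det2 :: "int^2 \<Rightarrow> int^2 \<Rightarrow> int"
  where "det2 a b = a$1 * b$2 - a$2 * b$1"

lemma ip2_linear [simp]:
  "ip2 f (a + b) = ip2 f a + ip2 f b" "ip2 f (a - b) = ip2 f a - ip2 f b"
  "ip2 f (k *s a) = k * ip2 f a" "ip2 f 0 = 0" "ip2 f (- a) = - ip2 f a"
  by (simp_all add: ip2_def algebra_simps)

lemma det2_linear [simp]:
  "det2 (a + b) c = det2 a c + det2 b c" "det2 (a - b) c = det2 a c - det2 b c"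
  "det2 (k *s a) c = k * det2 a c" "det2 (- a) c = - det2 a c" "det2 0 c = 0"
  "det2 c (a + b) = det2 c a + det2 c b" "det2 c (a - b) = det2 c a - det2 c b"
  "det2 c (k *s a) = k * det2 c a" "det2 c (- a) = - det2 c a" "det2 c 0 = 0" "det2 a a = 0"
  by (simp_all add: det2_def algebra_simps)

lemma det2_skew: "det2 a b = - det2 b a"
  by (simp add: det2_def)

lemma det2_cramer: "det2 u v *s w = det2 w v *s u + det2 u w *s v"
  by (simp add: det2_def vec_eq_iff forall_2 algebra_simps)

lemma primitive_multiple_exists2:
  assumes "v \<noteq> (0 :: int^2)"
  obtains k e b where "k > 0" "ip2 b e = 1" "v = k *s e"
proof -
  define g where "g = gcd (v$1) (v$2)"
  have "g \<noteq> 0"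
    using assms by (auto simp: g_def vec_eq_iff forall_2)
  then have "g > 0"
    by (simp add: g_def)
  define e where "e = (vector [v$1 div g, v$2 div g] :: int^2)"
  have v: "v = g *s e"
    by (simp add: e_def g_def vec_eq_iff forall_2)
  obtain r s where rs: "r * v$1 + s * v$2 = g"
    unfolding g_def using bezout_int by metis
  have "ip2 (vector [r, s]) v = g"
    using rs by (simp add: ip2_def)
  then have "g * ip2 (vector [r, s]) e = g * 1"
    using v by (metis ip2_linear(3) mult.right_neutral)
  then have "ip2 (vector [r, s]) e = 1"
    using \<open>g \<noteq> 0\<close> by simp
  then show ?thesis
    using that \<open>g > 0\<close> v by blast
qed

text \<open>The three numbers will be the determinants of consecutive vertices, and their sum the
  normalized area of a triangle. If \<open>z\<close> is the largest, then \<open>y * z\<close> and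
  \<open>z * x\<close> are at most \<open>3 * z\<close>, which bounds the other two by 3; from
  \<open>2 * z \<le> z * x\<close> one gets \<open>z \<le> x + y\<close>, hence the bound 6.\<close>

lemma pairwise_product_dvd_sum:
  fixes a b c :: int
  assumes "a \<ge> 2" "b \<ge> 2" "c \<ge> 2"
    and "a * b dvd a + b + c" "b * c dvd a + b + c" "c * a dvd a + b + c"
  shows "(a, b, c) \<in> {(3, 3, 3), (2, 2, 4), (2, 4, 2), (4, 2, 2)}"
proof -
  have le: "a * b \<le> a + b + c" "b * c \<le> a + b + c" "c * a \<le> a + b + c"
    using assms by (auto intro: zdvd_imp_le)
  have small: "x \<le> 6 \<and> y \<le> 6 \<and> z \<le> 6"
    if "x \<ge> 2" "y \<ge> 2" "z \<ge> x" "z \<ge> y" "y * z \<le> x + y + z" "z * x \<le> x + y + z" for x y z :: int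
  proof -
    have "y * z \<le> 3 * z" "x * z \<le> 3 * z"
      using that mult.commute[of z x] by linarith+
    moreover have "z > 0"
      using that by linarith
    ultimately have "y \<le> 3" "x \<le> 3"
      by (simp_all only: mult_le_cancel_right_pos)
    moreover have "z * 2 \<le> z * x"
      using that by (intro mult_left_mono) auto
    ultimately show ?thesis
      using that by linarith
  qed
  have "a \<le> 6 \<and> b \<le> 6 \<and> c \<le> 6"
  proof -
    consider "c \<ge> a" "c \<ge> b" | "a \<ge> b" "a \<ge> c" | "b \<ge> a" "b \<ge> c"
      by linarith
    then show ?thesis
    proof cases
      case 1
      then show ?thesis
        using small[of a b c] assms(1-3) le by auto
    next
      case 2
      then show ?thesis
        using small[of b c a] assms(1-3) le by (auto simp: algebra_simps)
    next
      case 3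
      then show ?thesis
        using small[of c a b] assms(1-3) le by (auto simp: algebra_simps)
    qed
  qed
  then have "a \<in> {2, 3, 4, 5, 6}" "b \<in> {2, 3, 4, 5, 6}" "c \<in> {2, 3, 4, 5, 6}"
    using assms(1-3) by auto
  then show ?thesis
    using assms(4-6) by (elim insertE emptyE) simp_all
qed

text \<open>
  The points \<open>u1\<close>, \<open>u2\<close>, \<open>u3\<close> are the projections of the three lattice points off a long
  lattice segment, along that segment. A lattice point of the projected polytope with barycentric weight at
  least \<open>1/4\<close> at the origin lies below a lattice point, and below two of them if the weight is
  at least \<open>1/2\<close>.
\<close>

locale planar_triple =
  fixes u1 u2 u3 :: "int^2" and U
  assumes U_def: "U = {u1, u2, u3}"
    and distinct: "distinct [u1, u2, u3]" and nonzero: "0 \<notin> U"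
    and quarter: "\<And>u v w a b k. u \<in> U \<Longrightarrow> v \<in> U \<Longrightarrow> w \<noteq> 0 \<Longrightarrow> 0 \<le> a \<Longrightarrow> 0 \<le> b \<Longrightarrow>
      k *s w = a *s u + b *s v \<Longrightarrow> k > 0 \<Longrightarrow> k \<le> 4 * (k - a - b) \<Longrightarrow> w \<in> U"
    and half: "\<And>u v w a b k. u \<in> U \<Longrightarrow> v \<in> U \<Longrightarrow> w \<noteq> 0 \<Longrightarrow> 0 \<le> a \<Longrightarrow> 0 \<le> b \<Longrightarrow>
      k *s w = a *s u + b *s v \<Longrightarrow> k > 0 \<Longrightarrow> k \<le> 2 * (k - a - b) \<Longrightarrow> False"
    and no_unit: "\<And>u v. u \<in> U \<Longrightarrow> v \<in> U \<Longrightarrow> \<bar>det2 u v\<bar> \<noteq> 1"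
    and wide2: "\<And>f. f \<noteq> 0 \<Longrightarrow> \<exists>p\<in>insert 0 U. \<exists>q\<in>insert 0 U. ip2 f p - ip2 f q \<ge> 2"
begin

text \<open>If \<open>u\<close> were \<open>k *s e\<close> with \<open>k \<ge> 2\<close>, the point
  \<open>e\<close> would have weight \<open>1 - 1/k\<close> at the origin, which is at least 1/2 and
  excluded by \<open>half\<close>.\<close>

lemma primitive_vertex:
  assumes "u \<in> U"
  obtains b where "ip2 b u = 1"
proof -
  have "u \<noteq> 0"
    using assms nonzero by auto
  then obtain k e b where ke: "k > 0" "ip2 b e = 1" "u = k *s e"
    using primitive_multiple_exists2 by metis
  have "e \<noteq> 0"
    using ke(2) by auto
  moreover have "k *s e = 1 *s u + 0 *s u"
    using ke(3) by simp
  ultimately have "\<not> k \<le> 2 * (k - 1 - 0)"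
    using half[OF assms assms, of e 1 0 k] ke(1) by auto
  then have "k = 1"
    using ke(1) by auto
  then show ?thesis
    using that ke by simp
qed

text \<open>
  Passing from \<open>w\<close> to \<open>2w - u\<close> or \<open>2w - v\<close> doubles the barycentric weight of the origin, and
  passing to \<open>u + v - 2w\<close> turns a weight below \<open>1/4\<close> into one above \<open>1/2\<close>.
\<close>

lemma climb:
  assumes "det2 u v > 0"
  shows "0 \<le> a \<Longrightarrow> 0 \<le> b \<Longrightarrow> 0 < a + b \<Longrightarrow> a + b < det2 u v \<Longrightarrow>
    det2 u v *s w = a *s u + b *s v \<Longrightarrow>
    \<exists>w a b. 0 \<le> a \<and> 0 \<le> b \<and> 0 < a + b \<and> det2 u v *s w = a *s u + b *s v \<and>
      det2 u v \<le> 4 * (det2 u v - a - b)"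
proof (induction "nat (a + b)" arbitrary: a b w rule: less_induct)
  case less
  let ?d = "det2 u v"
  consider "?d \<le> 4 * (?d - a - b)" | "?d > 4 * (?d - a - b)" "2 * a \<ge> ?d" | "?d > 4 * (?d - a - b)" "2 * b \<ge> ?d"
    | "?d > 4 * (?d - a - b)" "2 * a < ?d" "2 * b < ?d"
    by linarith
  then show ?case
  proof cases
    case 1
    then show ?thesis
      using less.prems by blast
  next
    case 2
    have "?d *s (2 *s w - u) = (2 * a - ?d) *s u + (2 * b) *s v"
      using less.prems(5) by (simp add: vec_eq_iff forall_2 algebra_simps)
    then show ?thesis
      using less.hyps[of "2 * a - ?d" "2 * b" "2 *s w - u"] less.prems(1-4) 2 by force
  next
    case 3
    have "?d *s (2 *s w - v) = (2 * a) *s u + (2 * b - ?d) *s v"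
      using less.prems(5) by (simp add: vec_eq_iff forall_2 algebra_simps)
    then show ?thesis
      using less.hyps[of "2 * a" "2 * b - ?d" "2 *s w - v"] less.prems(1-4) 3 by force
  next
    case 4
    have "?d *s (u + v - 2 *s w) = (?d - 2 * a) *s u + (?d - 2 * b) *s v"
      using less.prems(5) by (simp add: vec_eq_iff forall_2 algebra_simps)
    then show ?thesis
      using less.prems(1-4) 4
      by (intro exI[of _ "u + v - 2 *s w"] exI[of _ "?d - 2 * a"] exI[of _ "?d - 2 * b"]) simp
  qed
qed

text \<open>The lattice point \<open>w\<close> has determinant 1 with \<open>u\<close> and is
  reduced along \<open>u\<close>, so that \<open>?d *s w = R *s u + v\<close>. The extreme remainder
  \<open>R = ?d - 1\<close> means that \<open>v - u\<close> is divisible by \<open>?d\<close>. A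
  smaller one puts \<open>w\<close> strictly on the origin's side of the edge, and
  \<open>climb\<close> leads to a point of \<open>U\<close> other than \<open>u\<close> and
  \<open>v\<close>.\<close>

lemma congruent_or_inside:
  assumes "u \<in> U" "v \<in> U" "det2 u v > 0"
  shows "(\<exists>t. v - u = det2 u v *s t) \<or>
    (\<exists>w\<in>U. w \<noteq> u \<and> w \<noteq> v \<and> (\<exists>a b. 0 \<le> a \<and> 0 \<le> b \<and> det2 u v *s w = a *s u + b *s v))"
proof -
  let ?d = "det2 u v"
  obtain b0 where b0: "ip2 b0 u = 1"
    using primitive_vertex assms(1) by metis
  \<comment> \<open>A quarter turn of the dual vector of \<open>u\<close>, which turns the pairing
    into a determinant.\<close>
  define w0 where "w0 = (vector [- b0$2, b0$1] :: int^2)"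
  have w0: "det2 u w0 = 1"
    using b0 by (simp add: w0_def det2_def ip2_def algebra_simps)
  define w where "w = w0 - (det2 w0 v div ?d) *s u"
  define R where "R = det2 w0 v mod ?d"
  have "det2 w v = R"
    by (simp add: w_def R_def minus_div_mult_eq_mod)
  then have w: "?d *s w = R *s u + 1 *s v"
    using det2_cramer[of u v w] w0 by (simp add: w_def)
  have R: "0 \<le> R" "R < ?d"
    using assms(3) by (simp_all add: R_def)
  show ?thesis
  proof (cases "R = ?d - 1")
    case True
    have "v - u = ?d *s (w - u)"
      using w True by (simp add: vec_eq_iff forall_2 algebra_simps)
    then show ?thesis
      by blast
  next
    case False
    then obtain w a b where wab: "0 \<le> a" "0 \<le> b" "0 < a + b" "?d *s w = a *s u + b *s v"
      "?d \<le> 4 * (?d - a - b)"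
      using climb[OF assms(3) R(1) _ _ _ w] R by force
    have dv: "?d * det2 w v = a * ?d" and du: "?d * det2 u w = b * ?d"
      using arg_cong[OF wab(4), of "\<lambda>x. det2 x v"] arg_cong[OF wab(4), of "\<lambda>x. det2 u x"] by simp_all
    then have ab: "det2 w v = a" "det2 u w = b"
      using assms(3) by simp_all
    then have "w \<noteq> 0" "w \<noteq> u" "w \<noteq> v"
      using wab assms(3) by auto
    moreover have "w \<in> U"
      using quarter[OF assms(1,2) \<open>w \<noteq> 0\<close> wab(1,2,4) assms(3) wab(5)] .
    ultimately show ?thesis
      using wab by blast
  qed
qed

lemma third_vertex:
  assumes "U = {u, v, w}" "x \<in> U" "x \<noteq> u" "x \<noteq> v"
  shows "x = w"
  using assms by auto

lemma det2_ge_2: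
  assumes "u \<in> U" "v \<in> U" "det2 u v > 0"
  shows "det2 u v \<ge> 2"
  using no_unit[OF assms(1,2)] assms(3) by linarith

text \<open>The second alternative of \<open>congruent_or_inside\<close> would put \<open>w\<close>
  in the cone of \<open>u\<close> and \<open>v\<close>, where \<open>det2 v w\<close> and
  \<open>det2 w u\<close> are both at most 0.\<close>

lemma cone_congruent:
  assumes U: "U = {u, v, w}" and uv: "det2 u v > 0" and s: "det2 v w > 0 \<or> det2 w u > 0"
  obtains t where "v - u = det2 u v *s t"
proof -
  have "\<not> (\<exists>x\<in>U. x \<noteq> u \<and> x \<noteq> v \<and> (\<exists>a b. 0 \<le> a \<and> 0 \<le> b \<and> det2 u v *s x = a *s u + b *s v))"
  proof
    assume "\<exists>x\<in>U. x \<noteq> u \<and> x \<noteq> v \<and> (\<exists>a b. 0 \<le> a \<and> 0 \<le> b \<and> det2 u v *s x = a *s u + b *s v)"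
    then obtain a b where ab: "0 \<le> a" "0 \<le> b" "det2 u v *s w = a *s u + b *s v"
      using third_vertex[OF U] by blast
    have "det2 u v * det2 v w = a * det2 v u" "det2 u v * det2 w u = b * det2 v u"
      using arg_cong[OF ab(3), of "\<lambda>x. det2 v x"] arg_cong[OF ab(3), of "\<lambda>x. det2 x u"] by simp_all
    then have "det2 u v * det2 v w = det2 u v * - a" "det2 u v * det2 w u = det2 u v * - b"
      using det2_skew[of v u] by simp_all
    then have "det2 v w = - a" "det2 w u = - b"
      using uv by (metis less_irrefl mult_left_cancel)+
    then show False
      using s ab by linarith
  qed
  then show ?thesis
    using congruent_or_inside[of u v] that U uv by blast
qed

text \<open>Both edges at \<open>w\<close> are divisible by \<open>det2 u w\<close>, hence so is
  \<open>v - u\<close>, which is \<open>-2\<close> times \<open>u\<close>. As \<open>u\<close> is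
  primitive, the determinant divides 2.\<close>

lemma opposite_case:
  assumes U: "U = {u, v, w}" and v: "v = - u" and d: "det2 u w > 0"
  shows "det2 u w = 2 \<and> (\<exists>t. w - u = 2 *s t)"
proof -
  let ?d = "det2 u w"
  have inU: "u \<in> U" "v \<in> U" "w \<in> U"
    using U by auto
  have "U = {u, w, v}" "U = {w, v, u}"
    using U by auto
  have wv: "det2 w v = ?d"
    using v det2_skew[of w u] by simp
  obtain t where t: "w - u = ?d *s t"
    using cone_congruent[OF \<open>U = {u, w, v}\<close> d] wv d by auto
  obtain t' where t': "v - w = ?d *s t'"
    using cone_congruent[OF \<open>U = {w, v, u}\<close>] wv d by auto
  obtain b where b: "ip2 b u = 1"
    using primitive_vertex inU by metis
  have "?d * (ip2 b t + ip2 b t') = ip2 b (w - u) + ip2 b (v - w)"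
    by (simp only: t t' ip2_linear distrib_left)
  also have "\<dots> = - 2"
    using b v by simp
  finally have "?d dvd - 2"
    by (metis dvd_triv_left)
  then have "?d \<le> 2"
    by (intro zdvd_imp_le) auto
  then have "?d = 2"
    using det2_ge_2 inU d by force
  then show ?thesis
    using t by auto
qed

text \<open>Here \<open>w\<close> lies in the cone of \<open>u\<close> and \<open>v\<close>, and
  comparing areas gives \<open>d = a + b - a * b * \<delta>\<close>. For positive \<delta> this is
  at most 0; for \<delta> = 0 the vertices lie on a line at lattice distance one from the origin,
  against \<open>wide2\<close>; for negative \<delta> the vertex \<open>w\<close> has weight at
  least 1/2 at the origin, against \<open>half\<close>.\<close>

lemma ordered_case_impossible:
  assumes U: "U = {u, v, w}" and d: "det2 u w > 0" "det2 w v > 0" "det2 u v > 0"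
  shows False
proof -
  define a b d where ab: "a = det2 u w" "b = det2 w v" "d = det2 u v"
  have inU: "u \<in> U" "v \<in> U" "w \<in> U"
    using U by auto
  have ge: "a \<ge> 2" "b \<ge> 2"
    unfolding ab using det2_ge_2 inU assms by auto
  have "U = {u, w, v}" "U = {w, v, u}"
    using U by auto
  obtain t where t: "w - u = a *s t"
    unfolding ab(1) using cone_congruent[OF \<open>U = {u, w, v}\<close> d(1)] d by auto
  obtain t' where t': "v - w = b *s t'"
    unfolding ab(2) using cone_congruent[OF \<open>U = {w, v, u}\<close> d(2)] d by auto
  define \<delta> where "\<delta> = det2 t t'"
  have "a * b * \<delta> = det2 (w - u) (v - w)"
    unfolding t t' \<delta>_def by (simp add: mult.commute mult.left_commute)
  also have "\<dots> = a + b - d"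
    using ab det2_skew[of w u] by simp
  finally have eq: "d = a + b - a * b * \<delta>"
    by simp
  have "(a - 1) * (b - 1) \<ge> 1 * 1"
    using ge by (intro mult_mono) auto
  then have prod: "a * b \<ge> a + b"
    by (simp add: algebra_simps)
  consider "\<delta> \<ge> 1" | "\<delta> = 0" | "\<delta> \<le> - 1"
    by linarith
  then show False
  proof cases
    case 1
    then have "a * b * \<delta> \<ge> a * b * 1"
      using ge by (intro mult_left_mono) auto
    then show False
      using eq prod d(3) ab by linarith
  next
    case 2
    have "a * det2 u t = det2 u (w - u)"
      by (simp only: t det2_linear)
    then have "a * det2 u t = a * 1"
      using ab by simp
    then have u: "det2 u t = 1"
      using ge by simp
    have "w = u + a *s t" "v = w + b *s t'"
      using t t' by (metis add.commute diff_add_cancel)+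
    then have w: "det2 w t = 1" and v: "det2 v t = 1"
      using u 2 det2_skew[of t' t] by (simp_all add: \<delta>_def)
    define f where "f = (vector [t$2, - t$1] :: int^2)"
    have f: "ip2 f p = det2 p t" for p
      by (simp add: f_def ip2_def det2_def algebra_simps)
    have "f \<noteq> 0"
      using f[of u] u by (auto simp: ip2_def)
    then obtain p q where "p \<in> insert 0 U" "q \<in> insert 0 U" "ip2 f p - ip2 f q \<ge> 2"
      using wide2 by blast
    then show False
      using u v w f U by auto
  next
    case 3
    then have "a * b * \<delta> \<le> a * b * - 1"
      using ge by (intro mult_left_mono) auto
    then have "a * b * \<delta> \<le> - (a * b)"
      by simp
    then have "d \<ge> a + b + a * b"
      using eq by simp
    then have "d \<ge> 2 * a + 2 * b"
      using prod by linarith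
    then have "d \<le> 2 * (d - b - a)"
      by simp
    moreover have "d *s w = b *s u + a *s v"
      unfolding ab by (rule det2_cramer)
    moreover have "w \<noteq> 0"
      using inU nonzero by auto
    ultimately show False
      using half[of u v w b a d] inU ge d(3) ab by auto
  qed
qed

text \<open>The origin is interior, so the determinants add up to the normalized area of the
  triangle. Any two edges have this area as determinant, and the divisibility of the edges makes it
  a multiple of each product of two.\<close>

lemma cyclic_case:
  assumes U: "U = {u, v, w}" and d: "det2 u v > 0" "det2 v w > 0" "det2 w u > 0"
  shows "(det2 u v, det2 v w, det2 w u) \<in> {(3, 3, 3), (2, 2, 4), (2, 4, 2), (4, 2, 2)} \<and>
    (\<exists>t. v - u = det2 u v *s t) \<and> (\<exists>t. w - v = det2 v w *s t) \<and> (\<exists>t. u - w = det2 w u *s t)"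
proof -
  define a b c where ab: "a = det2 u v" "b = det2 v w" "c = det2 w u"
  have inU: "u \<in> U" "v \<in> U" "w \<in> U" and rot: "U = {v, w, u}" "U = {w, u, v}"
    using U by auto
  have ge: "a \<ge> 2" "b \<ge> 2" "c \<ge> 2"
    unfolding ab using det2_ge_2 inU assms by auto
  obtain t where t: "v - u = a *s t"
    unfolding ab(1) using cone_congruent[OF U d(1)] d by blast
  obtain t' where t': "w - v = b *s t'"
    unfolding ab(2) using cone_congruent[OF rot(1) d(2)] d by blast
  obtain t'' where t'': "u - w = c *s t''"
    unfolding ab(3) using cone_congruent[OF rot(2) d(3)] d by blast
  have skew: "det2 u w = - c" "det2 v u = - a" "det2 w v = - b"
    using ab det2_skew[of u w] det2_skew[of v u] det2_skew[of w v] by simp_all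
  have "det2 (v - u) (w - v) = a + b + c" "det2 (w - v) (u - w) = a + b + c" "det2 (u - w) (v - u) = a + b + c"
    using ab skew by simp_all
  then have "a + b + c = a * b * det2 t t'" "a + b + c = b * c * det2 t' t''" "a + b + c = c * a * det2 t'' t"
    unfolding t t' t'' by (simp_all add: mult.commute mult.left_commute)
  then have "(a, b, c) \<in> {(3, 3, 3), (2, 2, 4), (2, 4, 2), (4, 2, 2)}"
    using ge by (intro pairwise_product_dvd_sum) (metis dvd_triv_left)+
  then show ?thesis
    using t t' t'' unfolding ab by blast
qed

lemma parallel_vertices:
  assumes "u \<in> U" "v \<in> U" "u \<noteq> v" "det2 u v = 0"
  shows "v = - u"
proof -
  have *: "y = ip2 b y *s x" if "ip2 b x = 1" "det2 x y = 0" for b x y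
  proof -
    have "b$1 * x$1 + b$2 * x$2 = 1" "x$1 * y$2 = x$2 * y$1"
      using that by (simp_all add: ip2_def det2_def)
    then show ?thesis
      unfolding vec_eq_iff forall_2 ip2_def vector_smult_component by (intro conjI; algebra)
  qed
  obtain b b' where b: "ip2 b u = 1" "ip2 b' v = 1"
    using primitive_vertex assms(1,2) by metis
  have v: "v = ip2 b v *s u"
    using *[OF b(1) assms(4)] .
  then have "ip2 b' v = ip2 b v * ip2 b' u"
    by (metis ip2_linear(3))
  then have "\<bar>ip2 b v\<bar> = 1"
    using b(2) by (metis abs_zmult_eq_1 abs_1)
  moreover have "ip2 b v \<noteq> 1"
    using v assms(3) by auto
  ultimately have "ip2 b v = - 1"
    by linarith
  then show ?thesis
    using v by (simp add: vec_eq_iff)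
qed

theorem planar_classification:
  "(\<exists>u v w. U = {u, v, w} \<and> v = - u \<and> det2 u w = 2 \<and> (\<exists>t. w - u = 2 *s t)) \<or>
   (\<exists>u v w. U = {u, v, w} \<and> w = - u - v \<and> det2 u v = 3 \<and> (\<exists>t. v - u = 3 *s t)) \<or>
   (\<exists>u v w. U = {u, v, w} \<and> w = - u - 2 *s v \<and> det2 u v = 2 \<and>
      (\<exists>t. v - u = 2 *s t) \<and> (\<exists>t. w - v = 2 *s t))"
proof (cases "\<exists>u\<in>U. \<exists>v\<in>U. u \<noteq> v \<and> det2 u v = 0")
  case True
  then obtain u v where uv: "u \<in> U" "v \<in> U" "u \<noteq> v" "det2 u v = 0"
    by blast
  then have v: "v = - u"
    using parallel_vertices by blast
  obtain w where w: "U = {u, v, w}"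
    using uv(1-3) distinct unfolding U_def by auto
  have "u \<noteq> 0"
    using uv nonzero by auto
  have "det2 u w \<noteq> 0"
  proof
    assume 0: "det2 u w = 0"
    define f where "f = (vector [- u$2, u$1] :: int^2)"
    have f: "ip2 f p = det2 u p" for p
      by (simp add: f_def ip2_def det2_def algebra_simps)
    have "f \<noteq> 0"
      using \<open>u \<noteq> 0\<close> by (auto simp: f_def vec_eq_iff forall_2)
    then show False
      using wide2[of f] f w uv(4) 0 by auto
  qed
  then consider "det2 u w > 0" | "det2 v w > 0"
    using v by fastforce
  then have "\<exists>u v w. U = {u, v, w} \<and> v = - u \<and> det2 u w = 2 \<and> (\<exists>t. w - u = 2 *s t)"
  proof cases
    case 1
    then show ?thesis
      using opposite_case[OF w v] w v by blast
  next
    case 2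
    have "U = {v, u, w}" "u = - v"
      using w v by auto
    then show ?thesis
      using opposite_case[of v u w] 2 by blast
  qed
  then show ?thesis
    by blast
next
  case False
  then have nz: "det2 u1 u2 \<noteq> 0" "det2 u2 u3 \<noteq> 0" "det2 u3 u1 \<noteq> 0"
    using distinct unfolding U_def by auto
  have perm: "U = {u1, u2, u3}" "U = {u2, u1, u3}" "U = {u1, u3, u2}" "U = {u3, u1, u2}" "U = {u2, u3, u1}" "U = {u3, u2, u1}"
    unfolding U_def by auto
  have sk: "det2 u2 u1 = - det2 u1 u2" "det2 u3 u2 = - det2 u2 u3" "det2 u1 u3 = - det2 u3 u1"
    by (rule det2_skew)+
  have "\<exists>u v w. U = {u, v, w} \<and> det2 u v > 0 \<and> det2 v w > 0 \<and> det2 w u > 0"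
  proof (rule ccontr)
    assume *: "\<not> ?thesis"
    \<comment> \<open>Two of the eight sign patterns are cyclic; each of the other six puts one
      vertex in the cone of the other two.\<close>
    consider "det2 u1 u2 > 0 \<and> det2 u2 u3 > 0 \<and> det2 u3 u1 > 0"
      | "det2 u1 u2 < 0 \<and> det2 u2 u3 < 0 \<and> det2 u3 u1 < 0"
      | "det2 u1 u2 > 0 \<and> det2 u2 u3 > 0 \<and> det2 u3 u1 < 0"
      | "det2 u2 u3 > 0 \<and> det2 u3 u1 > 0 \<and> det2 u1 u2 < 0"
      | "det2 u3 u1 > 0 \<and> det2 u1 u2 > 0 \<and> det2 u2 u3 < 0"
      | "det2 u1 u2 < 0 \<and> det2 u2 u3 < 0 \<and> det2 u3 u1 > 0"
      | "det2 u2 u3 < 0 \<and> det2 u3 u1 < 0 \<and> det2 u1 u2 > 0"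
      | "det2 u3 u1 < 0 \<and> det2 u1 u2 < 0 \<and> det2 u2 u3 > 0"
      using nz unfolding linorder_neq_iff by blast
    then show False
    proof cases
      case 1
      then show False
        using * perm(1) by blast
    next
      case 2
      then show False
        using * perm(6) sk by (metis neg_0_less_iff_less)
    next
      case 3
      then show False
        using ordered_case_impossible[OF perm(3)] sk by simp
    next
      case 4
      then show False
        using ordered_case_impossible[OF perm(2)] sk by simp
    next
      case 5
      then show False
        using ordered_case_impossible[OF perm(6)] sk by simp
    next
      case 6
      then show False
        using ordered_case_impossible[OF perm(4)] sk by simp
    next
      case 7
      then show False
        using ordered_case_impossible[OF perm(1)] sk by simp
    next
      case 8
      then show False
        using ordered_case_impossible[OF perm(5)] sk by simp
    qed
  qed
  then obtain u v w where U: "U = {u, v, w}" and d: "det2 u v > 0" "det2 v w > 0" "det2 w u > 0"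
    by blast
  have rel: "w' = - u' - 2 *s v'" if "(det2 u' v', det2 v' w', det2 w' u') = (2, 2, 4)" for u' v' w'
  proof -
    have "2 *s w' = - 2 *s u' - 4 *s v'"
      using that det2_cramer[of u' v' w'] det2_skew[of w' v'] det2_skew[of u' w']
      by (simp add: vec_eq_iff)
    then have "2 * w' $ i = 2 * (- u' - 2 *s v') $ i" for i
      by (simp add: vec_eq_iff)
    then have "w' $ i = (- u' - 2 *s v') $ i" for i
      by (metis mult_left_cancel zero_neq_numeral)
    then show ?thesis
      unfolding vec_eq_iff by blast
  qed
  have rot: "U = {v, w, u}" "U = {w, u, v}"
    using U by auto
  obtain t1 t2 t3 where t: "v - u = det2 u v *s t1" "w - v = det2 v w *s t2" "u - w = det2 w u *s t3"
    using cyclic_case[OF U d] by blast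
  consider "(det2 u v, det2 v w, det2 w u) = (3, 3, 3)" | "(det2 u v, det2 v w, det2 w u) = (2, 2, 4)"
    | "(det2 w u, det2 u v, det2 v w) = (2, 2, 4)" | "(det2 v w, det2 w u, det2 u v) = (2, 2, 4)"
    using cyclic_case[OF U d] by auto
  then show ?thesis
  proof cases
    case 1
    have "3 *s w = - 3 *s u - 3 *s v"
      using 1 det2_cramer[of u v w] det2_skew[of w v] det2_skew[of u w]
      by (simp add: vec_eq_iff)
    then have "3 * w $ i = 3 * (- u - v) $ i" for i
      by (simp add: vec_eq_iff)
    then have "w $ i = (- u - v) $ i" for i
      by (metis mult_left_cancel zero_neq_numeral)
    then have "w = - u - v"
      unfolding vec_eq_iff by blast
    moreover have "det2 u v = 3" "v - u = 3 *s t1"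
      using 1 t(1) by simp_all
    ultimately show ?thesis
      using U by - (rule disjI2, rule disjI1, rule exI[of _ u], rule exI[of _ v], rule exI[of _ w], (intro conjI; metis))
  next
    case 2
    then have "det2 u v = 2" "v - u = 2 *s t1" "w - v = 2 *s t2"
      using t(1,2) by simp_all
    then show ?thesis
      using U rel[OF 2]
      by - (rule disjI2, rule disjI2, rule exI[of _ u], rule exI[of _ v], rule exI[of _ w], (intro conjI; metis))
  next
    case 3
    then have "det2 w u = 2" "u - w = 2 *s t3" "v - u = 2 *s t1"
      using t(3,1) by simp_all
    then show ?thesis
      using rot(2) rel[OF 3]
      by - (rule disjI2, rule disjI2, rule exI[of _ w], rule exI[of _ u], rule exI[of _ v], (intro conjI; metis))
  next
    case 4
    then have "det2 v w = 2" "w - v = 2 *s t2" "u - w = 2 *s t3"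
      using t(2,3) by simp_all
    then show ?thesis
      using rot(1) rel[OF 4]
      by - (rule disjI2, rule disjI2, rule exI[of _ v], rule exI[of _ w], rule exI[of _ u], (intro conjI; metis))
  qed
qed

end

section \<open>Unimodular maps\<close>

text \<open>\<open>B\<close> is the adjugate. Since \<open>det A\<close> is its own inverse,
  multiplying by it replaces the division.\<close>

lemma unimodular_inverse:
  fixes A :: "int^3^3"
  assumes "\<bar>det A\<bar> = 1"
  obtains B where "A ** B = mat 1" "B ** A = mat 1"
proof -
  define B :: "int^3^3" where "B = vector [
    vector [A$2$2 * A$3$3 - A$2$3 * A$3$2, A$1$3 * A$3$2 - A$1$2 * A$3$3, A$1$2 * A$2$3 - A$1$3 * A$2$2],
    vector [A$2$3 * A$3$1 - A$2$1 * A$3$3, A$1$1 * A$3$3 - A$1$3 * A$3$1, A$1$3 * A$2$1 - A$1$1 * A$2$3],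
    vector [A$2$1 * A$3$2 - A$2$2 * A$3$1, A$1$2 * A$3$1 - A$1$1 * A$3$2, A$1$1 * A$2$2 - A$1$2 * A$2$1]]"
  define C :: "int^3^3" where "C = (\<chi> i j. det A * B$i$j)"
  have dd: "det A * det A = 1"
    using assms by (metis abs_mult_self_eq mult_1)
  have AB: "(\<Sum>k\<in>UNIV. A$i$k * B$k$j) = (if i = j then det A else 0)"
    and BA: "(\<Sum>k\<in>UNIV. B$i$k * A$k$j) = (if i = j then det A else 0)" for i j
    using exhaust_3[of i] exhaust_3[of j]
    by (auto simp: B_def sum_3 det_3 algebra_simps)
  have "(\<Sum>k\<in>UNIV. A$i$k * C$k$j) = det A * (\<Sum>k\<in>UNIV. A$i$k * B$k$j)"
    "(\<Sum>k\<in>UNIV. C$i$k * A$k$j) = det A * (\<Sum>k\<in>UNIV. B$i$k * A$k$j)" for i j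
    by (simp_all add: C_def sum_distrib_left mult.left_commute mult.assoc)
  then have "A ** C = mat 1" "C ** A = mat 1"
    using AB BA dd by (simp_all add: matrix_matrix_mult_def mat_def vec_eq_iff)
  then show ?thesis
    using that by blast
qed

definition umap :: "(int^3 \<Rightarrow> int^3) \<Rightarrow> bool"
  where "umap \<Phi> \<longleftrightarrow> (\<exists>A t. \<bar>det A\<bar> = 1 \<and> \<Phi> = (\<lambda>p. A *v p + t))"

lemma umapI: "\<bar>det A\<bar> = 1 \<Longrightarrow> umap (\<lambda>p. A *v p + t)"
  unfolding umap_def by blast

lemma umap_comp:
  assumes "umap \<Phi>" "umap \<Psi>"
  shows "umap (\<lambda>p. \<Phi> (\<Psi> p))"
proof -
  obtain A t B u where *: "\<bar>det A\<bar> = 1" "\<Phi> = (\<lambda>p. A *v p + t)" "\<bar>det B\<bar> = 1" "\<Psi> = (\<lambda>p. B *v p + u)"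
    using assms unfolding umap_def by blast
  have "(\<lambda>p. \<Phi> (\<Psi> p)) = (\<lambda>p. (A ** B) *v p + (A *v u + t))"
    by (simp add: * matrix_vector_mul_assoc matrix_vector_right_distrib add.assoc)
  moreover have "\<bar>det (A ** B)\<bar> = 1"
    using * by (simp add: det_mul abs_mult)
  ultimately show ?thesis
    unfolding umap_def by blast
qed

lemma umap_inverse:
  assumes "umap \<Phi>"
  obtains \<Psi> where "umap \<Psi>" "\<And>p. \<Psi> (\<Phi> p) = p" "\<And>p. \<Phi> (\<Psi> p) = p"
proof -
  obtain A t where A: "\<bar>det A\<bar> = 1" "\<Phi> = (\<lambda>p. A *v p + t)"
    using assms unfolding umap_def by blast
  obtain B where B: "A ** B = mat 1" "B ** A = mat 1"
    using unimodular_inverse[OF A(1)] by metis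
  have "det A * det B = 1"
    using B(1) by (metis det_I det_mul)
  then have "\<bar>det B\<bar> = 1"
    by (metis abs_zmult_eq_1 abs_1 mult.commute)
  then have "umap (\<lambda>p. B *v p + - (B *v t))"
    by (rule umapI)
  moreover have "B *v \<Phi> p + - (B *v t) = p" "\<Phi> (B *v p + - (B *v t)) = p" for p
    by (simp_all add: A matrix_vector_right_distrib matrix_vector_mult_diff_distrib
        matrix_vector_mul_assoc B)
  ultimately show ?thesis
    using that by blast
qed

lemma ip_matrix: "ip f (A *v p) = ip (transpose A *v f) p"
  by (simp add: ip_def matrix_vector_mult_def sum_3 transpose_def algebra_simps)

lemma transpose_unimodular_nonzero:
  assumes "\<bar>det A\<bar> = 1" "f \<noteq> 0"
  shows "transpose A *v f \<noteq> (0 :: int^3)"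
proof
  assume 0: "transpose A *v f = 0"
  have "\<bar>det (transpose A)\<bar> = 1"
    using assms(1) by simp
  then obtain B where "B ** transpose A = mat 1"
    using unimodular_inverse by metis
  then have "f = B *v (transpose A *v f)"
    by (metis matrix_vector_mul_assoc matrix_vector_mul_lid)
  then show False
    using 0 assms(2) by simp
qed

lemma idet_matrix: "idet (A *v p) (A *v q) (A *v r) = det A * idet p q r"
proof -
  have *: "idet a b c = det (vector [a, b, c] :: int^3^3)" for a b c
    by (simp add: ivec_simps det_3 algebra_simps)
  have "(vector [A *v p, A *v q, A *v r] :: int^3^3) = vector [p, q, r] ** transpose A"
    by (simp add: vec_eq_iff forall_3 matrix_vector_mult_def matrix_matrix_mult_def transpose_def sum_3 mult.commute)
  then show ?thesis
    by (simp add: * det_mul)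
qed

lemma umap_wide:
  assumes "umap \<Phi>" "wide Y"
  shows "wide (\<Phi> ` Y)"
proof -
  obtain A t where A: "\<bar>det A\<bar> = 1" "\<Phi> = (\<lambda>p. A *v p + t)"
    using assms(1) unfolding umap_def by blast
  have "\<not> spread1 f (\<Phi> ` Y)" if "f \<noteq> 0" for f
  proof
    assume "spread1 f (\<Phi> ` Y)"
    then have "spread1 (transpose A *v f) Y"
      by (simp add: spread1_def A ip_matrix)
    then show False
      using assms(2) transpose_unimodular_nonzero[OF A(1) that] by (simp add: wide_def)
  qed
  then show ?thesis
    by (simp add: wide_def)
qed

lemma umap_idet:
  assumes "umap \<Phi>"
  shows "\<bar>idet (\<Phi> q - \<Phi> p) (\<Phi> r - \<Phi> p) (\<Phi> s - \<Phi> p)\<bar> = \<bar>idet (q - p) (r - p) (s - p)\<bar>"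
proof -
  obtain A t where A: "\<bar>det A\<bar> = 1" "\<Phi> = (\<lambda>p. A *v p + t)"
    using assms unfolding umap_def by blast
  then show ?thesis
    by (simp add: idet_matrix abs_mult flip: matrix_vector_mult_diff_distrib)
qed

lemma umap_idet_zero:
  assumes "umap \<Phi>"
  shows "idet (\<Phi> q - \<Phi> p) (\<Phi> r - \<Phi> p) (\<Phi> s - \<Phi> p) = 0 \<longleftrightarrow> idet (q - p) (r - p) (s - p) = 0"
  using umap_idet[OF assms, of q p r s] by linarith

lemma umap_flat: "umap \<Phi> \<Longrightarrow> flat Y \<Longrightarrow> flat (\<Phi> ` Y)"
  by (simp add: flat_def umap_idet_zero)

lemma umap_no_unimodular: "umap \<Phi> \<Longrightarrow> no_unimodular Y \<Longrightarrow> no_unimodular (\<Phi> ` Y)"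
  unfolding no_unimodular_def by (simp add: umap_idet)

lemma umap_saturated:
  assumes "umap \<Phi>" "saturated X"
  shows "saturated (\<Phi> ` X)"
  unfolding saturated_def
proof (intro ballI allI impI)
  fix p q r s a b c d x
  assume mem: "p \<in> \<Phi> ` X" "q \<in> \<Phi> ` X" "r \<in> \<Phi> ` X" "s \<in> \<Phi> ` X"
    and pos: "0 \<le> a" "0 \<le> b" "0 \<le> c" "0 \<le> d" "0 < a + b + c + d"
    and eq: "(a + b + c + d) *s x = a *s p + b *s q + c *s r + d *s s"
  obtain \<Psi> where \<Psi>: "umap \<Psi>" "\<And>p. \<Psi> (\<Phi> p) = p" "\<And>p. \<Phi> (\<Psi> p) = p"
    using umap_inverse[OF assms(1)] by metis
  have mem': "\<Psi> p \<in> X" "\<Psi> q \<in> X" "\<Psi> r \<in> X" "\<Psi> s \<in> X"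
    using mem \<Psi>(2) by auto
  obtain B u where B: "\<Psi> = (\<lambda>p. B *v p + u)"
    using \<Psi>(1) unfolding umap_def by blast
  have "(a + b + c + d) *s \<Psi> x = B *v ((a + b + c + d) *s x) + (a + b + c + d) *s u"
    by (simp add: B vector_add_ldistrib matrix_vector_mult_scaleR vec_eq_iff matrix_vector_mult_def sum_3 algebra_simps)
  also have "\<dots> = a *s \<Psi> p + b *s \<Psi> q + c *s \<Psi> r + d *s \<Psi> s"
    unfolding eq by (simp add: B vec_eq_iff matrix_vector_mult_def sum_3 algebra_simps)
  finally have "\<Psi> x \<in> X"
    using assms(2) mem' pos unfolding saturated_def by metis
  then show "x \<in> \<Phi> ` X"
    using \<Psi>(3) by (metis imageI)
qed

text \<open>Vertices as seen by integer functionals: the notion refers to \<open>X\<close> alone, so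
  no real polytope has to be carried through changes of coordinates.\<close>

definition exposed :: "(int^3) set \<Rightarrow> int^3 \<Rightarrow> bool"
  where "exposed X u \<longleftrightarrow> u \<in> X \<and> (\<exists>f. \<forall>p\<in>X - {u}. ip f p < ip f u)"

locale exposed_points = lattice_points +
  assumes exposed_non_merged: "exposed X u \<Longrightarrow> exposed X v \<Longrightarrow> u \<noteq> v \<Longrightarrow>
      \<not> wide (X - {u}) \<or> \<not> wide (X - {v}) \<or> flat (X - {u, v})"

lemma umap_inj: "umap \<Phi> \<Longrightarrow> inj \<Phi>"
  by (metis injI umap_inverse)

lemma umap_exposed:
  assumes "umap \<Phi>" "exposed (\<Phi> ` X) (\<Phi> u)"
  shows "exposed X u"
proof -
  obtain A t where A: "\<bar>det A\<bar> = 1" "\<Phi> = (\<lambda>p. A *v p + t)"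
    using assms(1) unfolding umap_def by blast
  obtain f where f: "\<forall>p\<in>\<Phi> ` X - {\<Phi> u}. ip f p < ip f (\<Phi> u)"
    using assms(2) by (auto simp: exposed_def)
  have inj: "\<Phi> x = \<Phi> y \<longleftrightarrow> x = y" for x y
    using umap_inj[OF assms(1)] by (simp add: inj_eq)
  have "u \<in> X"
    using assms(2) by (auto simp: exposed_def inj)
  moreover have "ip (transpose A *v f) p < ip (transpose A *v f) u" if "p \<in> X - {u}" for p
  proof -
    have "\<Phi> p \<in> \<Phi> ` X - {\<Phi> u}"
      using that inj by auto
    then have "ip f (\<Phi> p) < ip f (\<Phi> u)"
      using f by blast
    then show ?thesis
      by (simp add: A ip_matrix)
  qed
  ultimately show ?thesis
    by (auto simp: exposed_def)
qed

lemma umap_exposed_points: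
  assumes "umap \<Phi>" "exposed_points X"
  shows "exposed_points (\<Phi> ` X)"
proof -
  interpret exposed_points X by fact
  obtain \<Psi> where \<Psi>: "umap \<Psi>" "\<And>p. \<Psi> (\<Phi> p) = p" "\<And>p. \<Phi> (\<Psi> p) = p"
    using umap_inverse[OF assms(1)] by metis
  have inj: "inj \<Phi>"
    using umap_inj assms(1) .
  show ?thesis
  proof
    show "finite (\<Phi> ` X)" "saturated (\<Phi> ` X)" "no_unimodular (\<Phi> ` X)" "wide (\<Phi> ` X)" "card (\<Phi> ` X) \<ge> 8"
      using umap_saturated[OF assms(1) sat] umap_no_unimodular[OF assms(1) nouni]
        umap_wide[OF assms(1) wide] fin size card_image[OF inj_on_subset[OF inj subset_UNIV], of X]
      by simp_all
    fix u v assume uv: "exposed (\<Phi> ` X) u" "exposed (\<Phi> ` X) v" "u \<noteq> v"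
    then obtain u' v' where *: "u = \<Phi> u'" "v = \<Phi> v'" "u' \<in> X" "v' \<in> X"
      unfolding exposed_def by blast
    have "exposed (\<Phi> ` X) (\<Phi> u')" "exposed (\<Phi> ` X) (\<Phi> v')"
      using uv * by simp_all
    then have "exposed X u'" "exposed X v'"
      using umap_exposed[OF assms(1)] by blast+
    moreover have "u' \<noteq> v'"
      using uv(3) * by blast
    ultimately have "\<not> wide (X - {u'}) \<or> \<not> wide (X - {v'}) \<or> flat (X - {u', v'})"
      by (rule exposed_non_merged)
    moreover have "\<Phi> ` X - {\<Phi> p} = \<Phi> ` (X - {p})" "\<Phi> ` X - {\<Phi> p, \<Phi> q} = \<Phi> ` (X - {p, q})" for p q
      using inj by (auto simp: inj_eq)
    moreover have "wide Y" if "wide (\<Phi> ` Y)" for Y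
      using umap_wide[OF \<Psi>(1) that] by (simp add: image_image \<Psi>)
    ultimately show "\<not> wide (\<Phi> ` X - {u}) \<or> \<not> wide (\<Phi> ` X - {v}) \<or> flat (\<Phi> ` X - {u, v})"
      using umap_flat[OF assms(1)] * by metis
  qed
qed

lemma primitive_to_axis:
  assumes "primitive e"
  obtains A :: "int^3^3" where "\<bar>det A\<bar> = 1" "A *v e = vector [0, 0, 1]"
proof -
  define g where "g = gcd (e$1) (e$2)"
  obtain b :: "int^3" where b: "b$1 * e$1 + b$2 * e$2 + b$3 * e$3 = 1"
    using assms by (auto simp: primitive_def ip_def)
  show ?thesis
  proof (cases "g = 0")
    case True
    then have e: "e$1 = 0" "e$2 = 0"
      by (auto simp: g_def)
    then have e3: "b$3 * e$3 = 1"
      using b by simp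
    define A :: "int^3^3" where "A = vector [vector [1, 0, 0], vector [0, 1, 0], vector [0, 0, b$3]]"
    have "\<bar>det A\<bar> = 1" "A *v e = vector [0, 0, 1]"
      using e e3 by (auto simp: A_def det_3 vec_eq_iff forall_3 matrix_vector_mult_def sum_3 dest: abs_zmult_eq_1
          intro: abs_zmult_eq_1[of _ "e$3"])
    then show ?thesis
      using that by blast
  next
    case False
    define x y where "x = e$1 div g" and "y = e$2 div g"
    have xy: "e$1 = g * x" "e$2 = g * y"
      by (simp_all add: x_def y_def g_def)
    obtain r s where "r * e$1 + s * e$2 = g"
      unfolding g_def using bezout_int by metis
    then have "g * (r * x + s * y) = g * 1"
      by (simp add: xy algebra_simps)
    then have rs: "r * x + s * y = 1"
      using False by simp
    define k where "k = b$1 * x + b$2 * y"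
    have k: "k * g + b$3 * e$3 = 1"
      using b by (simp add: xy k_def algebra_simps)
    \<comment> \<open>The first row annihilates \<open>e\<close> since \<open>(x, y)\<close> is
      parallel to its first two coordinates, the second since the Bezout relation cancels against
      \<open>g * e$3\<close>, and the third is a dual vector of \<open>e\<close> built on
      \<open>(r, s)\<close>. The determinant becomes -1.\<close>
    define A :: "int^3^3" where "A = vector [vector [y, - x, 0],
      vector [- e$3 * r, - e$3 * s, g], vector [k * r, k * s, b$3]]"
    have "det A = - (r * x + s * y) * (k * g + b$3 * e$3)"
      by (simp add: A_def det_3 algebra_simps)
    then have "\<bar>det A\<bar> = 1"
      using rs k by simp
    moreover have "A *v e = vector [0, g * e$3 * (1 - (r * x + s * y)), k * g * (r * x + s * y) + b$3 * e$3]"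
      by (simp add: A_def vec_eq_iff forall_3 matrix_vector_mult_def sum_3 xy algebra_simps)
    then have "A *v e = vector [0, 0, 1]"
      using rs k by simp
    ultimately show ?thesis
      using that by blast
  qed
qed

section \<open>Three lattice points off a segment\<close>

abbreviation pt :: "int \<Rightarrow> int \<Rightarrow> int \<Rightarrow> int^3"
  where "pt x y z \<equiv> vector [x, y, z]"

definition proj :: "int^3 \<Rightarrow> int^2"
  where "proj p = vector [p$1, p$2]"

definition zsegment :: "int \<Rightarrow> int \<Rightarrow> (int^3) set"
  where "zsegment l h = {p. p$1 = 0 \<and> p$2 = 0 \<and> l \<le> p$3 \<and> p$3 \<le> h}"

lemma proj_linear [simp]:
  "proj (a + b) = proj a + proj b" "proj (a - b) = proj a - proj b" "proj (k *s a) = k *s proj a" "proj 0 = 0"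
  by (simp_all add: proj_def vec_eq_iff forall_2)

lemma proj_eq_0: "proj p = 0 \<longleftrightarrow> p$1 = 0 \<and> p$2 = 0"
  by (simp add: proj_def vec_eq_iff forall_2)

lemma proj_zsegment: "p \<in> zsegment l h \<Longrightarrow> proj p = 0"
  by (simp add: zsegment_def proj_eq_0)

lemma pt_zsegment: "pt x y z \<in> zsegment l h \<longleftrightarrow> x = 0 \<and> y = 0 \<and> l \<le> z \<and> z \<le> h"
  by (simp add: zsegment_def)

lemma zsegment_eq_image: "zsegment l h = pt 0 0 ` {l..h}"
proof -
  have "p \<in> pt 0 0 ` {l..h}" if "p \<in> zsegment l h" for p
  proof
    show "p = pt 0 0 (p$3)" "p$3 \<in> {l..h}"
      using that by (simp_all add: zsegment_def vec_eq_iff forall_3)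
  qed
  then show ?thesis
    by (auto simp: zsegment_def)
qed

lemma card_zsegment: "card (zsegment l h) = nat (h - l + 1)"
proof -
  have "inj (pt 0 0)"
    by (auto simp: inj_def vec_eq_iff forall_3)
  then show ?thesis
    by (simp add: zsegment_eq_image card_image inj_on_subset)
qed

lemma finite_zsegment: "finite (zsegment l h)"
  by (simp add: zsegment_eq_image)

text \<open>The situation once the direction of the spike is vertical. Eight points without three
  leave five on the axis, whence the bound 4 in \<open>long\<close>.\<close>

locale spiked_points = exposed_points +
  fixes l h :: int and W :: "(int^3) set"
  assumes X_eq: "X = zsegment l h \<union> W"
    and long: "h - l \<ge> 4"
    and inj: "inj_on proj W"
    and off: "0 \<notin> proj ` W"
    and card_W: "card W = 3"

text \<open>The kernel direction goes to the third axis and one point of the line to the origin, so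
  the fibres of \<open>f1\<close>, \<open>f2\<close> become the fibres of \<open>proj\<close>.
  Saturation fills the range between the lowest and the highest point.\<close>

lemma spike_zsegment:
  assumes "exposed_points X" "spike X f1 f2 v1 v2 v3"
  obtains \<Phi> l h W where "umap \<Phi>" "spiked_points (\<Phi> ` X) l h W"
proof -
  interpret exposed_points X by fact
  let ?g = "\<lambda>p. (ip f1 p, ip f2 p)"
  let ?S = "X - {v1, v2, v3}"
  have cr: "icross f1 f2 \<noteq> 0" and vX: "{v1, v2, v3} \<subseteq> X" and dist: "distinct [?g v1, ?g v2, ?g v3]"
    and S: "\<forall>s\<in>?S. ?g s \<notin> {?g v1, ?g v2, ?g v3} \<and> (\<forall>s'\<in>?S. ?g s = ?g s')"
    using assms(2) unfolding spike_def Let_def by blast+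
  obtain e where e: "primitive e" "ip f1 e = 0" "ip f2 e = 0"
    "\<And>p. ip f1 p = 0 \<Longrightarrow> ip f2 p = 0 \<Longrightarrow> \<exists>k. p = k *s e"
    using kernel_generator[OF cr] by metis
  obtain A where A: "\<bar>det A\<bar> = 1" "A *v e = pt 0 0 1"
    using primitive_to_axis[OF e(1)] by metis
  have "card ?S > 0"
    using card_Diff_ge(1)[of v1 v2 v3] by linarith
  then have "?S \<noteq> {}"
    by (metis card.empty less_irrefl)
  then obtain s0 where s0: "s0 \<in> ?S"
    by blast
  define \<Phi> where "\<Phi> = (\<lambda>p. A *v p + - (A *v s0))"
  have um: "umap \<Phi>"
    unfolding \<Phi>_def using A(1) by (rule umapI)
  have diff: "\<Phi> p - \<Phi> q = A *v (p - q)" for p q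
    by (simp add: \<Phi>_def matrix_vector_mult_diff_distrib)
  have Ae: "A *v (k *s e) = pt 0 0 k" for k
  proof -
    have "A *v (k *s e) = k *s (A *v e)"
      by (simp add: vec_eq_iff matrix_vector_mult_def sum_distrib_left mult_ac)
    then show ?thesis
      by (simp add: A(2) vec_eq_iff forall_3)
  qed
  obtain B where B: "B ** A = mat 1"
    using unimodular_inverse[OF A(1)] by metis
  have proj_eq: "proj (\<Phi> p) = proj (\<Phi> q) \<longleftrightarrow> ?g p = ?g q" for p q
  proof
    assume "?g p = ?g q"
    then obtain k where "p - q = k *s e"
      using e(4)[of "p - q"] by auto
    then have "\<Phi> p - \<Phi> q = pt 0 0 k"
      using diff Ae by simp
    then have "proj (\<Phi> p - \<Phi> q) = 0"
      by (simp add: proj_eq_0 del: proj_linear)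
    then show "proj (\<Phi> p) = proj (\<Phi> q)"
      by simp
  next
    assume "proj (\<Phi> p) = proj (\<Phi> q)"
    then have "proj (\<Phi> p - \<Phi> q) = 0"
      by simp
    then have "(\<Phi> p - \<Phi> q)$1 = 0 \<and> (\<Phi> p - \<Phi> q)$2 = 0"
      unfolding proj_eq_0 .
    then have "\<Phi> p - \<Phi> q = pt 0 0 ((\<Phi> p - \<Phi> q)$3)"
      unfolding vec_eq_iff forall_3 vector_3 by blast
    then have "A *v (p - q) = A *v ((\<Phi> p - \<Phi> q)$3 *s e)"
      unfolding Ae diff .
    then have "p - q = (\<Phi> p - \<Phi> q)$3 *s e"
      by (metis B matrix_vector_mul_assoc matrix_vector_mul_lid)
    then have "ip f1 (p - q) = 0" "ip f2 (p - q) = 0"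
      using e(2,3) ip_scale by (metis mult_zero_right)+
    then show "?g p = ?g q"
      by simp
  qed
  have "\<Phi> s0 = 0"
    by (simp add: \<Phi>_def)
  have proj_0: "proj (\<Phi> p) = 0 \<longleftrightarrow> ?g p = ?g s0" for p
    using proj_eq[of p s0] \<open>\<Phi> s0 = 0\<close> by simp
  define W where "W = \<Phi> ` {v1, v2, v3}"
  define Z where "Z = (\<lambda>p. \<Phi> p $ 3) ` ?S"
  have Z: "finite Z" "Z \<noteq> {}"
    using fin s0 by (auto simp: Z_def)
  define l h where "l = Min Z" and "h = Max Z"
  interpret X': exposed_points "\<Phi> ` X"
    using umap_exposed_points[OF um assms(1)] .
  have S_col: "\<Phi> ` ?S \<subseteq> zsegment l h"
  proof
    fix x assume "x \<in> \<Phi> ` ?S"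
    then obtain s where s: "s \<in> ?S" "x = \<Phi> s"
      by blast
    then have "proj x = 0"
      using S s0 proj_0 by metis
    moreover have "x$3 \<in> Z"
      using s by (simp add: Z_def)
    then have "l \<le> x$3" "x$3 \<le> h"
      using Z by (simp_all add: l_def h_def)
    ultimately show "x \<in> zsegment l h"
      by (simp add: zsegment_def proj_eq_0)
  qed
  have ends: "pt 0 0 z \<in> \<Phi> ` X" if zZ: "z \<in> Z" for z
  proof -
    obtain s where s: "s \<in> ?S" "z = \<Phi> s $ 3"
      using zZ unfolding Z_def by blast
    then have "\<Phi> s = pt 0 0 z"
      using S_col by (auto simp: zsegment_def vec_eq_iff forall_3)
    then show ?thesis
      using s by (metis DiffD1 imageI)
  qed
  have lh: "pt 0 0 l \<in> \<Phi> ` X" "pt 0 0 h \<in> \<Phi> ` X"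
    using ends Z by (auto simp: l_def h_def)
  have "card (\<Phi> ` ?S) \<ge> 5"
    using card_Diff_ge(1)[of v1 v2 v3] umap_inj[OF um] by (metis card_image inj_on_subset subset_UNIV)
  then have "5 \<le> card (zsegment l h)"
    using card_mono[OF finite_zsegment S_col] by linarith
  then have long: "h - l \<ge> 4"
    by (simp add: card_zsegment)
  have col: "zsegment l h \<subseteq> \<Phi> ` X"
  proof
    fix x assume x: "x \<in> zsegment l h"
    have "(h - l) *s x = (h - x$3) *s pt 0 0 l + (x$3 - l) *s pt 0 0 h + 0 *s pt 0 0 l + 0 *s pt 0 0 l"
      using x by (simp add: zsegment_def vec_eq_iff forall_3 algebra_simps)
    then show "x \<in> \<Phi> ` X"
      by (rule X'.satD[of "pt 0 0 l" "pt 0 0 h" "pt 0 0 l" "pt 0 0 l" "h - x$3" "x$3 - l" 0 0 "h - l", rotated -1])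
        (use lh long x in \<open>simp_all add: zsegment_def\<close>)
  qed
  have "spiked_points (\<Phi> ` X) l h W"
  proof
    show "\<Phi> ` X = zsegment l h \<union> W"
      using S_col col vX by (auto simp: W_def)
    show "inj_on proj W"
      using dist by (auto simp: W_def inj_on_def proj_eq)
    have "?g s0 \<notin> {?g v1, ?g v2, ?g v3}"
      using S s0 by blast
    then have "proj (\<Phi> v1) \<noteq> 0" "proj (\<Phi> v2) \<noteq> 0" "proj (\<Phi> v3) \<noteq> 0"
      unfolding proj_0 by auto
    then show "0 \<notin> proj ` W"
      unfolding W_def by auto
    have "distinct [v1, v2, v3]"
      using dist by auto
    then have "card {v1, v2, v3} = 3"
      by simp
    then show "card W = 3"
      unfolding W_def using umap_inj[OF um] by (metis card_image inj_on_subset subset_UNIV)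
  qed (fact long)
  then show ?thesis
    using that um by blast
qed

context spiked_points
begin

lemma col_mem: "l \<le> z \<Longrightarrow> z \<le> h \<Longrightarrow> pt 0 0 z \<in> X"
  by (simp add: X_eq pt_zsegment)

lemma W_mem: "w \<in> W \<Longrightarrow> w \<in> X"
  by (simp add: X_eq)

lemma proj_mem: "x \<in> X \<Longrightarrow> proj x = 0 \<or> proj x \<in> proj ` W"
  by (auto simp: X_eq proj_zsegment)

text \<open>The weight \<open>c\<close> left at the origin can be split between the two ends of the
  segment, so that every height in the range given for \<open>k * z\<close> is reached. Scaling all
  weights by the segment length makes the split integral.\<close>

lemma lift:
  assumes uv: "u \<in> X" "v \<in> X" and nn: "0 \<le> a" "0 \<le> b" "0 \<le> c" "k = a + b + c" "k > 0"
    and w: "k *s w = a *s proj u + b *s proj v"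
    and z: "c * l \<le> k * z - a * u$3 - b * v$3" "k * z - a * u$3 - b * v$3 \<le> c * h"
  shows "pt (w$1) (w$2) z \<in> X"
proof -
  define m where "m = h - l"
  define d where "d = k * z - a * u$3 - b * v$3 - c * l"
  have d: "0 \<le> d" "d \<le> m * c"
    using z by (simp_all add: d_def m_def algebra_simps)
  have w12: "k * w$1 = a * u$1 + b * v$1" "k * w$2 = a * u$2 + b * v$2"
    using w by (simp_all add: proj_def vec_eq_iff forall_2)
  have "m * k * w$1 = m * a * u$1 + m * b * v$1" "m * k * w$2 = m * a * u$2 + m * b * v$2"
    using w12 by (metis distrib_left mult.assoc)+
  moreover have "m * k * z = (m * c - d) * l + d * h + m * a * u$3 + m * b * v$3"
    unfolding d_def m_def by (simp add: algebra_simps)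
  ultimately have "(m * k) *s pt (w$1) (w$2) z = (m * c - d) *s pt 0 0 l + d *s pt 0 0 h + (m * a) *s u + (m * b) *s v"
    by (simp add: vec_eq_iff forall_3 left_diff_distrib)
  moreover have "m > 0"
    using long by (simp add: m_def)
  moreover have "m * k = (m * c - d) + d + m * a + m * b"
    unfolding nn(4) by (simp add: algebra_simps)
  moreover have "pt 0 0 l \<in> X" "pt 0 0 h \<in> X"
    using col_mem long by auto
  ultimately show ?thesis
    using satD[of "pt 0 0 l" "pt 0 0 h" u v "m * c - d" d "m * a" "m * b" "m * k"] uv nn d
    by (metis diff_ge_0_iff_ge mult_nonneg_nonneg mult_pos_pos less_imp_le)
qed

text \<open>The fibre over \<open>w\<close> has length at least \<open>4 * (k - a - b) / k\<close>.
  Rounding its lower end up costs at most \<open>k - 1\<close> in units of \<open>1/k\<close> and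
  \<open>n\<close> further steps cost \<open>n * k\<close>, which explains the bound
  \<open>(n + 1) * k - 1\<close>. Later \<open>n = 0\<close> yields \<open>quarter\<close> and
  \<open>n = 1\<close> yields \<open>half\<close>.\<close>

lemma lift_consecutive:
  assumes uv: "u \<in> X" "v \<in> X" and nn: "0 \<le> a" "0 \<le> b" "k > 0"
    and w: "k *s w = a *s proj u + b *s proj v"
    and n: "n \<ge> 0" "(n + 1) * k - 1 \<le> 4 * (k - a - b)"
  shows "\<exists>z. \<forall>i. 0 \<le> i \<and> i \<le> n \<longrightarrow> pt (w$1) (w$2) (z + i) \<in> X"
proof -
  define c where "c = k - a - b"
  define K where "K = a * u$3 + b * v$3 + c * l"
  define z where "z = - ((- K) div k)"
  have "(- K) mod k = - K - k * ((- K) div k)"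
    by (simp add: minus_mult_div_eq_mod)
  then have kz0: "k * z - K = (- K) mod k"
    by (simp add: z_def)
  have kz: "0 \<le> k * z - K" "k * z - K \<le> k - 1"
    using nn(3) kz0 pos_mod_bound[OF nn(3), of "- K"] by auto
  define N where "N = (n + 1) * k"
  have "N \<ge> 1 * k"
    unfolding N_def using n nn(3) by (intro mult_right_mono) auto
  moreover have "N - 1 \<le> 4 * c"
    using n(2) by (simp add: N_def c_def)
  ultimately have c: "c \<ge> 0"
    using nn(3) by linarith
  then have "c * 4 \<le> c * (h - l)"
    using long by (intro mult_left_mono) auto
  then have top: "(n + 1) * k - 1 \<le> c * h - c * l"
    using n(2) by (simp add: c_def right_diff_distrib)
  have "pt (w$1) (w$2) (z + i) \<in> X" if i: "0 \<le> i" "i \<le> n" for i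
  proof (rule lift[OF uv nn(1,2) c _ nn(3) w])
    show "k = a + b + c"
      by (simp add: c_def)
    have "0 \<le> k * i" "k * i \<le> k * n"
      using i nn(3) by (auto intro: mult_left_mono)
    moreover have "k * (z + i) - a * u$3 - b * v$3 = (k * z - K) + k * i + c * l"
      by (simp add: K_def algebra_simps)
    moreover have "(n + 1) * k - 1 = k * n + k - 1"
      by (simp add: algebra_simps)
    ultimately show "c * l \<le> k * (z + i) - a * u$3 - b * v$3" "k * (z + i) - a * u$3 - b * v$3 \<le> c * h"
      using kz top by linarith+
  qed
  then show ?thesis
    by blast
qed

lemma proj_pt [simp]: "proj (pt (w$1) (w$2) z) = w"
  by (simp add: proj_def vec_eq_iff forall_2)

text \<open>Consecutive points of the segment turn planar determinants into spatial ones,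
  functionals without third component factor through \<open>proj\<close>, and two lattice points
  over the same \<open>w\<close> contradict the injectivity of \<open>proj\<close> on
  \<open>W\<close>.\<close>

lemma planar:
  assumes "W = {v1, v2, v3}"
  shows "planar_triple (proj v1) (proj v2) (proj v3) (proj ` W)"
proof
  show "proj ` W = {proj v1, proj v2, proj v3}"
    using assms by auto
  have "card (proj ` W) = 3"
    using inj card_W by (simp add: card_image)
  then show "distinct [proj v1, proj v2, proj v3]"
    using assms by (auto simp: card_insert_if split: if_splits)
  show "0 \<notin> proj ` W"
    by (fact off)
next
  fix u v w and a b k :: int
  assume *: "u \<in> proj ` W" "v \<in> proj ` W" "w \<noteq> 0" "0 \<le> a" "0 \<le> b" "k *s w = a *s u + b *s v" "k > 0"
  then obtain u' v' where uv: "u' \<in> X" "v' \<in> X" "u = proj u'" "v = proj v'"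
    using W_mem by blast
  show "w \<in> proj ` W" if "k \<le> 4 * (k - a - b)"
  proof -
    have "(0 + 1) * k - 1 \<le> 4 * (k - a - b)"
      using that by simp
    then obtain z where z: "\<forall>i. 0 \<le> i \<and> i \<le> 0 \<longrightarrow> pt (w$1) (w$2) (z + i) \<in> X"
      using lift_consecutive[OF uv(1,2) *(4,5,7) *(6)[unfolded uv] order_refl] by blast
    show ?thesis
      using proj_mem[of "pt (w$1) (w$2) z"] z[rule_format, of 0] *(3) by simp
  qed
  show False if "k \<le> 2 * (k - a - b)"
  proof -
    have "(1 + 1) * k - 1 \<le> 4 * (k - a - b)"
      using that by simp
    then obtain z where z: "\<forall>i. 0 \<le> i \<and> i \<le> 1 \<longrightarrow> pt (w$1) (w$2) (z + i) \<in> X"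
      using lift_consecutive[OF uv(1,2) *(4,5,7) *(6)[unfolded uv] zero_le_one] by blast
    have inW: "x \<in> W" if "x \<in> X" "proj x = w" for x
      using that *(3) proj_zsegment unfolding X_eq by blast
    have "pt (w$1) (w$2) (z + 0) \<in> W" "pt (w$1) (w$2) (z + 1) \<in> W"
      using z by (auto intro!: inW)
    then have "pt (w$1) (w$2) (z + 0) = pt (w$1) (w$2) (z + 1)"
      by (rule inj_onD[OF inj, rotated]) simp
    then show False
      by (simp add: vec_eq_iff forall_3)
  qed
next
  fix u v assume "u \<in> proj ` W" "v \<in> proj ` W"
  then obtain u' v' where uv: "u' \<in> X" "v' \<in> X" "u = proj u'" "v = proj v'"
    using W_mem by blast
  have "idet (pt 0 0 (l + 1) - pt 0 0 l) (u' - pt 0 0 l) (v' - pt 0 0 l) = det2 u v"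
    by (simp add: uv ivec_simps det2_def proj_def algebra_simps)
  then show "\<bar>det2 u v\<bar> \<noteq> 1"
    using no_unit_det[OF col_mem[of l] col_mem[of "l + 1"] uv(1,2)] long by simp
next
  fix f :: "int^2" assume "f \<noteq> 0"
  then have "pt (f$1) (f$2) 0 \<noteq> 0"
    by (simp add: vec_eq_iff forall_3 forall_2)
  then obtain p q where pq: "p \<in> X" "q \<in> X" "\<not> ip (pt (f$1) (f$2) 0) p - ip (pt (f$1) (f$2) 0) q \<le> 1"
    using wide unfolding wide_def spread1_def by blast
  have "proj p \<in> insert 0 (proj ` W)" "proj q \<in> insert 0 (proj ` W)"
    using pq proj_mem by auto
  moreover have "ip (pt (f$1) (f$2) 0) x = ip2 f (proj x)" for x
    by (simp add: ip_def ip2_def proj_def)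
  ultimately show "\<exists>p\<in>insert 0 (proj ` W). \<exists>q\<in>insert 0 (proj ` W). ip2 f p - ip2 f q \<ge> 2"
    using pq(3) by (intro bexI[of _ "proj p"] bexI[of _ "proj q"]) auto
qed

lemma preimages:
  assumes "proj ` W = {u, v, w}"
  obtains a b c where "W = {a, b, c}" "proj a = u" "proj b = v" "proj c = w"
proof -
  obtain a b c where abc: "a \<in> W" "b \<in> W" "c \<in> W" "proj a = u" "proj b = v" "proj c = w"
  proof -
    have "u \<in> proj ` W" "v \<in> proj ` W" "w \<in> proj ` W"
      using assms by simp_all
    then show ?thesis
      using that by blast
  qed
  have "x \<in> {a, b, c}" if "x \<in> W" for x
  proof -
    have "proj x \<in> {proj a, proj b, proj c}"
      using assms abc that by auto
    then show ?thesis
      using inj abc that by (auto dest: inj_onD)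
  qed
  then have "W = {a, b, c}"
    using abc by blast
  then show ?thesis
    using that abc by blast
qed

lemma combination_mem:
  assumes "p \<in> X" "q \<in> X" "0 \<le> a" "0 \<le> b" "a + b > 0" "(a + b) *s x = a *s p + b *s q"
  shows "x \<in> X"
  using satD[of p q p p a b 0 0 "a + b" x] assms by simp

text \<open>Congruent heights would make the midpoint, or a point dividing an edge in thirds,
  integral. Its projection would be 0 or one of the three vertices, which the values of
  \<open>det2\<close> collected in \<open>vals\<close> exclude.\<close>

lemma classification:
  "(\<exists>a b c t. W = {a, b, c} \<and> proj b = - proj a \<and> det2 (proj a) t = 1 \<and> proj c = proj a + 2 *s t \<and>
      even (a$3 + b$3) \<and> odd (a$3 + c$3)) \<or>
   (\<exists>a b c t. W = {a, b, c} \<and> proj c = - proj a - proj b \<and> det2 (proj a) t = 1 \<and> proj b = proj a + 3 *s t \<and>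
      3 dvd a$3 + b$3 + c$3 \<and> \<not> 3 dvd a$3 - c$3)"
proof -
  obtain v1 v2 v3 where "W = {v1, v2, v3}"
    using card_W by (auto simp: card_3_iff)
  then interpret planar_triple "proj v1" "proj v2" "proj v3" "proj ` W"
    by (rule planar)
  have half_mem: "proj p + t \<in> insert 0 (proj ` W)"
    if "p \<in> W" "q \<in> W" "proj q = proj p + 2 *s t" and ev: "even (p$3 + q$3)" for p q t
  proof -
    obtain z where z: "p$3 + q$3 = 2 * z"
      using ev by (elim evenE)
    define x where "x = pt ((proj p + t)$1) ((proj p + t)$2) z"
    have "proj q = proj p + 2 *s t"
      by fact
    then have "(1 + 1) *s x = 1 *s p + 1 *s q"
      using z by (simp add: x_def proj_def vec_eq_iff forall_3 forall_2 algebra_simps)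
    then have "x \<in> X"
      by (rule combination_mem[of p q 1 1, rotated -1]) (use that W_mem in auto)
    then show ?thesis
      using proj_mem[of x] by (simp add: x_def del: vector_add_component)
  qed
  have third_mem: "proj p + t \<in> insert 0 (proj ` W)"
    if "p \<in> W" "q \<in> W" "proj q = proj p + 3 *s t" and dv: "3 dvd q$3 - p$3" for p q t
  proof -
    obtain z where z: "q$3 - p$3 = 3 * z"
      using dv by (elim dvdE)
    define x where "x = pt ((proj p + t)$1) ((proj p + t)$2) (p$3 + z)"
    have "proj q = proj p + 3 *s t"
      by fact
    then have "(2 + 1) *s x = 2 *s p + 1 *s q"
      using z by (simp add: x_def proj_def vec_eq_iff forall_3 forall_2 algebra_simps)
    then have "x \<in> X"
      by (rule combination_mem[of p q 2 1, rotated -1]) (use that W_mem in auto)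
    then show ?thesis
      using proj_mem[of x] by (simp add: x_def del: vector_add_component)
  qed
  consider u v w t where "proj ` W = {u, v, w}" "v = - u" "det2 u w = 2" "w - u = 2 *s t"
    | u v w t where "proj ` W = {u, v, w}" "w = - u - v" "det2 u v = 3" "v - u = 3 *s t"
    | u v w t t' where "proj ` W = {u, v, w}" "w = - u - 2 *s v" "det2 u v = 2" "v - u = 2 *s t" "w - v = 2 *s t'"
    using planar_classification by blast
  then show ?thesis
  proof cases
    case (1 u v w t)
    obtain a b c where abc: "W = {a, b, c}" "proj a = u" "proj b = v" "proj c = w"
      using preimages[OF 1(1)] by metis
    have w: "w = u + 2 *s t"
      using 1(4) by (metis add.commute diff_add_cancel)
    have det: "det2 u t = 1"
      using 1(3) w by simp
    have vals: "det2 u x \<in> {0, 2}" if "x \<in> insert 0 (proj ` W)" for x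
      using that 1(1,2,3) by auto
    have ac: "odd (a$3 + c$3)"
    proof
      assume "even (a$3 + c$3)"
      then have "u + t \<in> insert 0 (proj ` W)"
        using half_mem[of a c t] abc w by simp
      then show False
        using vals[of "u + t"] det by simp
    qed
    have "odd (b$3 + c$3)"
    proof
      assume "even (b$3 + c$3)"
      moreover have "proj c = proj b + 2 *s (u + t)"
        using abc w 1(2) by (simp add: vec_eq_iff)
      ultimately have "proj b + (u + t) \<in> insert 0 (proj ` W)"
        using half_mem[of b c "u + t"] abc(1) by simp
      then have "t \<in> insert 0 (proj ` W)"
        using abc(3) 1(2) by simp
      then show False
        using vals[of t] det by simp
    qed
    then have "even (a$3 + b$3)"
      using ac by presburger
    moreover have "proj b = - proj a" "det2 (proj a) t = 1" "proj c = proj a + 2 *s t"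
      using abc det w 1(2) by simp_all
    ultimately show ?thesis
      using abc(1) ac by metis
  next
    case (2 u v w t)
    obtain a b c where abc: "W = {a, b, c}" "proj a = u" "proj b = v" "proj c = w"
      using preimages[OF 2(1)] by metis
    have v: "v = u + 3 *s t"
      using 2(4) by (metis add.commute diff_add_cancel)
    have det: "det2 u t = 1"
      using 2(3) v by simp
    have w: "w = - 2 *s u - 3 *s t"
      using 2(2) v by (simp add: vec_eq_iff)
    have vals: "det2 u x \<in> {0, 3, - 3}" if "x \<in> insert 0 (proj ` W)" for x
      using that 2(1) v w det by auto
    have ba: "\<not> 3 dvd b$3 - a$3"
    proof
      assume "3 dvd b$3 - a$3"
      then have "u + t \<in> insert 0 (proj ` W)"
        using third_mem[of a b t] abc v by simp
      then show False
        using vals[of "u + t"] det by simp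
    qed
    have ca: "\<not> 3 dvd c$3 - a$3"
    proof
      assume "3 dvd c$3 - a$3"
      moreover have "proj c = proj a + 3 *s (- u - t)"
        using abc w by (simp add: vec_eq_iff)
      ultimately have "proj a + (- u - t) \<in> insert 0 (proj ` W)"
        using third_mem[of a c "- u - t"] abc(1) by simp
      then show False
        using vals[of "proj a + (- u - t)"] det abc(2) by simp
    qed
    have cb: "\<not> 3 dvd c$3 - b$3"
    proof
      assume "3 dvd c$3 - b$3"
      moreover have "proj c = proj b + 3 *s (- u - 2 *s t)"
        using abc w v by (simp add: vec_eq_iff)
      ultimately have "proj b + (- u - 2 *s t) \<in> insert 0 (proj ` W)"
        using third_mem[of b c "- u - 2 *s t"] abc(1) by simp
      then show False
        using vals[of "proj b + (- u - 2 *s t)"] det abc(3) v by simp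
    qed
    \<comment> \<open>Heights in pairwise different classes modulo 3 represent all three classes, so
      their sum is divisible by 3.\<close>
    have "3 dvd a$3 + b$3 + c$3" "\<not> 3 dvd a$3 - c$3"
      using ba ca cb by presburger+
    moreover have "proj c = - proj a - proj b" "det2 (proj a) t = 1" "proj b = proj a + 3 *s t"
      using abc det v 2(2) by simp_all
    ultimately show ?thesis
      using abc(1) by metis
  next
    case (3 u v w t t')
    obtain a b c where abc: "W = {a, b, c}" "proj a = u" "proj b = v" "proj c = w"
      using preimages[OF 3(1)] by metis
    have v: "v = u + 2 *s t" and w: "w = v + 2 *s t'"
      using 3(4,5) by (metis add.commute diff_add_cancel)+
    have det: "det2 u t = 1"
      using 3(3) v by simp
    have vals: "det2 u x \<in> {0, 2, - 4}" "det2 v x \<in> {0, 2, - 2}" if "x \<in> insert 0 (proj ` W)" for x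
      using that 3(1,2,3) det2_skew[of v u] by auto
    have "odd (a$3 + b$3)"
    proof
      assume "even (a$3 + b$3)"
      then have "u + t \<in> insert 0 (proj ` W)"
        using half_mem[of a b t] abc v by simp
      then show False
        using vals(1)[of "u + t"] det by simp
    qed
    moreover have "odd (b$3 + c$3)"
    proof
      assume "even (b$3 + c$3)"
      then have "v + t' \<in> insert 0 (proj ` W)"
        using half_mem[of b c t'] abc w by simp
      moreover have "2 * det2 v t' = det2 v (w - v)"
        using 3(5) by simp
      then have "det2 v t' = 1"
        using 3(2,3) det2_skew[of v u] by simp
      ultimately show False
        using vals(2)[of "v + t'"] by simp
    qed
    \<comment> \<open>Two odd sums force an even one, so the midpoint of \<open>a\<close> and
      \<open>c\<close> is a lattice point. It projects to \<open>- v\<close>, whose determinant -2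
      with \<open>u\<close> occurs neither at a vertex nor at 0.\<close>
    ultimately have "even (a$3 + c$3)"
      by presburger
    moreover have "proj c = proj a + 2 *s (- u - v)"
      using abc 3(2) by (simp add: vec_eq_iff)
    ultimately have "proj a + (- u - v) \<in> insert 0 (proj ` W)"
      using half_mem[of a c "- u - v"] abc(1) by simp
    then have False
      using vals(1)[of "proj a + (- u - v)"] 3(3) abc(2) by simp
    then show ?thesis ..
  qed
qed

end

section \<open>Normalization by maps that keep the vertical axis\<close>

definition emap :: "int \<Rightarrow> int \<Rightarrow> int \<Rightarrow> int \<Rightarrow> int \<Rightarrow> int \<Rightarrow> int \<Rightarrow> int \<Rightarrow> int^3 \<Rightarrow> int^3"
  where "emap g11 g12 g21 g22 \<alpha> \<beta> \<epsilon> \<gamma> p =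
    pt (g11 * p$1 + g12 * p$2) (g21 * p$1 + g22 * p$2) (\<alpha> * p$1 + \<beta> * p$2 + \<epsilon> * p$3 + \<gamma>)"

lemma umap_emap:
  assumes "\<bar>g11 * g22 - g12 * g21\<bar> = 1" "\<bar>\<epsilon>\<bar> = 1"
  shows "umap (emap g11 g12 g21 g22 \<alpha> \<beta> \<epsilon> \<gamma>)"
proof -
  define A :: "int^3^3" where "A = vector [pt g11 g12 0, pt g21 g22 0, pt \<alpha> \<beta> \<epsilon>]"
  have "det A = (g11 * g22 - g12 * g21) * \<epsilon>"
    by (simp add: A_def det_3 algebra_simps)
  then have "\<bar>det A\<bar> = 1"
    using assms by (simp add: abs_mult)
  moreover have "emap g11 g12 g21 g22 \<alpha> \<beta> \<epsilon> \<gamma> = (\<lambda>p. A *v p + pt 0 0 \<gamma>)"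
    by (simp add: fun_eq_iff emap_def A_def vec_eq_iff forall_3 matrix_vector_mult_def sum_3)
  ultimately show ?thesis
    using umapI by metis
qed

lemma emap_zsegment: "emap g11 g12 g21 g22 \<alpha> \<beta> 1 \<gamma> ` zsegment l h = zsegment (l + \<gamma>) (h + \<gamma>)"
proof -
  have "emap g11 g12 g21 g22 \<alpha> \<beta> 1 \<gamma> ` zsegment l h = pt 0 0 ` (\<lambda>z. z + \<gamma>) ` {l..h}"
    by (simp add: zsegment_eq_image image_image emap_def del: image_add_atLeastAtMost')
  then show ?thesis
    by (simp only: zsegment_eq_image image_add_atLeastAtMost')
qed

lemma emap_zsegment_reflect: "emap g11 g12 g21 g22 \<alpha> \<beta> (- 1) 0 ` zsegment l h = zsegment (- h) (- l)"
proof -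
  have "emap g11 g12 g21 g22 \<alpha> \<beta> (- 1) 0 ` zsegment l h = pt 0 0 ` uminus ` {l..h}"
    by (simp add: zsegment_eq_image image_image emap_def del: image_uminus_atLeastAtMost)
  then show ?thesis
    by (simp only: zsegment_eq_image image_uminus_atLeastAtMost)
qed

text \<open>The vertices of the exceptional tetrahedra off the vertical axis. Here and in
  \<open>base3\<close> their plane contains the origin, so the members of a family differ only in
  the height of the apex.\<close>

definition base2 :: "(int^3) set"
  where "base2 = {pt 1 (- 1) 0, pt (- 1) 1 0, pt (- 1) (- 1) 1}"

definition base3 :: "(int^3) set"
  where "base3 = {pt 2 (- 1) 1, pt (- 1) 2 (- 1), pt (- 1) (- 1) 0}"

context spiked_points
begin

text \<open>
  The map \<open>\<Phi>1\<close> moves the projections of \<open>a\<close> and \<open>c\<close> to \<open>(1, -1)\<close> and \<open>(-1, -1)\<close>. Its matrix is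
  integral because the projections of \<open>a\<close> and \<open>c\<close> differ by \<open>2t\<close>.
\<close>

lemma normalize2:
  assumes W: "W = {a, b, c}" and ab: "proj b = - proj a" and det: "det2 (proj a) t = 1"
    and ac: "proj c = proj a + 2 *s t" and par: "even (a$3 + b$3)" "odd (a$3 + c$3)"
  obtains \<Phi> l' h' where "umap \<Phi>" "\<Phi> ` X = zsegment l' h' \<union> base2" "h' - l' = h - l" "l' \<le> 0" "0 \<le> h'"
proof -
  define p q where "p = a$1" and "q = a$2"
  have a: "a$1 = p" "a$2 = q"
    by (simp_all add: p_def q_def)
  have b: "b$1 = - p" "b$2 = - q" and c: "c$1 = p + 2 * t$1" "c$2 = q + 2 * t$2"
    using ab ac by (simp_all add: proj_def vec_eq_iff forall_2 p_def q_def)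
  have det: "p * t$2 - q * t$1 = 1"
    using det by (simp add: det2_def proj_def p_def q_def)
  \<comment> \<open>The midpoint of \<open>a\<close> and \<open>b\<close> lies on the axis and hence
    in the segment; shifting by its height puts 0 between the new ends.\<close>
  obtain c0 where c0: "a$3 + b$3 = 2 * c0"
    using par(1) by (elim evenE)
  have "(1 + 1) *s pt 0 0 c0 = 1 *s a + 1 *s b"
    using c0 a b by (simp add: vec_eq_iff forall_3)
  then have "pt 0 0 c0 \<in> X"
    by (rule combination_mem[of a b 1 1, rotated -1]) (use W W_mem in auto)
  moreover have "pt 0 0 c0 \<notin> W"
    using off by (metis (no_types, lifting) imageI proj_eq_0 vector_3(1,2))
  ultimately have c0lh: "l \<le> c0" "c0 \<le> h"
    by (auto simp: X_eq pt_zsegment)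
  define \<Phi>1 where "\<Phi>1 = emap (q + t$2) (- (p + t$1)) (- t$2) (t$1) 0 0 1 0"
  have "(q + t$2) * t$1 - (- (p + t$1)) * (- t$2) = - (p * t$2 - q * t$1)"
    by (simp add: algebra_simps)
  then have um1: "umap \<Phi>1"
    unfolding \<Phi>1_def using det by (intro umap_emap) simp_all
  have "\<Phi>1 a = pt (p * t$2 - q * t$1) (- (p * t$2 - q * t$1)) (a$3)"
    "\<Phi>1 b = pt (- (p * t$2 - q * t$1)) (p * t$2 - q * t$1) (b$3)"
    "\<Phi>1 c = pt (- (p * t$2 - q * t$1)) (- (p * t$2 - q * t$1)) (c$3)"
    by (simp_all add: \<Phi>1_def emap_def vec_eq_iff forall_3 a b c algebra_simps)
  then have im1: "\<Phi>1 a = pt 1 (- 1) (a$3)" "\<Phi>1 b = pt (- 1) 1 (b$3)" "\<Phi>1 c = pt (- 1) (- 1) (c$3)"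
    using det by simp_all
  have "even (c$3 - a$3 - 1)"
    using par(2) by presburger
  \<comment> \<open>The shear is solved for height 0 at \<open>a\<close> and height 1 at
    \<open>c\<close>; the odd height sum makes it integral, and \<open>b\<close> follows from the
    midpoint.\<close>
  then obtain \<alpha> where \<alpha>: "c$3 - a$3 - 1 = 2 * \<alpha>"
    by (elim evenE)
  define \<beta> where "\<beta> = \<alpha> - c0 + a$3"
  define \<Phi>2 where "\<Phi>2 = emap 1 0 0 1 \<alpha> \<beta> 1 (- c0)"
  have um2: "umap \<Phi>2"
    unfolding \<Phi>2_def by (intro umap_emap) simp_all
  have im2: "\<Phi>2 (pt 1 (- 1) (a$3)) = pt 1 (- 1) 0" "\<Phi>2 (pt (- 1) 1 (b$3)) = pt (- 1) 1 0"
    "\<Phi>2 (pt (- 1) (- 1) (c$3)) = pt (- 1) (- 1) 1"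
    using c0 \<alpha> by (simp_all add: \<Phi>2_def emap_def \<beta>_def vec_eq_iff forall_3)
  have col: "\<Phi>1 ` zsegment l h = zsegment l h" "\<Phi>2 ` zsegment l h = zsegment (l - c0) (h - c0)"
    by (simp_all add: \<Phi>1_def \<Phi>2_def emap_zsegment)
  define \<Phi> where "\<Phi> = (\<lambda>p. \<Phi>2 (\<Phi>1 p))"
  have "\<Phi> ` X = \<Phi>2 ` \<Phi>1 ` X"
    by (simp add: \<Phi>_def image_image)
  also have "\<dots> = zsegment (l - c0) (h - c0) \<union> base2"
    by (simp add: X_eq image_Un W col im1 im2 base2_def)
  finally show ?thesis
    using that[of \<Phi> "l - c0" "h - c0"] umap_comp[OF um2 um1] c0lh by (simp add: \<Phi>_def)
qed

text \<open>The planar part of \<open>\<Phi>1\<close> sends \<open>t\<close> to (-1, 1) and the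
  projection of \<open>a\<close> to (2, -1); both pairs have determinant 1. The centroid of the
  three points lies on the axis and provides the shift. The residue of \<open>a$3 - c$3\<close>
  modulo 3 leaves a sign \<eta>, and the wrong sign is undone by exchanging the first two
  coordinates.\<close>

lemma normalize3:
  assumes W: "W = {a, b, c}" and abc: "proj c = - proj a - proj b" and det: "det2 (proj a) t = 1"
    and ab: "proj b = proj a + 3 *s t" and dv: "3 dvd a$3 + b$3 + c$3" "\<not> 3 dvd a$3 - c$3"
  obtains \<Phi> l' h' where "umap \<Phi>" "\<Phi> ` X = zsegment l' h' \<union> base3" "h' - l' = h - l" "l' \<le> 0" "0 \<le> h'"
proof -
  define p q where "p = a$1" and "q = a$2"
  have a: "a$1 = p" "a$2 = q"
    by (simp_all add: p_def q_def)
  have b: "b$1 = p + 3 * t$1" "b$2 = q + 3 * t$2"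
    using ab by (simp_all add: proj_def vec_eq_iff forall_2 p_def q_def)
  have c: "c$1 = - 2 * p - 3 * t$1" "c$2 = - 2 * q - 3 * t$2"
    using abc a b by (simp_all add: proj_def vec_eq_iff forall_2)
  have det: "p * t$2 - q * t$1 = 1"
    using det by (simp add: det2_def proj_def p_def q_def)
  obtain c0 where c0: "a$3 + b$3 + c$3 = 3 * c0"
    using dv(1) by (elim dvdE)
  have inX: "a \<in> X" "b \<in> X" "c \<in> X"
    using W W_mem by auto
  have "3 *s pt 0 0 c0 = 1 *s a + 1 *s b + 1 *s c + 0 *s a"
    using c0 a b c by (simp add: vec_eq_iff forall_3)
  then have "pt 0 0 c0 \<in> X"
    by (rule satD[of a b c a 1 1 1 0 3, rotated -1]) (use inX in auto)
  moreover have "pt 0 0 c0 \<notin> W"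
    using off by (metis (no_types, lifting) imageI proj_eq_0 vector_3(1,2))
  ultimately have c0lh: "l \<le> c0" "c0 \<le> h"
    by (auto simp: X_eq pt_zsegment)
  define \<Phi>1 where "\<Phi>1 = emap (q + 2 * t$2) (- (p + 2 * t$1)) (- (q + t$2)) (p + t$1) 0 0 1 0"
  have "(q + 2 * t$2) * (p + t$1) - (- (p + 2 * t$1)) * (- (q + t$2)) = p * t$2 - q * t$1"
    by (simp add: algebra_simps)
  then have um1: "umap \<Phi>1"
    unfolding \<Phi>1_def using det by (intro umap_emap) simp_all
  have "\<Phi>1 a = pt (2 * (p * t$2 - q * t$1)) (- (p * t$2 - q * t$1)) (a$3)"
    "\<Phi>1 b = pt (- (p * t$2 - q * t$1)) (2 * (p * t$2 - q * t$1)) (b$3)"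
    "\<Phi>1 c = pt (- (p * t$2 - q * t$1)) (- (p * t$2 - q * t$1)) (c$3)"
    by (simp_all add: \<Phi>1_def emap_def vec_eq_iff forall_3 a b c algebra_simps)
  then have im1: "\<Phi>1 a = pt 2 (- 1) (a$3)" "\<Phi>1 b = pt (- 1) 2 (b$3)" "\<Phi>1 c = pt (- 1) (- 1) (c$3)"
    using det by simp_all
  have "\<exists>\<eta> \<alpha>. (\<eta> = 1 \<or> \<eta> = - 1) \<and> a$3 - c$3 + 3 * \<alpha> = \<eta>"
    using dv(2) by presburger
  then obtain \<eta> \<alpha> where \<eta>: "\<eta> = 1 \<or> \<eta> = - 1" and \<alpha>: "a$3 - c$3 + 3 * \<alpha> = \<eta>"
    by blast
  define \<beta> where "\<beta> = c$3 - c0 - \<alpha>"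
  define \<Phi>2 where "\<Phi>2 = emap 1 0 0 1 \<alpha> \<beta> 1 (- c0)"
  have um2: "umap \<Phi>2"
    unfolding \<Phi>2_def by (intro umap_emap) simp_all
  have im2: "\<Phi>2 (pt 2 (- 1) (a$3)) = pt 2 (- 1) \<eta>" "\<Phi>2 (pt (- 1) 2 (b$3)) = pt (- 1) 2 (- \<eta>)"
    "\<Phi>2 (pt (- 1) (- 1) (c$3)) = pt (- 1) (- 1) 0"
    using c0 \<alpha> by (simp_all add: \<Phi>2_def emap_def \<beta>_def vec_eq_iff forall_3)
  have col: "\<Phi>1 ` zsegment l h = zsegment l h" "\<Phi>2 ` zsegment l h = zsegment (l - c0) (h - c0)"
    by (simp_all add: \<Phi>1_def \<Phi>2_def emap_zsegment)
  define \<Phi> where "\<Phi> = (\<lambda>p. \<Phi>2 (\<Phi>1 p))"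
  have um: "umap \<Phi>"
    unfolding \<Phi>_def using umap_comp[OF um2 um1] .
  have "\<Phi> ` X = \<Phi>2 ` \<Phi>1 ` X"
    by (simp add: \<Phi>_def image_image)
  also have "\<dots> = zsegment (l - c0) (h - c0) \<union> {pt 2 (- 1) \<eta>, pt (- 1) 2 (- \<eta>), pt (- 1) (- 1) 0}"
    by (simp add: X_eq image_Un W col im1 im2)
  finally have im: "\<Phi> ` X = zsegment (l - c0) (h - c0) \<union> {pt 2 (- 1) \<eta>, pt (- 1) 2 (- \<eta>), pt (- 1) (- 1) 0}" .
  show ?thesis
  proof (cases "\<eta> = 1")
    case True
    then show ?thesis
      using that[of \<Phi> "l - c0" "h - c0"] um im c0lh by (simp add: base3_def)
  next
    case False
    define \<Sigma> where "\<Sigma> = emap 0 1 1 0 0 0 1 0"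
    have "umap \<Sigma>"
      unfolding \<Sigma>_def by (intro umap_emap) simp_all
    then have "umap (\<lambda>p. \<Sigma> (\<Phi> p))"
      using um by (rule umap_comp)
    moreover have "(\<lambda>p. \<Sigma> (\<Phi> p)) ` X = \<Sigma> ` \<Phi> ` X"
      by (simp add: image_image)
    moreover have "\<Sigma> ` \<Phi> ` X = zsegment (l - c0) (h - c0) \<union> base3"
      using False \<eta> unfolding im \<Sigma>_def image_Un emap_zsegment
      by (auto simp: emap_def base3_def)
    ultimately show ?thesis
      using that[of "\<lambda>p. \<Sigma> (\<Phi> p)" "l - c0" "h - c0"] c0lh by simp
  qed
qed

end

text \<open>If the base plane, given by \<open>F\<close>, met the segment in an inner point, both
  ends would be exposed, by \<open>F\<close> and by \<open>- F\<close>. After removing one end, the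
  rest of the segment forces \<open>f$3 = 0\<close> and the base then forces \<open>f = 0\<close>,
  so the set stays wide. After removing both, two axis points with \<open>a\<close> and
  \<open>c\<close> are still not coplanar, against \<open>exposed_non_merged\<close>.\<close>

lemma (in exposed_points) zsegment_endpoint:
  assumes X: "X = zsegment l h \<union> W" and lh: "h - l \<ge> 4" "l \<le> 0" "0 \<le> h"
    and F: "F$3 > 0" "\<And>w. w \<in> W \<Longrightarrow> ip F w = 0"
    and W: "\<And>f. f$3 = 0 \<Longrightarrow> spread1 f (insert 0 W) \<Longrightarrow> f = 0"
    and ac: "a \<in> W" "c \<in> W" "det2 (proj a) (proj c) \<noteq> 0"
  shows "l = 0 \<or> h = 0"
proof (rule ccontr)
  assume "\<not> ?thesis"
  then have lh': "l < 0" "0 < h"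
    using lh by auto
  have mem: "pt 0 0 z \<in> X" if "l \<le> z" "z \<le> h" for z
    using that by (simp add: X pt_zsegment)
  have ipz: "ip f (pt 0 0 z) = f$3 * z" for f z
    by (simp add: ip_def)
  have notW: "pt 0 0 z \<notin> W" if "z \<noteq> 0" for z
    using F(1) F(2)[of "pt 0 0 z"] that ipz[of F z] by auto
  have val: "ip F p = F$3 * p$3 \<and> l \<le> p$3 \<and> p$3 \<le> h \<or> ip F p = 0" if "p \<in> X" for p
    using that F(2) by (auto simp: X zsegment_def ip_def)
  have eq: "p = pt 0 0 (p$3)" if "p \<in> X" "ip F p \<noteq> 0" for p
    using that F(2) by (auto simp: X zsegment_def vec_eq_iff forall_3)
  have "ip F p < ip F (pt 0 0 h)" if "p \<in> X - {pt 0 0 h}" for p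
  proof (cases "ip F p = 0")
    case True
    then show ?thesis
      using lh' F(1) by (simp add: ipz)
  next
    case False
    then have "p$3 \<noteq> h" "p$3 \<le> h" "ip F p = F$3 * p$3"
      using that eq[of p] val[of p] by auto
    then show ?thesis
      using F(1) by (simp add: ipz)
  qed
  then have top: "exposed X (pt 0 0 h)"
    using mem[of h] lh unfolding exposed_def by auto
  have "ip (- F) p < ip (- F) (pt 0 0 l)" if "p \<in> X - {pt 0 0 l}" for p
  proof -
    have neg: "ip (- F) x = - ip F x" for x
      by (simp add: ip_def)
    show ?thesis
    proof (cases "ip F p = 0")
      case True
      then show ?thesis
        using lh' F(1) by (simp add: neg ipz mult_pos_neg)
    next
      case False
      then have "p$3 \<noteq> l" "l \<le> p$3" "ip F p = F$3 * p$3"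
        using that eq[of p] val[of p] by auto
      then show ?thesis
        using F(1) by (simp add: neg ipz)
    qed
  qed
  moreover have "pt 0 0 l \<in> X"
    using mem lh by simp
  ultimately have bot: "exposed X (pt 0 0 l)"
    unfolding exposed_def by blast
  have wide: "wide (X - {pt 0 0 e})" if e: "e = l \<or> e = h" for e
    unfolding wide_def
  proof (intro allI impI notI)
    fix f assume f: "f \<noteq> 0" "spread1 f (X - {pt 0 0 e})"
    \<comment> \<open>Both \<open>z\<close> and \<open>z + 3\<close> survive the removal of the end
      \<open>e\<close> because the length is at least 4.\<close>
    define z where "z = (if e = l then l + 1 else l)"
    have "pt 0 0 z \<in> X - {pt 0 0 e}" "pt 0 0 (z + 3) \<in> X - {pt 0 0 e}"
      using e lh mem[of z] mem[of "z + 3"] by (auto simp: z_def vec_eq_iff forall_3)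
    then have "ip f (pt 0 0 (z + 3)) - ip f (pt 0 0 z) \<le> 1" "ip f (pt 0 0 z) - ip f (pt 0 0 (z + 3)) \<le> 1"
      using f(2) unfolding spread1_def by blast+
    then have "f$3 = 0"
      by (simp add: ipz algebra_simps)
    moreover have "insert 0 W \<subseteq> X - {pt 0 0 e}"
    proof -
      have "pt 0 0 0 = 0"
        by (simp add: vec_eq_iff forall_3)
      then have "0 \<in> X"
        using mem[of 0] lh by simp
      moreover have "e \<noteq> 0"
        using e lh' by auto
      ultimately show ?thesis
        using notW[of e] by (auto simp: X vec_eq_iff forall_3)
    qed
    then have "spread1 f (insert 0 W)"
      using f(2) spread1_subset by blast
    ultimately show False
      using W f(1) by blast
  qed
  have "pt 0 0 h \<noteq> pt 0 0 l"
    using lh' by (simp add: vec_eq_iff forall_3)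
  then have fl: "flat (X - {pt 0 0 h, pt 0 0 l})"
    using exposed_non_merged[OF top bot] wide by blast
  \<comment> \<open>A neighbour of 0 that is not an end: as the length is at least 4,
    \<open>h \<ge> 2\<close> or \<open>l \<le> - 2\<close>.\<close>
  define z where "z = (if h \<ge> 2 then 1 else - 1 :: int)"
  have z: "pt 0 0 z \<in> X - {pt 0 0 h, pt 0 0 l}" "pt 0 0 0 \<in> X - {pt 0 0 h, pt 0 0 l}"
    using lh lh' mem[of z] mem[of 0] by (auto simp: z_def vec_eq_iff forall_3)
  have "a \<in> X - {pt 0 0 h, pt 0 0 l}" "c \<in> X - {pt 0 0 h, pt 0 0 l}"
    using ac notW lh' by (auto simp: X)
  then have "idet (pt 0 0 z - pt 0 0 0) (a - pt 0 0 0) (c - pt 0 0 0) = 0"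
    using fl z unfolding flat_def by blast
  moreover have "idet (pt 0 0 z - pt 0 0 0) (a - pt 0 0 0) (c - pt 0 0 0) = z * det2 (proj a) (proj c)"
    by (simp add: ivec_simps det2_def proj_def algebra_simps)
  ultimately show False
    using ac(3) by (auto simp: z_def split: if_splits)
qed

text \<open>Two base points differ by (2, -2, 0), which forces \<open>f$1 = f$2\<close>; the value
  at the third is then even and bounded by 1. For \<open>base3\<close> the first difference is a
  multiple of 3 instead.\<close>

lemma base2_spread:
  assumes "f$3 = 0" "spread1 f (insert 0 base2)"
  shows "f = 0"
proof -
  have "ip f (pt 1 (- 1) 0) - ip f (pt (- 1) 1 0) \<le> 1" "ip f (pt (- 1) 1 0) - ip f (pt 1 (- 1) 0) \<le> 1"
    "ip f (pt (- 1) (- 1) 1) - ip f 0 \<le> 1" "ip f 0 - ip f (pt (- 1) (- 1) 1) \<le> 1"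
    using assms(2) unfolding spread1_def base2_def by blast+
  then have "f$1 = f$2" "f$1 + f$2 \<le> 1" "- (f$1 + f$2) \<le> 1"
    using assms(1) by (auto simp: ip_def)
  then have "f$1 = 0" "f$2 = 0"
    by auto
  then show ?thesis
    using assms(1) by (simp add: vec_eq_iff forall_3)
qed

lemma base3_spread:
  assumes "f$3 = 0" "spread1 f (insert 0 base3)"
  shows "f = 0"
proof -
  have "ip f (pt 2 (- 1) 1) - ip f (pt (- 1) 2 (- 1)) \<le> 1" "ip f (pt (- 1) 2 (- 1)) - ip f (pt 2 (- 1) 1) \<le> 1"
    "ip f (pt (- 1) (- 1) 0) - ip f 0 \<le> 1" "ip f 0 - ip f (pt (- 1) (- 1) 0) \<le> 1"
    using assms(2) unfolding spread1_def base3_def by blast+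
  then have "f$1 = f$2" "f$1 + f$2 \<le> 1" "- (f$1 + f$2) \<le> 1"
    using assms(1) by (auto simp: ip_def)
  then have "f$1 = 0" "f$2 = 0"
    by auto
  then show ?thesis
    using assms(1) by (simp add: vec_eq_iff forall_3)
qed

lemma base_off_zsegment: "zsegment l h \<inter> base2 = {}" "zsegment l h \<inter> base3 = {}"
  by (auto simp: zsegment_def base2_def base3_def)

lemma card_base: "card base2 = 3" "card base3 = 3"
  by (simp_all add: base2_def base3_def vec_eq_iff forall_3)

lemma card_zsegment_base:
  assumes "m \<ge> 0" "B = base2 \<or> B = base3"
  shows "int (card (zsegment 0 m \<union> B)) = m + 4"
proof -
  have B: "card B = 3" "zsegment 0 m \<inter> B = {}"
    using assms(2) card_base base_off_zsegment by metis+
  then have "finite B"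
    by (intro card_ge_0_finite) simp
  then have "card (zsegment 0 m \<union> B) = card (zsegment 0 m) + card B"
    using B(2) by (intro card_Un_disjoint finite_zsegment)
  then show ?thesis
    using assms(1) B(1) by (simp add: card_zsegment)
qed

theorem exposed_spike_normal_form:
  assumes "exposed_points X" "spike X f1 f2 v1 v2 v3"
  obtains \<Phi> m B where "umap \<Phi>" "B = base2 \<or> B = base3" "\<Phi> ` X = zsegment 0 m \<union> B" "int (card X) = m + 4"
proof -
  obtain \<Phi>0 l h W where um0: "umap \<Phi>0" and sp: "spiked_points (\<Phi>0 ` X) l h W"
    using spike_zsegment[OF assms] by metis
  interpret spiked_points "\<Phi>0 ` X" l h W
    by (rule sp)
  obtain \<Phi>1 l' h' B where um1: "umap \<Phi>1" and B: "B = base2 \<or> B = base3"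
    and im: "\<Phi>1 ` \<Phi>0 ` X = zsegment l' h' \<union> B" and lh: "h' - l' = h - l" "l' \<le> 0" "0 \<le> h'"
  proof -
    from classification show ?thesis
    proof (elim disjE exE conjE)
      fix a b c t
      assume "W = {a, b, c}" "proj b = - proj a" "det2 (proj a) t = 1" "proj c = proj a + 2 *s t"
        "even (a$3 + b$3)" "odd (a$3 + c$3)"
      then show ?thesis
        by (rule normalize2) (rule that[of _ base2], auto)
    next
      fix a b c t
      assume "W = {a, b, c}" "proj c = - proj a - proj b" "det2 (proj a) t = 1" "proj b = proj a + 3 *s t"
        "3 dvd a$3 + b$3 + c$3" "\<not> 3 dvd a$3 - c$3"
      then show ?thesis
        by (rule normalize3) (rule that[of _ base3], auto)
    qed
  qed
  have "umap (\<lambda>p. \<Phi>1 (\<Phi>0 p))"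
    using um1 um0 by (rule umap_comp)
  then interpret Y: exposed_points "zsegment l' h' \<union> B"
    using umap_exposed_points[OF um1 exposed_points_axioms] im by simp
  have lh4: "h' - l' \<ge> 4"
    using lh(1) long by simp
  have end0: "l' = 0 \<or> h' = 0"
  proof (cases "B = base2")
    case True
    show ?thesis
    \<comment> \<open>\<open>pt 1 1 2\<close> is normal to the plane through the base and the
      origin, as is \<open>pt (- 1) 1 3\<close> in the case of \<open>base3\<close>.\<close>
    proof (rule Y.zsegment_endpoint[OF refl lh4 lh(2,3), of "pt 1 1 2"])
      show "ip (pt 1 1 2) w = 0" if "w \<in> B" for w
        using that True by (auto simp: base2_def ip_def)
      show "pt 1 (- 1) 0 \<in> B" "pt (- 1) (- 1) 1 \<in> B"
        "det2 (proj (pt 1 (- 1) 0)) (proj (pt (- 1) (- 1) 1)) \<noteq> 0"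
        using True by (simp_all add: base2_def det2_def proj_def)
    qed (use True base2_spread in auto)
  next
    case False
    then have B3: "B = base3"
      using B by simp
    show ?thesis
    proof (rule Y.zsegment_endpoint[OF refl lh4 lh(2,3), of "pt (- 1) 1 3"])
      show "ip (pt (- 1) 1 3) w = 0" if "w \<in> B" for w
        using that B3 by (auto simp: base3_def ip_def)
      show "pt 2 (- 1) 1 \<in> B" "pt (- 1) 2 (- 1) \<in> B"
        "det2 (proj (pt 2 (- 1) 1)) (proj (pt (- 1) 2 (- 1))) \<noteq> 0"
        using B3 by (simp_all add: base3_def det2_def proj_def)
    qed (use B3 base3_spread in auto)
  qed
  \<comment> \<open>Such a map exchanges the sides of the base plane and preserves the base as a
    set, so a segment hanging below can be turned upwards. For \<open>base2\<close> the height
    \<open>z\<close> becomes \<open>- x - y - z\<close>; for \<open>base3\<close> it changes sign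
    while the other coordinates are swapped.\<close>
  have reflect: "\<exists>\<Sigma>. umap \<Sigma> \<and> \<Sigma> ` (zsegment l' h' \<union> B) = zsegment (- h') (- l') \<union> B"
  proof (cases "B = base2")
    case True
    have "umap (emap 1 0 0 1 (- 1) (- 1) (- 1) 0)"
      by (intro umap_emap) simp_all
    moreover have "emap 1 0 0 1 (- 1) (- 1) (- 1) 0 ` base2 = base2"
      by (simp add: base2_def emap_def)
    ultimately show ?thesis
      using True by (metis emap_zsegment_reflect image_Un)
  next
    case False
    have "umap (emap 0 1 1 0 0 0 (- 1) 0)"
      by (intro umap_emap) simp_all
    moreover have "emap 0 1 1 0 0 0 (- 1) 0 ` base3 = base3"
      by (auto simp: base3_def emap_def)
    ultimately show ?thesis
      using False B by (metis emap_zsegment_reflect image_Un)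
  qed
  obtain \<Phi> m where um: "umap \<Phi>" and imm: "\<Phi> ` X = zsegment 0 m \<union> B" and m: "m \<ge> 0"
  proof (cases "l' = 0")
    case True
    then show ?thesis
      using that[of "\<lambda>p. \<Phi>1 (\<Phi>0 p)" h'] \<open>umap (\<lambda>p. \<Phi>1 (\<Phi>0 p))\<close> im lh by (simp add: image_image)
  next
    case False
    then have "h' = 0"
      using end0 by simp
    obtain \<Sigma> where \<Sigma>: "umap \<Sigma>" "\<Sigma> ` (zsegment l' h' \<union> B) = zsegment (- h') (- l') \<union> B"
      using reflect by blast
    have "umap (\<lambda>p. \<Sigma> (\<Phi>1 (\<Phi>0 p)))"
      using \<Sigma>(1) \<open>umap (\<lambda>p. \<Phi>1 (\<Phi>0 p))\<close> by (rule umap_comp)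
    moreover have "(\<lambda>p. \<Sigma> (\<Phi>1 (\<Phi>0 p))) ` X = zsegment 0 (- l') \<union> B"
      using \<Sigma>(2) im \<open>h' = 0\<close> by (metis image_image minus_zero)
    ultimately show ?thesis
      using that[of "\<lambda>p. \<Sigma> (\<Phi>1 (\<Phi>0 p))" "- l'"] lh by simp
  qed
  have "card (\<Phi> ` X) = card X"
    using umap_inj[OF um] by (metis card_image inj_on_subset subset_UNIV)
  then have "int (card X) = m + 4"
    using card_zsegment_base[OF m B] imm by simp
  then show ?thesis
    using that um B imm by blast
qed

section \<open>Lattice polytopes and their integer points\<close>

definition rvec :: "int^3 \<Rightarrow> real^3"
  where "rvec p = (\<chi> i. of_int (p$i))"

lemma rvec_nth [simp]: "rvec p $ i = of_int (p$i)"
  by (simp add: rvec_def)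

lemma rvec_linear:
  "rvec (a + b) = rvec a + rvec b" "rvec (a - b) = rvec a - rvec b" "rvec (k *s a) = of_int k *\<^sub>R rvec a" "rvec 0 = 0"
  by (simp_all add: vec_eq_iff)

lemma inj_rvec: "inj rvec"
  by (auto simp: inj_def vec_eq_iff)

lemma rvec_eq_iff [simp]: "rvec p = rvec q \<longleftrightarrow> p = q"
  using inj_rvec by (simp add: inj_eq)

lemma int_lattice_eq: "int_lattice = range rvec"
proof
  show "int_lattice \<subseteq> range rvec"
  proof
    fix x assume "x \<in> int_lattice"
    then have "x = rvec (\<chi> i. \<lfloor>x$i\<rfloor>)"
      by (auto simp: int_lattice_def vec_eq_iff)
    then show "x \<in> range rvec"
      by blast
  qed
qed (auto simp: int_lattice_def)

lemma inner_rvec: "rvec f \<bullet> rvec p = of_int (ip f p)"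
  by (simp add: inner_vec_def sum_3 ip_def)

text \<open>The values at 0 and at the unit vectors recover integral coefficients, so the width only
  involves integer vectors.\<close>

lemma integer_affine_functional_rvec:
  "integer_affine_functional f \<and> \<not> f constant_on UNIV \<longleftrightarrow> (\<exists>g c. g \<noteq> 0 \<and> f = (\<lambda>x. rvec g \<bullet> x + of_int c))"
proof
  assume f: "integer_affine_functional f \<and> \<not> f constant_on UNIV"
  then obtain a b where ab: "f = (\<lambda>x. a \<bullet> x + b)" "f ` int_lattice \<subseteq> \<int>"
    by (auto simp: integer_affine_functional_def)
  have "f 0 \<in> \<int>"
    using ab(2) by (auto simp: int_lattice_def)
  then obtain c where c: "b = of_int c"
    using ab(1) by (auto simp: Ints_def)
  have "f (axis i 1) \<in> \<int>" for i
    using ab(2) by (auto simp: int_lattice_def axis_def)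
  then have "a$i \<in> \<int>" for i
    using ab(1) \<open>f 0 \<in> \<int>\<close> by (metis Ints_diff add_diff_cancel_right' inner_axis inner_zero_right add_0 inner_real_def mult.right_neutral)
  then have "a \<in> int_lattice"
    by (simp add: int_lattice_def)
  then obtain g where g: "a = rvec g"
    by (auto simp: int_lattice_eq)
  have "g \<noteq> 0"
    using f ab(1) g by (auto simp: constant_on_def rvec_linear)
  then show "\<exists>g c. g \<noteq> 0 \<and> f = (\<lambda>x. rvec g \<bullet> x + of_int c)"
    using ab(1) g c by blast
next
  assume "\<exists>g c. g \<noteq> 0 \<and> f = (\<lambda>x. rvec g \<bullet> x + of_int c)"
  then obtain g c where g: "g \<noteq> 0" and f: "f = (\<lambda>x. rvec g \<bullet> x + of_int c)"
    by blast
  have "integer_affine_functional f"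
    unfolding integer_affine_functional_def f int_lattice_eq
    by (auto simp: inner_rvec)
  moreover have "\<not> f constant_on UNIV"
  proof
    assume "f constant_on UNIV"
    then have "f (rvec g) = f 0"
      by (metis UNIV_I constant_on_def)
    then have "rvec g = 0"
      by (simp add: f)
    then show False
      using g by (metis rvec_eq_iff rvec_linear(4))
  qed
  ultimately show "integer_affine_functional f \<and> \<not> f constant_on UNIV"
    by blast
qed

text \<open>On integer points the spread of an integer functional is an integer, so exceeding 1
  means reaching 2. This gap passes to the infimum, whether or not it is attained.\<close>

lemma lattice_width_gt_1:
  assumes Y: "finite Y" "Y \<noteq> {}"
  shows "lattice_width (convex hull (rvec ` Y)) > 1 \<longleftrightarrow> wide Y"
proof -
  let ?Q = "convex hull (rvec ` Y)"
  define w where "w = (\<lambda>f. (SUP x\<in>?Q. f x) - (INF x\<in>?Q. f x) :: real)"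
  define E where "E = {w f | f. integer_affine_functional f \<and> \<not> f constant_on UNIV}"
  have E: "E = {w (\<lambda>x. rvec g \<bullet> x + of_int c) | g c. g \<noteq> 0}"
    unfolding E_def integer_affine_functional_rvec by blast
  have lw: "lattice_width ?Q = Inf E"
    by (simp add: lattice_width_def E_def w_def)
  have comp: "compact ?Q"
    using Y(1) by (intro finite_imp_compact_convex_hull) simp
  have sub: "rvec p \<in> ?Q" if "p \<in> Y" for p
    using that by (simp add: hull_inc)
  have bdd: "bdd_above ((\<lambda>x. rvec g \<bullet> x + of_int c) ` ?Q)" "bdd_below ((\<lambda>x. rvec g \<bullet> x + of_int c) ` ?Q)" for g c
  proof -
    have "compact ((\<lambda>x. rvec g \<bullet> x + of_int c) ` ?Q)"
      by (intro compact_continuous_image comp continuous_intros)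
    then have "bounded ((\<lambda>x. rvec g \<bullet> x + of_int c) ` ?Q)"
      by (rule compact_imp_bounded)
    then show "bdd_above ((\<lambda>x. rvec g \<bullet> x + of_int c) ` ?Q)" "bdd_below ((\<lambda>x. rvec g \<bullet> x + of_int c) ` ?Q)"
      by (auto intro: bounded_imp_bdd_above bounded_imp_bdd_below)
  qed
  have w_ge: "w (\<lambda>x. rvec g \<bullet> x + of_int c) \<ge> of_int (ip g p - ip g q)" if "p \<in> Y" "q \<in> Y" for g c p q
  proof -
    have "rvec g \<bullet> rvec p + of_int c \<le> (SUP x\<in>?Q. rvec g \<bullet> x + of_int c)"
      using sub[OF that(1)] bdd(1) by (intro cSUP_upper)
    moreover have "(INF x\<in>?Q. rvec g \<bullet> x + of_int c) \<le> rvec g \<bullet> rvec q + of_int c"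
      using sub[OF that(2)] bdd(2) by (intro cINF_lower)
    ultimately show ?thesis
      by (simp add: w_def inner_rvec)
  qed
  obtain p0 where p0: "p0 \<in> Y"
    using Y(2) by blast
  show ?thesis
  proof
    assume gt: "lattice_width ?Q > 1"
    show "wide Y"
      unfolding wide_def
    proof (intro allI impI notI)
      fix g assume g: "g \<noteq> 0" "spread1 g Y"
      obtain c where c: "\<And>p. p \<in> Y \<Longrightarrow> ip g p = c \<or> ip g p = c + 1"
        using spread1_values[OF g(2)] by blast
      have "rvec ` Y \<subseteq> {x. rvec g \<bullet> x \<ge> of_int c} \<inter> {x. rvec g \<bullet> x \<le> of_int (c + 1)}"
        using c by (fastforce simp: inner_rvec)
      then have "?Q \<subseteq> {x. rvec g \<bullet> x \<ge> of_int c} \<inter> {x. rvec g \<bullet> x \<le> of_int (c + 1)}"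
        by (intro hull_minimal convex_Int convex_halfspace_ge convex_halfspace_le)
      then have "(SUP x\<in>?Q. rvec g \<bullet> x + of_int 0) \<le> of_int (c + 1)" "(INF x\<in>?Q. rvec g \<bullet> x + of_int 0) \<ge> of_int c"
        using sub[OF p0] by (auto intro!: cSUP_least cINF_greatest)
      then have "w (\<lambda>x. rvec g \<bullet> x + of_int 0) \<le> 1"
        by (simp add: w_def)
      moreover have "w (\<lambda>x. rvec g \<bullet> x + of_int 0) \<in> E"
        using g(1) unfolding E by blast
      moreover have "bdd_below E"
        unfolding E using w_ge[OF p0 p0] by (intro bdd_belowI[of _ 0]) auto
      ultimately have "Inf E \<le> 1"
        by (meson cInf_lower order_trans)
      then show False
        using gt lw by simp
    qed
  next
    assume wide: "wide Y"
    have "e \<ge> 2" if eE: "e \<in> E" for e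
    proof -
      obtain g c where g: "g \<noteq> 0" "e = w (\<lambda>x. rvec g \<bullet> x + of_int c)"
        using eE unfolding E by blast
      obtain p q where pq: "p \<in> Y" "q \<in> Y" "\<not> ip g p - ip g q \<le> 1"
        using wide g(1) by (auto simp: wide_def spread1_def)
      have "(2 :: real) \<le> of_int (ip g p - ip g q)"
        using pq(3) by linarith
      also have "\<dots> \<le> e"
        unfolding g(2) by (rule w_ge[OF pq(1,2)])
      finally show ?thesis .
    qed
    moreover have "E \<noteq> {}"
    proof -
      have "(axis 1 1 :: int^3) \<noteq> 0"
        by simp
      then show ?thesis
        unfolding E by blast
    qed
    ultimately have "2 \<le> Inf E"
      by (intro cInf_greatest)
    then show "lattice_width ?Q > 1"
      using lw by simp
  qed
qed

section \<open>Determinants, dimension and volume\<close>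

lemma idet_real:
  "det (vector [rvec a, rvec b, rvec c] :: real^3^3) = of_int (idet a b c)"
  by (simp add: det_3 ivec_simps algebra_simps)

lemma idet_affine_independent:
  assumes "idet (q - p) (r - p) (s - p) \<noteq> 0"
  shows "\<not> affine_dependent (rvec ` {p, q, r, s})" "card (rvec ` {p, q, r, s}) = 4" "distinct [p, q, r, s]"
proof -
  let ?M = "vector [rvec (q - p), rvec (r - p), rvec (s - p)] :: real^3^3"
  show dist: "distinct [p, q, r, s]"
    using assms by (auto simp: ivec_simps algebra_simps)
  then have "card {p, q, r, s} = 4"
    by simp
  then show "card (rvec ` {p, q, r, s}) = 4"
    using inj_rvec by (metis card_image inj_on_subset subset_UNIV)
  have "rows ?M = {rvec (q - p), rvec (r - p), rvec (s - p)}"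
  proof -
    have "rows ?M = (\<lambda>i. row i ?M) ` {1, 2, 3}"
      using exhaust_3 unfolding rows_def by blast
    then show ?thesis
      by (simp add: row_def)
  qed
  moreover have "\<not> dependent (rows ?M)"
    using det_dependent_rows[of ?M] assms by (auto simp: dependent_vec_eq idet_real)
  ultimately have "\<not> dependent ((\<lambda>x. - rvec p + x) ` {rvec q, rvec r, rvec s})"
    by (simp add: rvec_linear)
  moreover have "rvec p \<notin> {rvec q, rvec r, rvec s}"
    using dist by auto
  ultimately have "\<not> affine_dependent (insert (rvec p) {rvec q, rvec r, rvec s})"
    by (metis affine_dependent_iff_dependent)
  then show "\<not> affine_dependent (rvec ` {p, q, r, s})"
    by simp
qed

lemma not_flat_aff_dim:
  assumes "\<not> flat Y"
  shows "aff_dim (convex hull (rvec ` Y)) = 3"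
proof -
  obtain p q r s where pqrs: "p \<in> Y" "q \<in> Y" "r \<in> Y" "s \<in> Y" "idet (q - p) (r - p) (s - p) \<noteq> 0"
    using assms by (auto simp: flat_def)
  have "int (card (rvec ` {p, q, r, s})) = aff_dim (rvec ` {p, q, r, s}) + 1"
    using aff_dim_affine_independent idet_affine_independent(1)[OF pqrs(5)] by simp
  then have "aff_dim (rvec ` {p, q, r, s}) = 3"
    using idet_affine_independent(2)[OF pqrs(5)] by simp
  moreover have "aff_dim (rvec ` {p, q, r, s}) \<le> aff_dim (rvec ` Y)"
    using pqrs by (intro aff_dim_subset) auto
  moreover have "aff_dim (rvec ` Y) \<le> 3"
    using aff_dim_le_DIM[of "rvec ` Y"] by simp
  ultimately show ?thesis
    by (simp add: aff_dim_convex_hull)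
qed

lemma unimodular_tetrahedron_convex_hull:
  assumes "\<bar>idet (q - p) (r - p) (s - p)\<bar> = 1"
  shows "unimodular_tetrahedron (convex hull (rvec ` {p, q, r, s}))"
proof -
  let ?C = "rvec ` {p, q, r, s}"
  let ?T = "convex hull ?C"
  have nz: "idet (q - p) (r - p) (s - p) \<noteq> 0"
    using assms by auto
  note ind = idet_affine_independent[OF nz]
  have "3 simplex ?T"
    unfolding simplex_def using ind(1,2) by (intro exI[of _ ?C]) simp
  moreover have "lattice_polytope ?T"
    unfolding lattice_polytope_def
  proof
    show "polytope ?T"
      by (intro polytope_convex_hull) simp
    show "{v. v extreme_point_of ?T} \<subseteq> int_lattice"
      using extreme_point_of_convex_hull[of _ ?C] by (auto simp: int_lattice_eq)
  qed
  moreover have "normalized_volume ?T = 1"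
  proof -
    \<comment> \<open>The vertices other than \<open>p\<close>, enumerated by the type
      \<open>3\<close> as the volume formula \<open>content_simplex\<close> expects.\<close>
    define f :: "3 \<Rightarrow> real^3" where "f = (\<lambda>i. if i = 1 then rvec q else if i = 2 then rvec r else rvec s)"
    have f: "f 1 = rvec q" "f 2 = rvec r" "f 3 = rvec s"
      by (simp_all add: f_def)
    have U: "(UNIV :: 3 set) = {1, 2, 3}"
      using exhaust_3 by auto
    have "inj_on f UNIV"
      unfolding U using ind(3) by (auto simp: inj_on_def f)
    moreover have "f ` UNIV = ?C - {rvec p}"
      unfolding U using ind(3) by (auto simp: f)
    ultimately have bij: "bij_betw f UNIV (?C - {rvec p})"
      by (simp add: bij_betw_def)
    have "measure lborel ?T = \<bar>det (\<chi> i j. f j $ i - rvec p $ i)\<bar> / fact (CARD(3))"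
      by (rule content_simplex[OF _ _ _ bij]) (use ind(2) in simp_all)
    also have "det (\<chi> i j. f j $ i - rvec p $ i) = of_int (idet (q - p) (r - p) (s - p))"
      by (simp add: det_3 f ivec_simps algebra_simps)
    also have "\<bar>of_int (idet (q - p) (r - p) (s - p)) :: real\<bar> = 1"
      using assms by (metis of_int_1 of_int_abs)
    finally have "measure lborel ?T = 1 / fact 3"
      by simp
    moreover have "compact ?T"
      by (intro finite_imp_compact_convex_hull) simp
    then have "measure lebesgue ?T = measure lborel ?T"
      by (intro measure_completion) (auto dest: compact_imp_closed)
    ultimately show ?thesis
      by (simp add: normalized_volume_def)
  qed
  ultimately show ?thesis
    by (simp add: unimodular_tetrahedron_def)
qed

lemma finite_bounded_int_vectors:
  assumes "bounded (rvec ` X)"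
  shows "finite X"
proof -
  obtain N where N: "\<And>x. x \<in> rvec ` X \<Longrightarrow> norm x \<le> N"
    using assms by (auto simp: bounded_iff)
  define M where "M = \<lceil>N\<rceil>"
  have "X \<subseteq> (\<lambda>(x, y, z). pt x y z) ` ({-M..M} \<times> {-M..M} \<times> {-M..M})"
  proof
    fix p assume p: "p \<in> X"
    have "p$i \<in> {-M..M}" for i
    proof -
      have "\<bar>real_of_int (p$i)\<bar> \<le> N"
        using component_le_norm_cart[of "rvec p" i] N[of "rvec p"] p by force
      then show ?thesis
        unfolding M_def by simp linarith
    qed
    moreover have "p = pt (p$1) (p$2) (p$3)"
      by (simp add: vec_eq_iff forall_3)
    ultimately show "p \<in> (\<lambda>(x, y, z). pt x y z) ` ({-M..M} \<times> {-M..M} \<times> {-M..M})"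
      by (intro image_eqI[of _ _ "(p$1, p$2, p$3)"]) auto
  qed
  then show ?thesis
    by (rule finite_subset) simp
qed

lemma convex_saturated:
  assumes "convex P"
  shows "saturated {p. rvec p \<in> P}"
  unfolding saturated_def
proof (intro ballI allI impI)
  fix p q r s a b c d x
  assume mem: "p \<in> {p. rvec p \<in> P}" "q \<in> {p. rvec p \<in> P}" "r \<in> {p. rvec p \<in> P}" "s \<in> {p. rvec p \<in> P}"
    and nn: "0 \<le> a" "0 \<le> b" "0 \<le> c" "0 \<le> d" "0 < a + b + c + d"
    and eq: "(a + b + c + d) *s x = a *s p + b *s q + c *s r + d *s s"
  define k where "k = real_of_int (a + b + c + d)"
  have k: "k > 0"
    using nn(5) unfolding k_def by (simp only: of_int_0_less_iff)
  \<comment> \<open>The points are indexed instead of collected in a set because \<open>p\<close>,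
    \<open>q\<close>, \<open>r\<close>, \<open>s\<close> may coincide.\<close>
  define y where "y = (\<lambda>i::nat. [rvec p, rvec q, rvec r, rvec s] ! i)"
  define u where "u = (\<lambda>i::nat. [a / k, b / k, c / k, d / k] ! i)"
  have "(\<Sum>i\<in>{0,1,2,3}. u i *\<^sub>R y i) \<in> P"
  proof (rule convex_sum[OF _ assms])
    have "sum u {0, 1, 2, 3} = (a + b + c + d) / k"
      by (simp add: u_def add_divide_distrib numeral_3_eq_3 numeral_2_eq_2)
    then show "sum u {0, 1, 2, 3} = 1"
      using k by (simp add: k_def)
  qed (use mem nn k in \<open>auto simp: u_def y_def numeral_3_eq_3 numeral_2_eq_2\<close>)
  moreover have "(\<Sum>i\<in>{0,1,2,3}. u i *\<^sub>R y i) = rvec x"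
  proof -
    have "k *\<^sub>R rvec x = of_int a *\<^sub>R rvec p + of_int b *\<^sub>R rvec q + of_int c *\<^sub>R rvec r + of_int d *\<^sub>R rvec s"
      using arg_cong[OF eq, of rvec] unfolding rvec_linear k_def .
    also have "\<dots> = k *\<^sub>R (\<Sum>i\<in>{0,1,2,3}. u i *\<^sub>R y i)"
      using k by (simp add: u_def y_def numeral_3_eq_3 numeral_2_eq_2 scaleR_add_right add.assoc)
    finally show ?thesis
      using k by simp
  qed
  ultimately show "x \<in> {p. rvec p \<in> P}"
    by simp
qed

section \<open>The sublattice generated by the lattice points\<close>

lemma affine_lattice_combination:
  assumes "w0 \<in> S" "w1 \<in> S" "w2 \<in> S" "w3 \<in> S"
  shows "rvec (w0 + a *s (w1 - w0) + b *s (w2 - w0) + c *s (w3 - w0)) \<in> affine_lattice (rvec ` S)"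
proof -
  define T where "T = rvec ` {w0, w1, w2, w3}"
  \<comment> \<open>Adding indicator terms lets coefficients accumulate when some of the four points
    coincide.\<close>
  define k where "k = (\<lambda>x. (if x = rvec w0 then 1 - a - b - c else 0) + (if x = rvec w1 then a else 0) +
    (if x = rvec w2 then b else 0) + (if x = rvec w3 then c else 0))"
  have fin: "finite T"
    by (simp add: T_def)
  have in_T: "rvec w0 \<in> T" "rvec w1 \<in> T" "rvec w2 \<in> T" "rvec w3 \<in> T"
    by (simp_all add: T_def)
  have "(\<Sum>x\<in>T. k x) = (1 - a - b - c) + a + b + c"
    unfolding k_def sum.distrib using fin in_T by (simp add: sum.delta)
  then have "(\<Sum>x\<in>T. k x) = 1"
    by simp
  moreover have "(\<Sum>x\<in>T. of_int (k x) *\<^sub>R x) =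
      of_int (1 - a - b - c) *\<^sub>R rvec w0 + of_int a *\<^sub>R rvec w1 + of_int b *\<^sub>R rvec w2 + of_int c *\<^sub>R rvec w3"
  proof -
    have "of_int (k x) *\<^sub>R x = (if x = rvec w0 then of_int (1 - a - b - c) *\<^sub>R x else 0) +
        (if x = rvec w1 then of_int a *\<^sub>R x else 0) + (if x = rvec w2 then of_int b *\<^sub>R x else 0) +
        (if x = rvec w3 then of_int c *\<^sub>R x else 0)" for x
      unfolding k_def of_int_add scaleR_add_left by (intro arg_cong2[of _ _ _ _ "(+)"]) auto
    then have "(\<Sum>x\<in>T. of_int (k x) *\<^sub>R x) = (\<Sum>x\<in>T. (if x = rvec w0 then of_int (1 - a - b - c) *\<^sub>R x else 0) +
        (if x = rvec w1 then of_int a *\<^sub>R x else 0) + (if x = rvec w2 then of_int b *\<^sub>R x else 0) +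
        (if x = rvec w3 then of_int c *\<^sub>R x else 0))"
      by (intro sum.cong refl)
    then show ?thesis
      unfolding sum.distrib using fin in_T by (simp only: sum.delta if_True)
  qed
  moreover have "\<dots> = rvec (w0 + a *s (w1 - w0) + b *s (w2 - w0) + c *s (w3 - w0))"
    by (simp add: vec_eq_iff algebra_simps)
  moreover have "T \<subseteq> rvec ` S"
    using assms by (auto simp: T_def)
  ultimately show ?thesis
    unfolding affine_lattice_def using fin by (intro CollectI exI[of _ T] exI[of _ k]) simp
qed

text \<open>The coefficients sum to 1, so the constant \<open>c\<close> is reproduced exactly once
  and the congruence passes to affine combinations.\<close>

lemma affine_lattice_congruence:
  assumes "x \<in> affine_lattice (rvec ` S)" "\<And>s. s \<in> S \<Longrightarrow> d dvd ip f s + c"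
  obtains p where "x = rvec p" "d dvd ip f p + c"
proof -
  obtain T k where T: "finite T" "T \<subseteq> rvec ` S" "(\<Sum>x\<in>T. k x) = (1 :: int)" "x = (\<Sum>x\<in>T. of_int (k x) *\<^sub>R x)"
    using assms(1) by (auto simp: affine_lattice_def)
  obtain U where U: "U \<subseteq> S" "T = rvec ` U"
    using T(2) by (meson subset_imageE)
  have inj: "inj_on rvec U"
    using inj_rvec inj_on_subset by blast
  have finU: "finite U"
    using T(1) U(2) inj by (simp add: finite_image_iff)
  define l where "l = (\<lambda>u. k (rvec u))"
  define p where "p = (\<Sum>u\<in>U. l u *s u)"
  have rsum: "rvec (\<Sum>u\<in>U. g u) = (\<Sum>u\<in>U. rvec (g u))" for g
    using finU by (induction U rule: finite_induct) (auto simp: rvec_linear)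
  have isum: "ip f (\<Sum>u\<in>U. g u) = (\<Sum>u\<in>U. ip f (g u))" for g
    using finU by (induction U rule: finite_induct) auto
  have "x = rvec p"
    unfolding T(4) U(2) p_def rsum sum.reindex[OF inj] by (simp add: l_def rvec_linear)
  moreover have "(\<Sum>u\<in>U. l u) = 1"
    using T(3) unfolding U(2) sum.reindex[OF inj] by (simp add: l_def)
  then have "ip f p + c = (\<Sum>u\<in>U. l u * ip f u) + (\<Sum>u\<in>U. l u) * c"
    by (simp add: p_def isum)
  then have "ip f p + c = (\<Sum>u\<in>U. l u * (ip f u + c))"
    by (simp add: sum_distrib_right sum.distrib distrib_left)
  then have "d dvd ip f p + c"
    using U(1) assms(2) by (auto intro!: dvd_sum)
  ultimately show ?thesis
    using that by blast
qed

text \<open>The translate by \<open>t\<close> depends only on \<open>ip f t\<close> modulo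
  \<open>d\<close>, and multiples of \<open>b\<close> realize every residue, so cosets correspond to
  residues.\<close>

lemma sublattice_index_congruence:
  assumes lat: "affine_lattice (P \<inter> int_lattice) = rvec ` {p. int d dvd ip f p + c}"
    and b: "ip f b = 1" and d: "d > 0"
  shows "sublattice_index P = d"
proof -
  define G where "G = (\<lambda>k. rvec ` {p. int d dvd ip f p - k + c})"
  have tr: "(+) (rvec t) ` rvec ` {p. int d dvd ip f p + c} = G (ip f t)" for t
  proof
    show "(+) (rvec t) ` rvec ` {p. int d dvd ip f p + c} \<subseteq> G (ip f t)"
      unfolding G_def by (auto simp flip: rvec_linear)
    show "G (ip f t) \<subseteq> (+) (rvec t) ` rvec ` {p. int d dvd ip f p + c}"
    proof
      fix x assume "x \<in> G (ip f t)"
      then obtain p where p: "x = rvec p" "int d dvd ip f p - ip f t + c"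
        by (auto simp: G_def)
      then have "x = rvec t + rvec (p - t)" "int d dvd ip f (p - t) + c"
        by (simp_all add: rvec_linear)
      then show "x \<in> (+) (rvec t) ` rvec ` {p. int d dvd ip f p + c}"
        by blast
    qed
  qed
  have "(\<lambda>t. (+) t ` affine_lattice (P \<inter> int_lattice)) ` int_lattice =
      range (\<lambda>t. (+) (rvec t) ` rvec ` {p. int d dvd ip f p + c})"
    unfolding lat unfolding int_lattice_eq by (simp only: image_image)
  also have "\<dots> = range (\<lambda>t. G (ip f t))"
    by (simp only: tr)
  also have "\<dots> = range G"
  proof
    show "range G \<subseteq> range (\<lambda>t. G (ip f t))"
    proof
      fix x assume "x \<in> range G"
      then obtain k where "x = G k"
        by blast
      then have "x = G (ip f (k *s b))"
        using b by simp
      then show "x \<in> range (\<lambda>t. G (ip f t))"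
        by blast
    qed
  qed auto
  also have "\<dots> = G ` {0..<int d}"
  proof
    show "range G \<subseteq> G ` {0..<int d}"
    proof
      fix x assume "x \<in> range G"
      then obtain k where k: "x = G k"
        by blast
      have "int d dvd m - k + c \<longleftrightarrow> int d dvd m - k mod int d + c" for m
      proof -
        have "m - k mod int d + c = (m - k + c) + int d * (k div int d)"
          by (simp add: minus_mult_div_eq_mod[symmetric])
        then show ?thesis
          by (metis dvd_add_left_iff dvd_triv_left)
      qed
      then have "G k = G (k mod int d)"
        by (simp add: G_def)
      then show "x \<in> G ` {0..<int d}"
        using k d by (intro image_eqI[of _ _ "k mod int d"]) auto
    qed
  qed auto
  finally have "sublattice_index P = card (G ` {0..<int d})"
    by (simp add: sublattice_index_def)
  moreover have "inj_on G {0..<int d}"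
  proof (rule inj_onI)
    fix k k' assume k: "k \<in> {0..<int d}" "k' \<in> {0..<int d}" "G k = G k'"
    have "rvec ((k - c) *s b) \<in> G k"
      using b by (simp add: G_def image_iff)
    then have "rvec ((k - c) *s b) \<in> G k'"
      using k(3) by simp
    then have "int d dvd (k - c) - k' + c"
      using b by (auto simp: G_def)
    then have "int d dvd k - k'"
      by simp
    then show "k = k'"
      using k(1,2) by (metis atLeastLessThan_iff mod_eq_dvd_iff mod_pos_pos_trivial)
  qed
  ultimately show ?thesis
    by (simp add: card_image)
qed

text \<open>Cramer's rule with a determinant of square 1 gives every lattice point integer
  coordinates in the frame. The index is then read off from the trivial congruence modulo 1.\<close>

lemma unimodular_frame_index:
  assumes X: "P \<inter> int_lattice = rvec ` X"
    and pqrs: "p \<in> X" "q \<in> X" "r \<in> X" "s \<in> X" "\<bar>idet (q - p) (r - p) (s - p)\<bar> = 1"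
  shows "sublattice_index P = 1"
proof (rule sublattice_index_congruence[of _ _ "axis 1 1" 0])
  define \<delta> where "\<delta> = idet (q - p) (r - p) (s - p)"
  have \<delta>: "\<delta> * \<delta> = 1"
    using pqrs(5) unfolding \<delta>_def by (metis abs_mult_self_eq mult_1)
  have "rvec x \<in> affine_lattice (rvec ` X)" for x
  proof -
    define a b c where "a = \<delta> * idet (x - p) (r - p) (s - p)"
      and "b = \<delta> * idet (q - p) (x - p) (s - p)" and "c = \<delta> * idet (q - p) (r - p) (x - p)"
    have cramer: "idet u v w *s y = idet y v w *s u + idet u y w *s v + idet u v y *s w" for u v w y
      by (simp add: ivec_simps algebra_simps)
    have "x - p = (\<delta> * \<delta>) *s (x - p)"
      using \<delta> by simp
    also have "\<dots> = \<delta> *s (idet (q - p) (r - p) (s - p) *s (x - p))"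
      unfolding \<delta>_def by (rule vector_smult_assoc[symmetric])
    also have "\<dots> = a *s (q - p) + b *s (r - p) + c *s (s - p)"
      unfolding cramer[of "q - p" "r - p" "s - p" "x - p"] a_def b_def c_def
      by (simp only: vector_add_ldistrib vector_smult_assoc)
    finally have "x - p = a *s (q - p) + b *s (r - p) + c *s (s - p)" .
    then have "x = p + a *s (q - p) + b *s (r - p) + c *s (s - p)"
      by (simp add: algebra_simps)
    then show ?thesis
      using affine_lattice_combination[OF pqrs(1-4), of a b c] by simp
  qed
  moreover have "affine_lattice (rvec ` X) \<subseteq> range rvec"
  proof
    fix x assume "x \<in> affine_lattice (rvec ` X)"
    then show "x \<in> range rvec"
      by (rule affine_lattice_congruence[of x X 1 0 0]) auto
  qed
  ultimately show "affine_lattice (P \<inter> int_lattice) = rvec ` {p. int 1 dvd ip (axis 1 1) p + 0}"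
    unfolding X by auto
  show "ip (axis 1 1) (axis 1 1) = 1"
    by (simp add: ip_def axis_def)
qed simp

text \<open>Congruence and generators are checked in normal form. Pulling back along
  \<open>\<Phi>\<close> replaces \<open>g\<close> by its image under the transpose and adds a
  constant for the translation; the preimage of 0 is the origin of the frame.\<close>

lemma umap_index:
  assumes X: "P \<inter> int_lattice = rvec ` X" and um: "umap \<Phi>"
    and d: "d > 0" and cong: "\<And>x. x \<in> \<Phi> ` X \<Longrightarrow> int d dvd ip g x"
    and frame: "\<And>x. int d dvd ip g x \<Longrightarrow> \<exists>a b c. x = a *s v1 + b *s v2 + c *s v3"
    and v: "0 \<in> \<Phi> ` X" "v1 \<in> \<Phi> ` X" "v2 \<in> \<Phi> ` X" "v3 \<in> \<Phi> ` X" and e: "ip g e = 1"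
  shows "sublattice_index P = d"
proof -
  obtain A t where A: "\<bar>det A\<bar> = 1" "\<Phi> = (\<lambda>p. A *v p + t)"
    using um unfolding umap_def by blast
  obtain \<Psi> where \<Psi>: "umap \<Psi>" "\<And>p. \<Psi> (\<Phi> p) = p" "\<And>p. \<Phi> (\<Psi> p) = p"
    using umap_inverse[OF um] by metis
  define f where "f = transpose A *v g"
  define c0 where "c0 = ip g t"
  have f: "ip g (\<Phi> p) = ip f p + c0" for p
    by (simp add: A(2) f_def c0_def ip_matrix)
  have "\<Psi> v \<in> X" if "v \<in> \<Phi> ` X" for v
    using that \<Psi>(2) by auto
  then obtain w0 w1 w2 w3 where w: "w0 \<in> X" "w1 \<in> X" "w2 \<in> X" "w3 \<in> X" "\<Phi> w0 = 0" "\<Phi> w1 = v1" "\<Phi> w2 = v2" "\<Phi> w3 = v3"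
    using that[of "\<Psi> 0" "\<Psi> v1" "\<Psi> v2" "\<Psi> v3"] v \<Psi>(3) by simp
  show ?thesis
  proof (rule sublattice_index_congruence[OF _ _ d, of P f c0 "\<Psi> e - w0"])
    show "affine_lattice (P \<inter> int_lattice) = rvec ` {p. int d dvd ip f p + c0}"
    proof
      show "affine_lattice (P \<inter> int_lattice) \<subseteq> rvec ` {p. int d dvd ip f p + c0}"
      proof
        fix x assume x: "x \<in> affine_lattice (P \<inter> int_lattice)"
        have "int d dvd ip f s + c0" if "s \<in> X" for s
          using cong[of "\<Phi> s"] that f[of s] by simp
        then obtain p where "x = rvec p" "int d dvd ip f p + c0"
          using affine_lattice_congruence[of x X "int d" f c0] x X by metis
        then show "x \<in> rvec ` {p. int d dvd ip f p + c0}"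
          by blast
      qed
      show "rvec ` {p. int d dvd ip f p + c0} \<subseteq> affine_lattice (P \<inter> int_lattice)"
      proof
        fix x assume "x \<in> rvec ` {p. int d dvd ip f p + c0}"
        then obtain p where p: "x = rvec p" "int d dvd ip g (\<Phi> p)"
          by (auto simp: f)
        obtain a b c where abc: "\<Phi> p = a *s v1 + b *s v2 + c *s v3"
          using frame[OF p(2)] by blast
        define y where "y = w0 + a *s (w1 - w0) + b *s (w2 - w0) + c *s (w3 - w0)"
        have "\<Phi> y = \<Phi> w0 + a *s (\<Phi> w1 - \<Phi> w0) + b *s (\<Phi> w2 - \<Phi> w0) + c *s (\<Phi> w3 - \<Phi> w0)"
          by (simp add: y_def A(2) vec_eq_iff matrix_vector_mult_def sum_3 algebra_simps)
        then have "\<Phi> y = \<Phi> p"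
          using abc w by simp
        then have "p = y"
          using \<Psi>(2) by metis
        then show "x \<in> affine_lattice (P \<inter> int_lattice)"
          using affine_lattice_combination[OF w(1-4)] unfolding X p(1) y_def by simp
      qed
    qed
    have "ip f (\<Psi> e) + c0 = 1" "ip f w0 + c0 = 0"
      using f[of "\<Psi> e"] f[of w0] \<Psi>(3) e w(5) by simp_all
    then show "ip f (\<Psi> e - w0) = 1"
      by simp
  qed
qed

text \<open>Base and axis satisfy that \<open>x + y\<close> is even in the first family and that
  \<open>x - y\<close> is divisible by 3 in the second. Conversely two base points and
  \<open>pt 0 0 1\<close>, available as \<open>m \<ge> 1\<close>, generate all solutions.\<close>

lemma base_index:
  assumes X: "P \<inter> int_lattice = rvec ` X" and um: "umap \<Phi>"
    and im: "\<Phi> ` X = zsegment 0 m \<union> B" and m: "m \<ge> 1"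
  shows "B = base2 \<Longrightarrow> sublattice_index P = 2" and "B = base3 \<Longrightarrow> sublattice_index P = 3"
proof -
  have 0: "0 \<in> \<Phi> ` X" and z: "pt 0 0 1 \<in> \<Phi> ` X"
    using m by (simp_all add: im zsegment_def)
  show "sublattice_index P = 2" if B: "B = base2"
  proof (rule umap_index[OF X um, of 2 "pt 1 1 0" "pt 1 (- 1) 0" "pt (- 1) (- 1) 1" "pt 0 0 1" "pt 1 0 0"])
    show "int 2 dvd ip (pt 1 1 0) x" if "x \<in> \<Phi> ` X" for x
      using that by (auto simp: im B base2_def zsegment_def ip_def)
    show "\<exists>a b c. x = a *s pt 1 (- 1) 0 + b *s pt (- 1) (- 1) 1 + c *s pt 0 0 1" if x: "int 2 dvd ip (pt 1 1 0) x" for x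
    proof -
      have "2 dvd x$1 + x$2"
        using x by (simp add: ip_def)
      then obtain k where k: "x$1 + x$2 = 2 * k"
        by (elim dvdE)
      then have "x = (x$1 - k) *s pt 1 (- 1) 0 + (- k) *s pt (- 1) (- 1) 1 + (x$3 + k) *s pt 0 0 1"
        by (simp add: vec_eq_iff forall_3)
      then show ?thesis
        by blast
    qed
  qed (use 0 z in \<open>simp_all add: im B base2_def ip_def\<close>)
  show "sublattice_index P = 3" if B: "B = base3"
  proof (rule umap_index[OF X um, of 3 "pt 1 (- 1) 0" "pt 2 (- 1) 1" "pt (- 1) (- 1) 0" "pt 0 0 1" "pt 1 0 0"])
    show "int 3 dvd ip (pt 1 (- 1) 0) x" if "x \<in> \<Phi> ` X" for x
      using that by (auto simp: im B base3_def zsegment_def ip_def)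
    show "\<exists>a b c. x = a *s pt 2 (- 1) 1 + b *s pt (- 1) (- 1) 0 + c *s pt 0 0 1" if x: "int 3 dvd ip (pt 1 (- 1) 0) x" for x
    proof -
      have "3 dvd x$1 - x$2"
        using x by (simp add: ip_def)
      then obtain k where k: "x$1 - x$2 = 3 * k"
        by (elim dvdE)
      then have "x = k *s pt 2 (- 1) 1 + (2 * k - x$1) *s pt (- 1) (- 1) 0 + (x$3 - k) *s pt 0 0 1"
        by (simp add: vec_eq_iff forall_3)
      then show ?thesis
        by blast
    qed
  qed (use 0 z in \<open>simp_all add: im B base3_def ip_def\<close>)
qed

section \<open>Convex hulls of the exceptional configurations\<close>

lemma umap_unimodular_equiv:
  assumes "umap \<Phi>"
  shows "convex hull (rvec ` X) \<cong>\<^sub>u convex hull (rvec ` \<Phi> ` X)"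
proof -
  obtain A t where A: "\<bar>det A\<bar> = 1" "\<Phi> = (\<lambda>p. A *v p + t)"
    using assms unfolding umap_def by blast
  define R :: "real^3^3" where "R = (\<chi> i j. of_int (A$i$j))"
  have "det R = of_int (det A)"
    by (simp add: det_3 R_def)
  then have "\<bar>det R\<bar> = 1"
    using A(1) by (metis of_int_1 of_int_abs)
  have R: "R *v rvec p + rvec t = rvec (\<Phi> p)" for p
    by (simp add: R_def A(2) vec_eq_iff matrix_vector_mult_def)
  have "(\<lambda>x. R *v x + rvec t) ` (convex hull (rvec ` X)) = (+) (rvec t) ` (*v) R ` (convex hull (rvec ` X))"
    by (simp add: image_image add.commute)
  also have "\<dots> = convex hull ((+) (rvec t) ` (*v) R ` rvec ` X)"
    by (simp add: convex_hull_linear_image convex_hull_translation)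
  also have "(+) (rvec t) ` (*v) R ` rvec ` X = rvec ` \<Phi> ` X"
    using R by (simp add: image_image add.commute)
  finally show ?thesis
    unfolding unimodular_equiv_def using \<open>\<bar>det R\<bar> = 1\<close>
    by (intro exI[of _ R] exI[of _ "rvec t"]) (auto simp: R_def int_lattice_eq)
qed

lemma convex_hull_zsegment_base:
  assumes m: "m > 0" and 0: "0 \<in> convex hull (insert (rvec (pt 0 0 m)) (rvec ` B))"
  shows "convex hull (rvec ` (zsegment 0 m \<union> B)) = convex hull (insert (rvec (pt 0 0 m)) (rvec ` B))"
proof
  let ?K = "convex hull (insert (rvec (pt 0 0 m)) (rvec ` B))"
  have "rvec x \<in> ?K" if x: "x \<in> zsegment 0 m" for x
  proof -
    define u where "u = real_of_int (x$3) / real_of_int m"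
    have "u \<ge> 0" "u \<le> 1"
      using x m by (auto simp: u_def zsegment_def)
    then have "(1 - u) *\<^sub>R 0 + u *\<^sub>R rvec (pt 0 0 m) \<in> ?K"
      by (intro convexD[OF convex_convex_hull] 0 hull_inc) auto
    moreover have "u *\<^sub>R rvec (pt 0 0 m) = rvec x"
      using x m by (auto simp: u_def zsegment_def vec_eq_iff forall_3)
    ultimately show ?thesis
      by simp
  qed
  moreover have "rvec x \<in> ?K" if "x \<in> B" for x
    using that by (auto intro: hull_inc)
  ultimately show "convex hull (rvec ` (zsegment 0 m \<union> B)) \<subseteq> ?K"
    by (intro hull_minimal) auto
  have "pt 0 0 m \<in> zsegment 0 m"
    using m by (simp add: pt_zsegment)
  then show "?K \<subseteq> convex hull (rvec ` (zsegment 0 m \<union> B))"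
    by (intro hull_mono) auto
qed

lemma base2_hull:
  assumes "m > 0"
  shows "convex hull (rvec ` (zsegment 0 m \<union> base2)) =
    convex hull {vector [1, -1, 0], vector [-1, 1, 0], vector [-1, -1, 1], vector [0, 0, of_int m]}"
proof -
  have *: "insert (rvec (pt 0 0 m)) (rvec ` base2) =
      {vector [1, -1, 0], vector [-1, 1, 0], vector [-1, -1, 1], vector [0, 0, of_int m]}"
  proof -
    have "rvec (pt 1 (- 1) 0) = vector [1, -1, 0]" "rvec (pt (- 1) 1 0) = vector [-1, 1, 0]"
      "rvec (pt (- 1) (- 1) 1) = vector [-1, -1, 1]" "rvec (pt 0 0 m) = vector [0, 0, of_int m]"
      by (simp_all add: vec_eq_iff forall_3)
    then show ?thesis
      by (auto simp: base2_def)
  qed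
  have "(1/2) *\<^sub>R rvec (pt 1 (- 1) 0) + (1/2) *\<^sub>R rvec (pt (- 1) 1 0) \<in> convex hull (insert (rvec (pt 0 0 m)) (rvec ` base2))"
    by (intro convexD[OF convex_convex_hull] hull_inc) (auto simp: base2_def)
  moreover have "(1/2) *\<^sub>R rvec (pt 1 (- 1) 0) + (1/2) *\<^sub>R rvec (pt (- 1) 1 0) = 0"
    by (simp add: vec_eq_iff forall_3)
  ultimately show ?thesis
    using convex_hull_zsegment_base[OF assms, of base2] * by simp
qed

lemma base3_hull:
  assumes "m > 0"
  shows "convex hull (rvec ` (zsegment 0 m \<union> base3)) =
    convex hull {vector [2, -1, 1], vector [-1, 2, -1], vector [-1, -1, 0], vector [0, 0, of_int m]}"
proof -
  have *: "insert (rvec (pt 0 0 m)) (rvec ` base3) =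
      {vector [2, -1, 1], vector [-1, 2, -1], vector [-1, -1, 0], vector [0, 0, of_int m]}"
  proof -
    have "rvec (pt 2 (- 1) 1) = vector [2, -1, 1]" "rvec (pt (- 1) 2 (- 1)) = vector [-1, 2, -1]"
      "rvec (pt (- 1) (- 1) 0) = vector [-1, -1, 0]" "rvec (pt 0 0 m) = vector [0, 0, of_int m]"
      by (simp_all add: vec_eq_iff forall_3)
    then show ?thesis
      by (auto simp: base3_def)
  qed
  let ?K = "convex hull (insert (rvec (pt 0 0 m)) (rvec ` base3))"
  have "(1/2) *\<^sub>R rvec (pt 2 (- 1) 1) + (1/2) *\<^sub>R rvec (pt (- 1) 2 (- 1)) \<in> ?K"
    by (intro convexD[OF convex_convex_hull] hull_inc) (auto simp: base3_def)
  \<comment> \<open>The centroid of the base, formed from a midpoint and the third point because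
    \<open>convexD\<close> combines two points at a time.\<close>
  then have "(2/3) *\<^sub>R ((1/2) *\<^sub>R rvec (pt 2 (- 1) 1) + (1/2) *\<^sub>R rvec (pt (- 1) 2 (- 1))) + (1/3) *\<^sub>R rvec (pt (- 1) (- 1) 0) \<in> ?K"
    by (intro convexD[OF convex_convex_hull]) (auto simp: base3_def intro: hull_inc)
  moreover have "(2/3) *\<^sub>R ((1/2) *\<^sub>R rvec (pt 2 (- 1) 1) + (1/2) *\<^sub>R rvec (pt (- 1) 2 (- 1))) + (1/3) *\<^sub>R rvec (pt (- 1) (- 1) 0) = 0"
    by (simp add: vec_eq_iff forall_3)
  ultimately show ?thesis
    using convex_hull_zsegment_base[OF assms, of base3] * by simp
qed

section \<open>From the polytope to its lattice points\<close>

locale lattice_polytope_width_gt_1 =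
  fixes P :: "(real^3) set" and X V :: "(int^3) set"
  assumes P3: "lattice_3_polytope P" and width: "lattice_width P > 1"
    and X_def: "X = {p. rvec p \<in> P}" and V_def: "V = {p. rvec p extreme_point_of P}"
begin

lemma polytope_P: "polytope P" "{v. v extreme_point_of P} \<subseteq> int_lattice" "aff_dim P = 3"
  using P3 by (auto simp: lattice_3_polytope_def lattice_polytope_def)

lemma rvec_X: "P \<inter> int_lattice = rvec ` X"
  by (auto simp: X_def int_lattice_eq)

lemma rvec_V: "{v. v extreme_point_of P} = rvec ` V"
  using polytope_P(2) by (auto simp: V_def int_lattice_eq)

lemma V_subset: "V \<subseteq> X"
  by (auto simp: V_def X_def extreme_point_of_def)

lemma finite_X: "finite X"
  using finite_bounded_int_vectors polytope_imp_bounded[OF polytope_P(1)] rvec_X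
  by (metis bounded_Int)

lemma P_hull_V: "P = convex hull (rvec ` V)"
  using Krein_Milman_Minkowski[of P] polytope_P(1) rvec_V
  by (simp add: polytope_imp_compact polytope_imp_convex)

lemma P_hull: "P = convex hull (rvec ` X)"
proof
  show "P \<subseteq> convex hull (rvec ` X)"
    using P_hull_V V_subset by (metis hull_mono image_mono)
  show "convex hull (rvec ` X) \<subseteq> P"
    using polytope_imp_convex[OF polytope_P(1)] by (intro hull_minimal) (auto simp: X_def)
qed

lemma card_X: "card X = lattice_size P"
proof -
  have "inj_on rvec X"
    using inj_rvec inj_on_subset by blast
  then show ?thesis
    by (simp add: lattice_size_def rvec_X card_image)
qed

lemma X_nonempty: "X \<noteq> {}"
  using P_hull polytope_P(3) by force

lemma wide_X: "wide X"
  using lattice_width_gt_1[OF finite_X X_nonempty] width P_hull by simp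

lemma card_V: "card V \<ge> 4"
proof -
  have fin: "finite V"
    using V_subset finite_X finite_subset by blast
  have "aff_dim (rvec ` V) = 3"
    using polytope_P(3) P_hull_V by (metis aff_dim_convex_hull)
  moreover have "aff_dim (rvec ` V) \<le> int (card (rvec ` V)) - 1"
    using fin by (intro aff_dim_le_card) simp
  moreover have "card (rvec ` V) \<le> card V"
    using fin by (rule card_image_le)
  ultimately show ?thesis
    by linarith
qed

lemma vertex_combination:
  assumes "s \<in> X"
  shows "\<exists>c. (\<forall>v\<in>V. 0 \<le> c v) \<and> sum c V = (1 :: real) \<and>
      (\<forall>f. (\<Sum>v\<in>V. c v * real_of_int (ip f v)) = real_of_int (ip f s))"
proof -
  have fin: "finite (rvec ` V)"
    using V_subset finite_X finite_subset by blast
  have inj: "inj_on rvec V"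
    using inj_rvec inj_on_subset by blast
  have "rvec s \<in> convex hull (rvec ` V)"
    using assms P_hull_V by (auto simp: X_def)
  then obtain u where u: "\<forall>x\<in>rvec ` V. 0 \<le> u x" "sum u (rvec ` V) = 1" "(\<Sum>x\<in>rvec ` V. u x *\<^sub>R x) = rvec s"
    unfolding convex_hull_finite[OF fin] by blast
  have "(\<Sum>v\<in>V. u (rvec v) * real_of_int (ip f v)) = real_of_int (ip f s)" for f
  proof -
    have "real_of_int (ip f s) = rvec f \<bullet> (\<Sum>x\<in>rvec ` V. u x *\<^sub>R x)"
      by (simp add: u(3) inner_rvec)
    also have "\<dots> = (\<Sum>v\<in>V. u (rvec v) * real_of_int (ip f v))"
      by (simp add: inner_sum_right sum.reindex[OF inj] inner_rvec)
    finally show ?thesis ..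
  qed
  then show ?thesis
    using u(1,2) by (intro exI[of _ "\<lambda>v. u (rvec v)"]) (auto simp: sum.reindex[OF inj])
qed

text \<open>Deleting an extreme point leaves a convex set, which contains the hull of the other
  lattice points.\<close>

lemma vertex_not_in_hull:
  assumes "u \<in> V"
  shows "rvec u \<notin> convex hull (rvec ` (X - {u}))"
proof -
  have "convex (P - {rvec u})"
    using assms extreme_point_of_stillconvex[of P "rvec u"] polytope_imp_convex[OF polytope_P(1)]
    by (auto simp: V_def extreme_point_of_def)
  then have "convex hull (rvec ` (X - {u})) \<subseteq> P - {rvec u}"
    by (intro hull_minimal) (auto simp: X_def)
  then show ?thesis
    by blast
qed

lemma remove_vertex: "remove_point P (rvec u) = convex hull (rvec ` (X - {u}))"
proof -
  have "rvec ` X - {rvec u} = rvec ` (X - {u})"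
    by auto
  then show ?thesis
    by (simp add: remove_point_def rvec_X)
qed

text \<open>The second removal starts from the lattice points of the smaller polytope. These are the
  points of \<open>X\<close> other than \<open>u\<close>, because a vertex is not in the hull of the
  rest.\<close>

lemma remove_two_vertices:
  assumes "u \<in> V"
  shows "remove_point (remove_point P (rvec u)) (rvec v) = convex hull (rvec ` (X - {u, v}))"
proof -
  have "convex hull (rvec ` (X - {u})) \<subseteq> P"
    using P_hull by (metis Diff_subset hull_mono image_mono)
  then have "convex hull (rvec ` (X - {u})) \<inter> int_lattice \<subseteq> rvec ` (X - {u})"
    using vertex_not_in_hull[OF assms] rvec_X by blast
  moreover have "rvec ` (X - {u}) \<subseteq> convex hull (rvec ` (X - {u})) \<inter> int_lattice"
    using hull_subset[of "rvec ` (X - {u})"] int_lattice_eq by blast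
  ultimately have "convex hull (rvec ` (X - {u})) \<inter> int_lattice = rvec ` (X - {u})"
    by (rule equalityI)
  moreover have "rvec ` (X - {u}) - {rvec v} = rvec ` (X - {u, v})"
    by auto
  ultimately show ?thesis
    unfolding remove_vertex by (simp add: remove_point_def)
qed

lemma exposed_vertex:
  assumes "exposed X u"
  shows "u \<in> V"
proof -
  obtain f where f: "u \<in> X" "\<And>p. p \<in> X - {u} \<Longrightarrow> ip f p < ip f u"
    using assms by (auto simp: exposed_def)
  have "rvec ` (X - {u}) \<subseteq> {x. rvec f \<bullet> x < of_int (ip f u)}"
    using f(2) by (auto simp: inner_rvec)
  then have "convex hull (rvec ` (X - {u})) \<subseteq> {x. rvec f \<bullet> x < of_int (ip f u)}"
    by (intro hull_minimal convex_halfspace_lt)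
  then have "rvec u \<notin> convex hull (rvec ` (X - {u}))"
    by (auto simp: inner_rvec)
  then have "rvec u extreme_point_of convex hull (insert (rvec u) (rvec ` (X - {u})))"
    using finite_X by (intro extreme_point_of_convex_hull_insert) auto
  moreover have "insert (rvec u) (rvec ` (X - {u})) = rvec ` X"
    using f(1) by auto
  ultimately show ?thesis
    using P_hull by (simp add: V_def)
qed

lemma not_merged_vertices:
  assumes "\<not> merged P" "u \<in> V" "v \<in> V" "u \<noteq> v" "card X \<ge> 2"
  shows "\<not> wide (X - {u}) \<or> \<not> wide (X - {v}) \<or> flat (X - {u, v})"
proof (rule ccontr)
  assume *: "\<not> ?thesis"
  have ne: "X - {w} \<noteq> {}" for w
    using assms(5) finite_X by (metis Diff_eq_empty_iff card.empty card.insert card_mono empty_iff finite.emptyI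
        finite.insertI not_less_eq_eq numeral_2_eq_2 One_nat_def)
  have "rvec u extreme_point_of P" "rvec v extreme_point_of P" "rvec u \<noteq> rvec v"
    using assms(2-4) by (auto simp: V_def)
  moreover have "lattice_width (remove_point P (rvec u)) > 1" "lattice_width (remove_point P (rvec v)) > 1"
    unfolding remove_vertex using * lattice_width_gt_1 ne finite_X by auto
  moreover have "aff_dim (remove_point (remove_point P (rvec u)) (rvec v)) = 3"
    unfolding remove_two_vertices[OF assms(2)] using * not_flat_aff_dim by blast
  ultimately have "merged P"
    unfolding merged_def using P3 width by blast
  then show False
    using assms(1) by blast
qed

end

theorem theorem5p2:
  fixes P :: "(real^3) set" and n :: nat
  assumes "lattice_3_polytope P"
    and "lattice_width P > 1"
    and "lattice_size P = n"
    and "n \<ge> 8"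
    and "\<not> merged P"
  shows "((\<exists>T. unimodular_tetrahedron T \<and> T \<subseteq> P) \<and> spanning P) \<or>
    (sublattice_index P = 2 \<and>
       P \<cong>\<^sub>u convex hull {vector [1, -1, 0], vector [-1, 1, 0],
                         vector [-1, -1, 1], vector [0, 0, real n - 4]}) \<or>
    (sublattice_index P = 3 \<and>
       P \<cong>\<^sub>u convex hull {vector [2, -1, 1], vector [-1, 2, -1],
                         vector [-1, -1, 0], vector [0, 0, real n - 4]})"
proof -
  define X V where "X = {p. rvec p \<in> P}" and "V = {p. rvec p extreme_point_of P}"
  interpret lattice_polytope_width_gt_1 P X V
    by unfold_locales (use assms X_def V_def in auto)
  have card: "card X = n"
    using card_X assms(3) by simp
  show ?thesis
  proof (cases "no_unimodular X")
    case False
    then obtain p q r s where pqrs: "p \<in> X" "q \<in> X" "r \<in> X" "s \<in> X" "\<bar>idet (q - p) (r - p) (s - p)\<bar> = 1"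
      by (auto simp: no_unimodular_def)
    have "convex hull (rvec ` {p, q, r, s}) \<subseteq> P"
      unfolding P_hull using pqrs by (intro hull_mono) auto
    then show ?thesis
      using unimodular_tetrahedron_convex_hull[OF pqrs(5)] unimodular_frame_index[OF rvec_X pqrs]
      unfolding spanning_def by blast
  next
    case True
    have nm: "\<not> wide (X - {u}) \<or> \<not> wide (X - {v}) \<or> flat (X - {u, v})"
      if "u \<in> V" "v \<in> V" "u \<noteq> v" for u v
      using not_merged_vertices[OF assms(5) that] card assms(4) by simp
    have sat: "saturated X"
      unfolding X_def using polytope_imp_convex[OF polytope_P(1)] by (rule convex_saturated)
    interpret non_merged_points X V
      by unfold_locales
        (use finite_X sat True wide_X card assms(4) V_subset card_V vertex_combination nm in simp_all)
    have "exposed_points X"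
      by unfold_locales (use nm exposed_vertex in blast)
    moreover obtain f1 f2 v1 v2 v3 where "spike X f1 f2 v1 v2 v3"
      using spike_exists by blast
    ultimately obtain \<Phi> m B where um: "umap \<Phi>" and B: "B = base2 \<or> B = base3"
      and im: "\<Phi> ` X = zsegment 0 m \<union> B" and m: "int (card X) = m + 4"
      by (rule exposed_spike_normal_form)
    have m': "m \<ge> 1" "m > 0" "real_of_int m = real n - 4"
      using m card assms(4) by linarith+
    have "P \<cong>\<^sub>u convex hull (rvec ` (zsegment 0 m \<union> B))"
      using umap_unimodular_equiv[OF um, of X] P_hull im by simp
    then show ?thesis
      using B base_index[OF rvec_X um im m'(1)] base2_hull[OF m'(2)] base3_hull[OF m'(2)] m'(3)
      by (elim disjE) simp_all
  qed
qed

end
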